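(* Let $(M,\omega,D)$ be a manifold with a non-degenerate 2-form $\omega$ and a linear connection $D$. The almost complex structure on $T^*M$ defined by $D$ and the (skew-symmetric) generalized complex structure $$\mathcal J^{\omega}=\begin{pmatrix}0&\omega^{-1}\\-\omega&0\end{pmatrix}$$ is integrable if and only if $D$ is flat and, for any $X,Y,Z\in\mathcal X(M)$, $$(d\omega)(X,Y,Z)-(D_Z\omega)(X,Y)-\omega(T^D_ZX,Y)-\omega(X,T^D_ZY)=0,$$ where $T^D$ is the torsion of $D$.
   Context: $\omega$ is viewed as a map $TM\to T^*M$, $X\mapsto i_X\omega$. The connection $D$, acting on $\pi:T^*M\to M$, induces a decomposition $T(T^*M)=H^D\oplus T^{\mathrm{vert}}(T^*M)\cong\pi^*(TM)\oplus\pi^*(T^*M)=\pi^*(TM\oplus T^*M)$ into horizontal and vertical bundles. The almost complex structure on $T^*M$ defined by $D$ and a field $\mathcal J$ of endomorphisms of $TM\oplus T^*M$ with $\mathcal J^2=-\mathrm{Id}$ is $\pi^*(\mathcal J)$ under this identification. "Skew-symmetric" refers to the metric $\frac12(\xi(Y)+\eta(X))$ on $TM\oplus T^*M$. $T^D_XY=D_XY-D_YX-[X,Y]$; $\mathcal X(M)$ denotes smooth vector fields. *)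

theory Defs
  imports "HOL-Analysis.Analysis"
begin

section \<open>Smooth maps and smooth manifolds\<close>

text \<open>Only used for open sets \<open>S\<close> of finite-dimensional spaces.\<close>

primrec Ck_on :: "nat \<Rightarrow> 'v::real_normed_vector set \<Rightarrow> ('v \<Rightarrow> 'w::real_normed_vector) \<Rightarrow> bool" where
  "Ck_on 0 S f \<longleftrightarrow> continuous_on S f"
| "Ck_on (Suc k) S f \<longleftrightarrow>
     (\<forall>x\<in>S. f differentiable at x) \<and> (\<forall>v. Ck_on k S (\<lambda>x. frechet_derivative f (at x) v))"

definition smooth_on :: "'v::real_normed_vector set \<Rightarrow> ('v \<Rightarrow> 'w::real_normed_vector) \<Rightarrow> bool" where
  "smooth_on S f \<longleftrightarrow> (\<forall>k. Ck_on k S f)"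

text \<open>A chart is a pair of a domain and a coordinate map, the latter being relevant only on the
  domain. The model space \<open>'e\<close> plays the role of \<open>\<real>\<^sup>n\<close>.\<close>

type_synonym ('a, 'e) chart = "'a set \<times> ('a \<Rightarrow> 'e)"

definition chart_inv :: "('a, 'e) chart \<Rightarrow> 'e \<Rightarrow> 'a" where
  "chart_inv c = inv_into (fst c) (snd c)"

definition smooth_manifold :: "'a topology \<Rightarrow> ('a, 'e::euclidean_space) chart set \<Rightarrow> bool" where
  "smooth_manifold T A \<longleftrightarrow>
     Hausdorff_space T \<and> second_countable T \<and>
     \<Union> (fst ` A) = topspace T \<and>
     (\<forall>(U, \<phi>)\<in>A. openin T U \<and> open (\<phi> ` U) \<and>
        homeomorphic_map (subtopology T U) (top_of_set (\<phi> ` U)) \<phi>) \<and>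
     (\<forall>c\<in>A. \<forall>d\<in>A. smooth_on (snd c ` (fst c \<inter> fst d)) (snd d \<circ> chart_inv c))"

text \<open>The underlying point set of the manifold with atlas \<open>A\<close>.\<close>

definition points :: "('a, 'e) chart set \<Rightarrow> 'a set" where
  "points A = \<Union> (fst ` A)"

definition charts_at :: "('a, 'e) chart set \<Rightarrow> 'a \<Rightarrow> ('a, 'e) chart set" where
  "charts_at A p = {c \<in> A. p \<in> fst c}"

definition some_chart :: "('a, 'e) chart set \<Rightarrow> 'a \<Rightarrow> ('a, 'e) chart" where
  "some_chart A p = (SOME c. c \<in> charts_at A p)"

definition smooth_fun :: "('a, 'e::euclidean_space) chart set \<Rightarrow> ('a \<Rightarrow> real) \<Rightarrow> bool" where
  "smooth_fun A f \<longleftrightarrow> (\<forall>c\<in>A. smooth_on (snd c ` fst c) (f \<circ> chart_inv c))"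

section \<open>Tangent and cotangent spaces\<close>

text \<open>A tangent vector at \<open>p\<close> is a class of pairs (chart around \<open>p\<close>, vector of \<open>'e\<close>), two pairs being
  identified when the derivative of the transition map matches them. The class is encoded as the
  function that assigns to each chart around \<open>p\<close> its vector, and \<open>0\<close> to all other charts; so the
  tangent space is \<open>{0}\<close> outside of the manifold.\<close>

type_synonym ('a, 'e) tvec = "('a, 'e) chart \<Rightarrow> 'e"
type_synonym ('a, 'e) covec = "('a, 'e) tvec \<Rightarrow> real"

definition vadd :: "('x \<Rightarrow> 'v::real_vector) \<Rightarrow> ('x \<Rightarrow> 'v) \<Rightarrow> ('x \<Rightarrow> 'v)"  (infixl "+\<^sub>v" 65) where
  "v +\<^sub>v w = (\<lambda>x. v x + w x)"

definition vdiff :: "('x \<Rightarrow> 'v::real_vector) \<Rightarrow> ('x \<Rightarrow> 'v) \<Rightarrow> ('x \<Rightarrow> 'v)"  (infixl "-\<^sub>v" 65) where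
  "v -\<^sub>v w = (\<lambda>x. v x - w x)"

definition vscale :: "real \<Rightarrow> ('x \<Rightarrow> 'v::real_vector) \<Rightarrow> ('x \<Rightarrow> 'v)"  (infixr "*\<^sub>v" 70) where
  "a *\<^sub>v v = (\<lambda>x. a *\<^sub>R v x)"

definition vzero :: "'x \<Rightarrow> 'v::real_vector"  ("0\<^sub>v") where
  "0\<^sub>v = (\<lambda>x. 0)"

definition tangent_space :: "('a, 'e::euclidean_space) chart set \<Rightarrow> 'a \<Rightarrow> ('a, 'e) tvec set" where
  "tangent_space A p = {v.
     (\<forall>c\<in>charts_at A p. \<forall>d\<in>charts_at A p.
        v d = frechet_derivative (snd d \<circ> chart_inv c) (at (snd c p)) (v c)) \<and>
     (\<forall>c. c \<notin> charts_at A p \<longrightarrow> v c = 0)}"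

text \<open>The tangent vector at \<open>p\<close> whose component vector in the chart \<open>c\<close> is \<open>u\<close>.\<close>

definition coord_vec ::
    "('a, 'e::euclidean_space) chart set \<Rightarrow> ('a, 'e) chart \<Rightarrow> 'a \<Rightarrow> 'e \<Rightarrow> ('a, 'e) tvec" where
  "coord_vec A c p u = (\<lambda>d. if d \<in> charts_at A p
     then frechet_derivative (snd d \<circ> chart_inv c) (at (snd c p)) u else 0)"

text \<open>Linear forms on the tangent space, extended by \<open>0\<close> to all functions on charts.\<close>

definition cotangent_space :: "('a, 'e::euclidean_space) chart set \<Rightarrow> 'a \<Rightarrow> ('a, 'e) covec set" where
  "cotangent_space A p = {\<alpha>.
     (\<forall>v\<in>tangent_space A p. \<forall>w\<in>tangent_space A p. \<alpha> (v +\<^sub>v w) = \<alpha> v + \<alpha> w) \<and>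
     (\<forall>a. \<forall>v\<in>tangent_space A p. \<alpha> (a *\<^sub>v v) = a * \<alpha> v) \<and>
     (\<forall>v. v \<notin> tangent_space A p \<longrightarrow> \<alpha> v = 0)}"

text \<open>The differential at \<open>p\<close> of a map \<open>F\<close> between the manifolds with atlases \<open>A\<close> and \<open>B\<close>.\<close>

definition pushforward ::
    "('a, 'e::euclidean_space) chart set \<Rightarrow> ('b, 'f::euclidean_space) chart set \<Rightarrow> ('a \<Rightarrow> 'b) \<Rightarrow> 'a \<Rightarrow>
     ('a, 'e) tvec \<Rightarrow> ('b, 'f) tvec" where
  "pushforward A B F p v = (\<lambda>d. if d \<in> charts_at B (F p)
     then let c = some_chart A p
          in frechet_derivative (snd d \<circ> F \<circ> chart_inv c) (at (snd c p)) (v c)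
     else 0)"

section \<open>Vector fields and differential forms\<close>

type_synonym ('a, 'e) vfield = "'a \<Rightarrow> ('a, 'e) tvec"

definition vector_fields :: "('a, 'e::euclidean_space) chart set \<Rightarrow> ('a, 'e) vfield set" where
  "vector_fields A = {X. (\<forall>p. X p \<in> tangent_space A p) \<and>
     (\<forall>c\<in>A. smooth_on (snd c ` fst c) (\<lambda>x. X (chart_inv c x) c))}"

definition one_forms :: "('a, 'e::euclidean_space) chart set \<Rightarrow> ('a \<Rightarrow> ('a, 'e) covec) set" where
  "one_forms A = {s. (\<forall>p. s p \<in> cotangent_space A p) \<and>
     (\<forall>c\<in>A. \<forall>u. smooth_on (snd c ` fst c)
        (\<lambda>x. s (chart_inv c x) (coord_vec A c (chart_inv c x) u)))}"

definition two_forms ::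
    "('a, 'e::euclidean_space) chart set \<Rightarrow> ('a \<Rightarrow> ('a, 'e) tvec \<Rightarrow> ('a, 'e) tvec \<Rightarrow> real) set" where
  "two_forms A = {\<omega>.
     (\<forall>p\<in>points A. \<forall>v\<in>tangent_space A p. \<forall>w\<in>tangent_space A p. \<omega> p v w = - \<omega> p w v) \<and>
     (\<forall>p\<in>points A. \<forall>u\<in>tangent_space A p. \<forall>v\<in>tangent_space A p. \<forall>w\<in>tangent_space A p.
        \<omega> p (u +\<^sub>v v) w = \<omega> p u w + \<omega> p v w) \<and>
     (\<forall>p\<in>points A. \<forall>a. \<forall>v\<in>tangent_space A p. \<forall>w\<in>tangent_space A p.
        \<omega> p (a *\<^sub>v v) w = a * \<omega> p v w) \<and>
     (\<forall>c\<in>A. \<forall>u u'. smooth_on (snd c ` fst c)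
        (\<lambda>x. \<omega> (chart_inv c x) (coord_vec A c (chart_inv c x) u) (coord_vec A c (chart_inv c x) u')))}"

definition nondegenerate ::
    "('a, 'e::euclidean_space) chart set \<Rightarrow> ('a \<Rightarrow> ('a, 'e) tvec \<Rightarrow> ('a, 'e) tvec \<Rightarrow> real) \<Rightarrow> bool" where
  "nondegenerate A \<omega> \<longleftrightarrow> (\<forall>p\<in>points A. \<forall>v\<in>tangent_space A p.
     (\<forall>w\<in>tangent_space A p. \<omega> p v w = 0) \<longrightarrow> v = 0\<^sub>v)"

text \<open>The function \<open>X f\<close>.\<close>

definition lie_deriv ::
    "('a, 'e::euclidean_space) chart set \<Rightarrow> ('a, 'e) vfield \<Rightarrow> ('a \<Rightarrow> real) \<Rightarrow> 'a \<Rightarrow> real" where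
  "lie_deriv A X f p = (let c = some_chart A p
     in frechet_derivative (f \<circ> chart_inv c) (at (snd c p)) (X p c))"

text \<open>In each chart, \<open>[X, Y]\<^sup>k = X\<^sup>i \<partial>\<^sub>i Y\<^sup>k - Y\<^sup>i \<partial>\<^sub>i X\<^sup>k\<close>.\<close>

definition bracket ::
    "('a, 'e::euclidean_space) chart set \<Rightarrow> ('a, 'e) vfield \<Rightarrow> ('a, 'e) vfield \<Rightarrow> ('a, 'e) vfield" where
  "bracket A X Y p = (\<lambda>c. if c \<in> charts_at A p
     then frechet_derivative (\<lambda>x. Y (chart_inv c x) c) (at (snd c p)) (X p c)
        - frechet_derivative (\<lambda>x. X (chart_inv c x) c) (at (snd c p)) (Y p c)
     else 0)"

text \<open>Normalised without the factor \<open>1/3\<close>.\<close>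

definition ext_deriv2 ::
    "('a, 'e::euclidean_space) chart set \<Rightarrow> ('a \<Rightarrow> ('a, 'e) tvec \<Rightarrow> ('a, 'e) tvec \<Rightarrow> real) \<Rightarrow>
     ('a, 'e) vfield \<Rightarrow> ('a, 'e) vfield \<Rightarrow> ('a, 'e) vfield \<Rightarrow> 'a \<Rightarrow> real" where
  "ext_deriv2 A \<omega> X Y Z p =
       lie_deriv A X (\<lambda>q. \<omega> q (Y q) (Z q)) p
     - lie_deriv A Y (\<lambda>q. \<omega> q (X q) (Z q)) p
     + lie_deriv A Z (\<lambda>q. \<omega> q (X q) (Y q)) p
     - \<omega> p (bracket A X Y p) (Z p)
     + \<omega> p (bracket A X Z p) (Y p)
     - \<omega> p (bracket A Y Z p) (X p)"

section \<open>Linear connections\<close>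

type_synonym ('a, 'e) conn = "('a, 'e) vfield \<Rightarrow> ('a, 'e) vfield \<Rightarrow> ('a, 'e) vfield"

definition linear_connection :: "('a, 'e::euclidean_space) chart set \<Rightarrow> ('a, 'e) conn \<Rightarrow> bool" where
  "linear_connection A D \<longleftrightarrow>
     (\<forall>X\<in>vector_fields A. \<forall>Y\<in>vector_fields A. D X Y \<in> vector_fields A) \<and>
     (\<forall>X\<in>vector_fields A. \<forall>X'\<in>vector_fields A. \<forall>Y\<in>vector_fields A.
        D (\<lambda>p. X p +\<^sub>v X' p) Y = (\<lambda>p. D X Y p +\<^sub>v D X' Y p)) \<and>
     (\<forall>X\<in>vector_fields A. \<forall>Y\<in>vector_fields A. \<forall>Y'\<in>vector_fields A.
        D X (\<lambda>p. Y p +\<^sub>v Y' p) = (\<lambda>p. D X Y p +\<^sub>v D X Y' p)) \<and>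
     (\<forall>f. smooth_fun A f \<longrightarrow> (\<forall>X\<in>vector_fields A. \<forall>Y\<in>vector_fields A.
        D (\<lambda>p. f p *\<^sub>v X p) Y = (\<lambda>p. f p *\<^sub>v D X Y p) \<and>
        D X (\<lambda>p. f p *\<^sub>v Y p) = (\<lambda>p. (lie_deriv A X f p *\<^sub>v Y p) +\<^sub>v (f p *\<^sub>v D X Y p))))"

definition torsion ::
    "('a, 'e::euclidean_space) chart set \<Rightarrow> ('a, 'e) conn \<Rightarrow> ('a, 'e) vfield \<Rightarrow> ('a, 'e) vfield \<Rightarrow>
     ('a, 'e) vfield" where
  "torsion A D X Y p = (D X Y p -\<^sub>v D Y X p) -\<^sub>v bracket A X Y p"

definition curvature ::
    "('a, 'e::euclidean_space) chart set \<Rightarrow> ('a, 'e) conn \<Rightarrow> ('a, 'e) vfield \<Rightarrow> ('a, 'e) vfield \<Rightarrow>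
     ('a, 'e) vfield \<Rightarrow> ('a, 'e) vfield" where
  "curvature A D X Y Z p = (D X (D Y Z) p -\<^sub>v D Y (D X Z) p) -\<^sub>v D (bracket A X Y) Z p"

definition flat :: "('a, 'e::euclidean_space) chart set \<Rightarrow> ('a, 'e) conn \<Rightarrow> bool" where
  "flat A D \<longleftrightarrow> (\<forall>X\<in>vector_fields A. \<forall>Y\<in>vector_fields A. \<forall>Z\<in>vector_fields A. \<forall>p\<in>points A.
     curvature A D X Y Z p = 0\<^sub>v)"

text \<open>\<open>(D\<^sub>Z \<omega>)(X, Y)\<close>.\<close>

definition cov_deriv2 ::
    "('a, 'e::euclidean_space) chart set \<Rightarrow> ('a, 'e) conn \<Rightarrow>
     ('a \<Rightarrow> ('a, 'e) tvec \<Rightarrow> ('a, 'e) tvec \<Rightarrow> real) \<Rightarrow>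
     ('a, 'e) vfield \<Rightarrow> ('a, 'e) vfield \<Rightarrow> ('a, 'e) vfield \<Rightarrow> 'a \<Rightarrow> real" where
  "cov_deriv2 A D \<omega> Z X Y p =
     lie_deriv A Z (\<lambda>q. \<omega> q (X q) (Y q)) p - \<omega> p (D Z X p) (Y p) - \<omega> p (X p) (D Z Y p)"

text \<open>\<open>(D\<^sub>X s)(Y)\<close> for the dual connection on 1-forms.\<close>

definition cov_deriv1 ::
    "('a, 'e::euclidean_space) chart set \<Rightarrow> ('a, 'e) conn \<Rightarrow> ('a, 'e) vfield \<Rightarrow>
     ('a \<Rightarrow> ('a, 'e) covec) \<Rightarrow> ('a, 'e) vfield \<Rightarrow> 'a \<Rightarrow> real" where
  "cov_deriv1 A D X s Y p = lie_deriv A X (\<lambda>q. s q (Y q)) p - s p (D X Y p)"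

section \<open>The cotangent bundle as a manifold\<close>

text \<open>The chart of the cotangent bundle induced by a chart \<open>(x\<^sup>1, \<dots>, x\<^sup>n)\<close> of the base is
  \<open>(x\<^sup>1, \<dots>, x\<^sup>n, \<xi>\<^sub>1, \<dots>, \<xi>\<^sub>n)\<close> with \<open>\<xi>\<^sub>i = \<alpha> (\<partial>\<^sub>i)\<close>.\<close>

type_synonym ('a, 'e) ctpoint = "'a \<times> ('a, 'e) covec"

definition cot_chart ::
    "('a, 'e::euclidean_space) chart set \<Rightarrow> ('a, 'e) chart \<Rightarrow> (('a, 'e) ctpoint, 'e \<times> 'e) chart" where
  "cot_chart A c =
     ({(p, \<alpha>). p \<in> fst c \<and> \<alpha> \<in> cotangent_space A p},
      \<lambda>(p, \<alpha>). (snd c p, \<Sum>b\<in>Basis. \<alpha> (coord_vec A c p b) *\<^sub>R b))"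

definition cot_atlas ::
    "('a, 'e::euclidean_space) chart set \<Rightarrow> (('a, 'e) ctpoint, 'e \<times> 'e) chart set" where
  "cot_atlas A = cot_chart A ` A"

text \<open>The vertical lift of \<open>\<beta>\<close> at \<open>(p, \<alpha>)\<close> is the velocity at \<open>t = 0\<close> of the curve
  \<open>t \<mapsto> (p, \<alpha> + t \<beta>)\<close>.\<close>

definition vlift ::
    "('a, 'e::euclidean_space) chart set \<Rightarrow> ('a, 'e) ctpoint \<Rightarrow> ('a, 'e) covec \<Rightarrow>
     (('a, 'e) ctpoint, 'e \<times> 'e) tvec" where
  "vlift A z \<beta> = (\<lambda>d. if d \<in> charts_at (cot_atlas A) z
     then vector_derivative (\<lambda>t. snd d (fst z, snd z +\<^sub>v (t *\<^sub>v \<beta>))) (at 0) else 0)"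

text \<open>The horizontal space at \<open>z = (p, \<alpha>)\<close> consists of the differentials \<open>ds (X\<^sub>p)\<close> of the 1-forms \<open>s\<close>,
  seen as sections, that pass through \<open>z\<close> and are parallel at \<open>p\<close> in the direction \<open>X\<^sub>p\<close>.\<close>

definition horizontal ::
    "('a, 'e::euclidean_space) chart set \<Rightarrow> ('a, 'e) conn \<Rightarrow> ('a, 'e) ctpoint \<Rightarrow>
     (('a, 'e) ctpoint, 'e \<times> 'e) tvec set" where
  "horizontal A D z = {pushforward A (cot_atlas A) (\<lambda>q. (q, s q)) (fst z) (X (fst z)) | X s.
     X \<in> vector_fields A \<and> s \<in> one_forms A \<and> s (fst z) = snd z \<and>
     (\<forall>Y\<in>vector_fields A. cov_deriv1 A D X s Y (fst z) = 0)}"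

text \<open>The inverse of the isomorphism \<open>H\<^sup>D \<cong> \<pi>\<^sup>* TM\<close> given by the differential of the projection.\<close>

definition hlift ::
    "('a, 'e::euclidean_space) chart set \<Rightarrow> ('a, 'e) conn \<Rightarrow> ('a, 'e) ctpoint \<Rightarrow> ('a, 'e) tvec \<Rightarrow>
     (('a, 'e) ctpoint, 'e \<times> 'e) tvec" where
  "hlift A D z v = (THE h. h \<in> horizontal A D z \<and> pushforward (cot_atlas A) A fst z h = v)"

text \<open>The isomorphism \<open>\<pi>\<^sup>* (TM \<oplus> T\<^sup>*M) \<cong> H\<^sup>D \<oplus> T\<^sup>v\<^sup>e\<^sup>r\<^sup>t (T\<^sup>*M) = T (T\<^sup>*M)\<close> at \<open>z\<close>.\<close>

definition splitting ::
    "('a, 'e::euclidean_space) chart set \<Rightarrow> ('a, 'e) conn \<Rightarrow> ('a, 'e) ctpoint \<Rightarrow>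
     ('a, 'e) tvec \<times> ('a, 'e) covec \<Rightarrow> (('a, 'e) ctpoint, 'e \<times> 'e) tvec" where
  "splitting A D z = (\<lambda>(v, \<beta>). hlift A D z v +\<^sub>v vlift A z \<beta>)"

text \<open>The almost complex structure \<open>\<pi>\<^sup>* \<J>\<close> on the cotangent bundle defined by \<open>D\<close> and a field \<open>\<J>\<close> of
  endomorphisms of \<open>TM \<oplus> T\<^sup>*M\<close>.\<close>

definition cot_structure ::
    "('a, 'e::euclidean_space) chart set \<Rightarrow> ('a, 'e) conn \<Rightarrow>
     ('a \<Rightarrow> ('a, 'e) tvec \<times> ('a, 'e) covec \<Rightarrow> ('a, 'e) tvec \<times> ('a, 'e) covec) \<Rightarrow>
     ('a, 'e) ctpoint \<Rightarrow> (('a, 'e) ctpoint, 'e \<times> 'e) tvec \<Rightarrow> (('a, 'e) ctpoint, 'e \<times> 'e) tvec" where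
  "cot_structure A D \<J> z w = splitting A D z (\<J> (fst z)
     (the_inv_into (tangent_space A (fst z) \<times> cotangent_space A (fst z)) (splitting A D z) w))"

section \<open>Generalized complex structures and integrability\<close>

text \<open>\<open>i\<^sub>v \<omega>\<close> as an element of the cotangent space.\<close>

definition flat_map ::
    "('a, 'e::euclidean_space) chart set \<Rightarrow> ('a \<Rightarrow> ('a, 'e) tvec \<Rightarrow> ('a, 'e) tvec \<Rightarrow> real) \<Rightarrow> 'a \<Rightarrow>
     ('a, 'e) tvec \<Rightarrow> ('a, 'e) covec" where
  "flat_map A \<omega> p v = (\<lambda>w. if w \<in> tangent_space A p then \<omega> p v w else 0)"

definition J_form ::
    "('a, 'e::euclidean_space) chart set \<Rightarrow> ('a \<Rightarrow> ('a, 'e) tvec \<Rightarrow> ('a, 'e) tvec \<Rightarrow> real) \<Rightarrow> 'a \<Rightarrow>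
     ('a, 'e) tvec \<times> ('a, 'e) covec \<Rightarrow> ('a, 'e) tvec \<times> ('a, 'e) covec" where
  "J_form A \<omega> p = (\<lambda>(v, \<beta>).
     (the_inv_into (tangent_space A p) (flat_map A \<omega> p) \<beta>, (- 1) *\<^sub>v flat_map A \<omega> p v))"

definition nijenhuis ::
    "('a, 'e::euclidean_space) chart set \<Rightarrow> ('a \<Rightarrow> ('a, 'e) tvec \<Rightarrow> ('a, 'e) tvec) \<Rightarrow>
     ('a, 'e) vfield \<Rightarrow> ('a, 'e) vfield \<Rightarrow> ('a, 'e) vfield" where
  "nijenhuis A J X Y p =
     ((bracket A (\<lambda>q. J q (X q)) (\<lambda>q. J q (Y q)) p -\<^sub>v J p (bracket A (\<lambda>q. J q (X q)) Y p))
       -\<^sub>v J p (bracket A X (\<lambda>q. J q (Y q)) p)) -\<^sub>v bracket A X Y p"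

text \<open>Integrability is taken in the sense of vanishing Nijenhuis tensor.\<close>

definition integrable_structure ::
    "('a, 'e::euclidean_space) chart set \<Rightarrow> ('a \<Rightarrow> ('a, 'e) tvec \<Rightarrow> ('a, 'e) tvec) \<Rightarrow> bool" where
  "integrable_structure A J \<longleftrightarrow> (\<forall>X\<in>vector_fields A. \<forall>Y\<in>vector_fields A. \<forall>p\<in>points A.
     nijenhuis A J X Y p = 0\<^sub>v)"

end

theory Submission
  imports Defs
begin

text \<open>In the chart \<open>(x, \<xi>)\<close> of the cotangent bundle induced by a chart of the base, let \<open>\<Gamma>\<close> be the
  Christoffel symbols of \<open>D\<close> and \<open>W\<close> the matrix of \<open>\<omega>\<close>. The almost complex structure \<open>J\<close> maps the
  horizontal lift \<open>H u = (u, \<xi> \<Gamma> u)\<close> to the vertical vector \<open>- (0, W u)\<close>. As the Nijenhuis tensor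
  \<open>N\<close> satisfies \<open>N (J X, Y) = - J (N (X, Y))\<close> and every tangent vector has the form \<open>H u + J (H v)\<close>, it
  vanishes iff it vanishes on horizontal vectors. The vertical part of \<open>N (H u, H v)\<close> comes from the
  curvature of \<open>D\<close> applied to \<open>\<xi>\<close>, and its horizontal part is \<open>\<omega>\<^sup>-\<^sup>1\<close> applied to
  \<open>D\<^sub>u (i\<^sub>v \<omega>) - D\<^sub>v (i\<^sub>u \<omega>) - i\<^bsub>[u, v]\<^esub> \<omega>\<close>, which expands to the compatibility condition. Bump functions
  provide the global fields on the base; on the cotangent bundle horizontal lifts of those suffice.\<close>

section \<open>Calculus\<close>

text \<open>Two mismatches between the definitions and the coordinate calculation shape the proof.
  The connection \<open>D\<close> accepts global fields only, so its locality and its Christoffel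
  symbols have to be extracted with cut-off frames; they are obtained near a given point, and every
  calculation takes place on such a neighbourhood. Moreover \<open>J\<close> contains the inverse of
  \<open>W\<close>, of which only differentiability is established, so the image under
  \<open>J\<close> of a smooth field is treated as differentiable and nothing more. Statements about
  brackets therefore ask for differentiability at a single point. This suffices because the
  derivatives of the fields cancel in the Nijenhuis tensor, which leaves an expression in the values
  of the fields and the first derivative of \<open>J\<close>. At a point of the fibre with
  coordinate \<xi>, the condition from the horizontal part does not involve \<xi> and the one from
  the vertical part is linear in it; letting \<xi> range over the whole fibre turns the latter into
  flatness.\<close>

abbreviation FD :: "('v::real_normed_vector \<Rightarrow> 'w::real_normed_vector) \<Rightarrow> 'v \<Rightarrow> 'v \<Rightarrow> 'w" where
  "FD f x \<equiv> frechet_derivative f (at x)"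

lemma FD_eq: "(f has_derivative f') (at x) \<Longrightarrow> FD f x = f'"
  by (metis frechet_derivative_at)

lemma FD_works: "f differentiable at x \<Longrightarrow> (f has_derivative FD f x) (at x)"
  using frechet_derivative_works by blast

lemma FD_bounded_linear: "f differentiable at x \<Longrightarrow> bounded_linear (FD f x)"
  using FD_works has_derivative_bounded_linear by blast

lemma has_derivative_cong_open:
  assumes "open S" "x \<in> S" "\<And>y. y \<in> S \<Longrightarrow> f y = g y"
  shows "(f has_derivative D) (at x) \<longleftrightarrow> (g has_derivative D) (at x)"
  using assms has_derivative_transform_within_open[of f D x UNIV S g]
    has_derivative_transform_within_open[of g D x UNIV S f] by auto

lemma FD_cong_open:
  assumes "open S" "x \<in> S" "\<And>y. y \<in> S \<Longrightarrow> f y = g y"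
  shows "FD f x = FD g x"
  unfolding frechet_derivative_def using has_derivative_cong_open[OF assms] by simp

lemma differentiable_cong_open:
  assumes "open S" "x \<in> S" "\<And>y. y \<in> S \<Longrightarrow> f y = g y"
  shows "f differentiable at x \<longleftrightarrow> g differentiable at x"
  unfolding differentiable_def using has_derivative_cong_open[OF assms] by simp

lemma FD_compose:
  assumes "f differentiable at x" "g differentiable at (f x)"
  shows "FD (\<lambda>x. g (f x)) x v = FD g (f x) (FD f x v)"
  using FD_eq[OF has_derivative_compose[OF FD_works[OF assms(1)] FD_works[OF assms(2)]]] by simp

lemma FD_bounded_linear_compose:
  assumes "bounded_linear L" "f differentiable at x"
  shows "FD (\<lambda>x. L (f x)) x v = L (FD f x v)"
  using FD_eq[OF bounded_linear.has_derivative[OF assms(1) FD_works[OF assms(2)]]] by simp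

lemma FD_add:
  assumes "f differentiable at x" "g differentiable at x"
  shows "FD (\<lambda>x. f x + g x) x v = FD f x v + FD g x v"
  using FD_eq[OF has_derivative_add[OF assms[THEN FD_works]]] by simp

lemma FD_bilinear:
  assumes "bounded_bilinear B" "f differentiable at x" "g differentiable at x"
  shows "FD (\<lambda>x. B (f x) (g x)) x v = B (f x) (FD g x v) + B (FD f x v) (g x)"
  using FD_eq[OF bounded_bilinear.FDERIV[OF assms(1) assms(2,3)[THEN FD_works]]] by simp

lemma differentiable_bilinear:
  assumes "bounded_bilinear B" "f differentiable at x" "g differentiable at x"
  shows "(\<lambda>x. B (f x) (g x)) differentiable at x"
  using bounded_bilinear.FDERIV[OF assms(1) assms(2,3)[THEN FD_works]] by (auto simp: differentiable_def)

lemma differentiable_bounded_linear: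
  assumes "bounded_linear L" "f differentiable at x"
  shows "(\<lambda>x. L (f x)) differentiable at x"
  using bounded_linear.has_derivative[OF assms(1) FD_works[OF assms(2)]] by (auto simp: differentiable_def)

lemma FD_expand:
  fixes f :: "'v::euclidean_space \<Rightarrow> 'w::real_normed_vector"
  assumes "f differentiable at x"
  shows "FD f x v = (\<Sum>b\<in>Basis. (v \<bullet> b) *\<^sub>R FD f x b)"
proof -
  interpret bounded_linear "FD f x" using FD_bounded_linear[OF assms] .
  have "FD f x v = FD f x (\<Sum>b\<in>Basis. (v \<bullet> b) *\<^sub>R b)" by (simp add: euclidean_representation)
  then show ?thesis by (simp add: sum scaleR)
qed

section \<open>Closure properties of C^k and smooth maps on open sets\<close>

lemma Ck_on_cong:
  assumes "open S" "\<And>x. x \<in> S \<Longrightarrow> f x = g x"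
  shows "Ck_on k S f \<longleftrightarrow> Ck_on k S g"
  using assms(2)
proof (induction k arbitrary: f g)
  case 0
  then show ?case by (simp cong: continuous_on_cong)
next
  case (Suc k)
  have "Ck_on k S (\<lambda>x. FD f x v) \<longleftrightarrow> Ck_on k S (\<lambda>x. FD g x v)" for v
    using FD_cong_open[OF assms(1) _ Suc.prems] by (intro Suc.IH) simp
  moreover have "f differentiable at x \<longleftrightarrow> g differentiable at x" if "x \<in> S" for x
    by (rule differentiable_cong_open[OF assms(1) that Suc.prems])
  ultimately show ?case by simp
qed

lemma Ck_on_subset: "Ck_on k S f \<Longrightarrow> S' \<subseteq> S \<Longrightarrow> Ck_on k S' f"
proof (induction k arbitrary: f)
  case 0
  then show ?case using continuous_on_subset by auto
next
  case (Suc k)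
  then show ?case by (simp add: subset_iff)
qed

text \<open>All derivatives in \<open>Ck_on\<close> are taken at a point of the full space, never
  within \<open>S\<close>, so the notion is local.\<close>

lemma Ck_on_local:
  assumes "\<And>x. x \<in> S \<Longrightarrow> \<exists>N. open N \<and> x \<in> N \<and> Ck_on k N f"
  shows "Ck_on k S f"
  using assms
proof (induction k arbitrary: f)
  case 0
  then show ?case
    by (metis Ck_on.simps(1) continuous_at_imp_continuous_on continuous_on_eq_continuous_at)
next
  case (Suc k)
  have "f differentiable at x" if "x \<in> S" for x
    using Suc.prems[OF that] by auto
  moreover have "Ck_on k S (\<lambda>x. FD f x v)" for v
    using Suc.prems unfolding Ck_on.simps(2) by (intro Suc.IH) blast
  ultimately show ?case by simp
qed

lemma Ck_on_continuous: "Ck_on k S f \<Longrightarrow> continuous_on S f"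
  by (cases k) (auto intro!: continuous_at_imp_continuous_on differentiable_imp_continuous_within)

lemma Ck_on_SucD: "Ck_on (Suc k) S f \<Longrightarrow> Ck_on k S f"
proof (induction k arbitrary: f)
  case 0
  then show ?case by (metis Ck_on.simps(1) Ck_on_continuous)
next
  case (Suc k)
  have "\<forall>x\<in>S. f differentiable at x" "\<And>v. Ck_on (Suc k) S (\<lambda>x. FD f x v)"
    using Suc.prems unfolding Ck_on.simps(2)[of "Suc k"] by auto
  then show ?case by (subst Ck_on.simps(2)) (blast intro: Suc.IH)
qed

lemma Ck_on_const: "Ck_on k S (\<lambda>x. c)"
  by (induction k arbitrary: c) (auto)

lemma Ck_on_bounded_linear:
  assumes "open S" "bounded_linear L" "Ck_on k S f"
  shows "Ck_on k S (\<lambda>x. L (f x))"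
  using assms(3)
proof (induction k arbitrary: f)
  case 0
  then show ?case using bounded_linear.continuous_on[OF assms(2)] by simp
next
  case (Suc k)
  have "Ck_on k S (\<lambda>x. FD (\<lambda>x. L (f x)) x v)" for v
    using Suc
    by (subst Ck_on_cong[OF assms(1), where g = "\<lambda>x. L (FD f x v)"])
      (auto simp: FD_bounded_linear_compose[OF assms(2)])
  then show ?case
    using Suc.prems by (simp add: differentiable_bounded_linear[OF assms(2)])
qed

lemma Ck_on_ident: "open S \<Longrightarrow> Ck_on k S (\<lambda>x. x)"
  by (cases k) (auto simp: Ck_on_const)

lemma Ck_on_add:
  assumes "open S" "Ck_on k S f" "Ck_on k S g"
  shows "Ck_on k S (\<lambda>x. f x + g x)"
  using assms(2,3)
proof (induction k arbitrary: f g)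
  case 0
  then show ?case by (auto intro: continuous_on_add)
next
  case (Suc k)
  have "Ck_on k S (\<lambda>x. FD (\<lambda>x. f x + g x) x v)" for v
    using Suc
    by (subst Ck_on_cong[OF assms(1), where g = "\<lambda>x. FD f x v + FD g x v"]) (auto simp: FD_add)
  then show ?case
    using Suc.prems by simp
qed

lemma Ck_on_sum:
  assumes "open S" "\<And>i. i \<in> I \<Longrightarrow> Ck_on k S (f i)"
  shows "Ck_on k S (\<lambda>x. \<Sum>i\<in>I. f i x)"
  using assms(2)
  by (induction I rule: infinite_finite_induct) (auto simp: Ck_on_const intro: Ck_on_add[OF assms(1)])

lemma Ck_on_bilinear:
  assumes "open S" "bounded_bilinear B" "Ck_on k S f" "Ck_on k S g"
  shows "Ck_on k S (\<lambda>x. B (f x) (g x))"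
  using assms(3,4)
proof (induction k arbitrary: f g)
  case 0
  then show ?case using bounded_bilinear.continuous_on[OF assms(2)] by simp
next
  case (Suc k)
  have "Ck_on k S (\<lambda>x. FD (\<lambda>x. B (f x) (g x)) x v)" for v
  proof (subst Ck_on_cong[OF assms(1)])
    show "x \<in> S \<Longrightarrow> FD (\<lambda>x. B (f x) (g x)) x v = B (f x) (FD g x v) + B (FD f x v) (g x)" for x
      using Suc.prems by (simp add: FD_bilinear[OF assms(2)])
    show "Ck_on k S (\<lambda>x. B (f x) (FD g x v) + B (FD f x v) (g x))"
      using Suc.prems Suc.prems[THEN Ck_on_SucD]
      by (intro Ck_on_add[OF assms(1)] Suc.IH) auto
  qed
  then show ?case
    using Suc.prems by (simp add: differentiable_bilinear[OF assms(2)])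
qed

text \<open>The chain rule gives \<open>FD g (f x) (FD f x v)\<close>, whose direction moves with
  \<open>x\<close>, whereas \<open>Ck_on\<close> speaks of fixed directions. Expanding in the basis
  of the intermediate space leaves components of \<open>FD f x v\<close> times
  \<open>FD g (f x) b\<close>, and the latter are again compositions with \<open>f\<close>; the
  induction therefore varies \<open>g\<close> and keeps \<open>f\<close>.\<close>

lemma Ck_on_compose:
  fixes f :: "'u::real_normed_vector \<Rightarrow> 'v::euclidean_space" and g :: "'v \<Rightarrow> 'w::real_normed_vector"
  assumes "open S" "f ` S \<subseteq> S'" "Ck_on k S f" "Ck_on k S' g"
  shows "Ck_on k S (\<lambda>x. g (f x))"
  using assms(3,4)
proof (induction k arbitrary: g)
  case 0
  then show ?case
    using assms(2) by (auto intro: continuous_on_compose2)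
next
  case (Suc k)
  have d: "f differentiable at x" "g differentiable at (f x)" if "x \<in> S" for x
    using Suc.prems that assms(2) by auto
  have "Ck_on k S (\<lambda>x. FD (\<lambda>x. g (f x)) x v)" for v
  proof (subst Ck_on_cong[OF assms(1)])
    show "x \<in> S \<Longrightarrow> FD (\<lambda>x. g (f x)) x v = (\<Sum>b\<in>Basis. (FD f x v \<bullet> b) *\<^sub>R FD g (f x) b)" for x
      using d[of x] by (simp add: FD_compose FD_expand[of g])
    show "Ck_on k S (\<lambda>x. \<Sum>b\<in>Basis. (FD f x v \<bullet> b) *\<^sub>R FD g (f x) b)"
      using Suc.prems Suc.prems[THEN Ck_on_SucD]
      by (intro Ck_on_sum[OF assms(1)] Ck_on_bilinear[OF assms(1) bounded_bilinear_scaleR] Suc.IH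
          Ck_on_bounded_linear[OF assms(1) bounded_linear_inner_left]) auto
  qed
  then show ?case
    using Suc.prems d by (auto intro: differentiable_compose)
qed

text \<open>The derivative is a constant times the square of \<open>inverse\<close> itself, so the
  induction meets no other function.\<close>

lemma Ck_on_inverse: "Ck_on k (- {0}) (inverse :: real \<Rightarrow> real)"
proof (induction k)
  case 0
  then show ?case by (auto intro!: continuous_intros)
next
  case (Suc k)
  have d: "(inverse has_derivative (\<lambda>h. - (inverse x * h * inverse x))) (at x)" if "x \<noteq> 0" for x :: real
    using has_derivative_inverse'[OF that] .
  have "Ck_on k (- {0}) (\<lambda>x. FD (inverse :: real \<Rightarrow> real) x v)" for v
  proof (subst Ck_on_cong)
    show "x \<in> - {0} \<Longrightarrow> FD inverse x v = (- v) *\<^sub>R (inverse x * inverse x)" for x :: real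
      using FD_eq[OF d[of x]] by simp
    show "Ck_on k (- {0::real}) (\<lambda>x. (- v) *\<^sub>R (inverse x * inverse x))"
      by (intro Ck_on_bilinear[OF _ bounded_bilinear_mult] Suc
          Ck_on_bounded_linear[OF _ bounded_linear_scaleR_right]) auto
  qed auto
  then show ?case
    using d by (auto simp: differentiable_def)
qed

lemma smooth_on_cong:
  assumes "open S" "\<And>x. x \<in> S \<Longrightarrow> f x = g x"
  shows "smooth_on S f \<longleftrightarrow> smooth_on S g"
  using Ck_on_cong[OF assms] by (simp add: smooth_on_def)

lemma smooth_on_subset: "smooth_on S f \<Longrightarrow> S' \<subseteq> S \<Longrightarrow> smooth_on S' f"
  using Ck_on_subset by (metis smooth_on_def)

lemma smooth_on_local:
  assumes "\<And>x. x \<in> S \<Longrightarrow> \<exists>N. open N \<and> x \<in> N \<and> smooth_on N f"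
  shows "smooth_on S f"
  using assms unfolding smooth_on_def by (meson Ck_on_local)

lemma smooth_on_differentiable: "smooth_on S f \<Longrightarrow> x \<in> S \<Longrightarrow> f differentiable at x"
  unfolding smooth_on_def by (metis Ck_on.simps(2))

lemma smooth_on_continuous: "smooth_on S f \<Longrightarrow> continuous_on S f"
  unfolding smooth_on_def using Ck_on_continuous by blast

lemma smooth_on_const: "smooth_on S (\<lambda>x. c)"
  by (simp add: smooth_on_def Ck_on_const)

lemma smooth_on_ident: "open S \<Longrightarrow> smooth_on S (\<lambda>x. x)"
  by (simp add: smooth_on_def Ck_on_ident)

lemma smooth_on_bounded_linear:
  "open S \<Longrightarrow> bounded_linear L \<Longrightarrow> smooth_on S f \<Longrightarrow> smooth_on S (\<lambda>x. L (f x))"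
  by (simp add: smooth_on_def Ck_on_bounded_linear)

lemma smooth_on_add: "open S \<Longrightarrow> smooth_on S f \<Longrightarrow> smooth_on S g \<Longrightarrow> smooth_on S (\<lambda>x. f x + g x)"
  by (simp add: smooth_on_def Ck_on_add)

lemma smooth_on_sum:
  "open S \<Longrightarrow> (\<And>i. i \<in> I \<Longrightarrow> smooth_on S (f i)) \<Longrightarrow> smooth_on S (\<lambda>x. \<Sum>i\<in>I. f i x)"
  by (simp add: smooth_on_def Ck_on_sum)

lemma smooth_on_bilinear:
  "open S \<Longrightarrow> bounded_bilinear B \<Longrightarrow> smooth_on S f \<Longrightarrow> smooth_on S g \<Longrightarrow>
    smooth_on S (\<lambda>x. B (f x) (g x))"
  by (simp add: smooth_on_def Ck_on_bilinear)

lemmas smooth_on_scaleR = smooth_on_bilinear[OF _ bounded_bilinear_scaleR]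
lemmas smooth_on_mult = smooth_on_bilinear[OF _ bounded_bilinear_mult]
lemmas smooth_on_inner = smooth_on_bilinear[OF _ bounded_bilinear_inner]

lemma smooth_on_minus: "open S \<Longrightarrow> smooth_on S f \<Longrightarrow> smooth_on S (\<lambda>x. - f x)"
  by (rule smooth_on_bounded_linear[OF _ bounded_linear_minus[OF bounded_linear_ident]])

lemma smooth_on_diff: "open S \<Longrightarrow> smooth_on S f \<Longrightarrow> smooth_on S g \<Longrightarrow> smooth_on S (\<lambda>x. f x - g x)"
  using smooth_on_add[of S f "\<lambda>x. - g x"] smooth_on_minus by fastforce

lemma smooth_on_Pair:
  assumes "open S" "smooth_on S f" "smooth_on S g"
  shows "smooth_on S (\<lambda>x. (f x, g x))"
proof -
  have "smooth_on S (\<lambda>x. (f x, 0) + (0, g x))"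
    by (intro smooth_on_add assms smooth_on_bounded_linear[where L = "\<lambda>y. (y, 0)"]
        smooth_on_bounded_linear[where L = "\<lambda>y. (0, y)"] bounded_linear_Pair bounded_linear_ident
        bounded_linear_zero)
  then show ?thesis by simp
qed

lemma smooth_on_compose:
  fixes f :: "'u::real_normed_vector \<Rightarrow> 'v::euclidean_space" and g :: "'v \<Rightarrow> 'w::real_normed_vector"
  assumes "open S" "smooth_on S f" "smooth_on S' g" "f ` S \<subseteq> S'"
  shows "smooth_on S (\<lambda>x. g (f x))"
  using assms Ck_on_compose[of S f S' _ g] by (simp add: smooth_on_def)

lemma smooth_on_inverse:
  fixes f :: "'u::real_normed_vector \<Rightarrow> real"
  assumes "open S" "smooth_on S f" "\<And>x. x \<in> S \<Longrightarrow> f x \<noteq> 0"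
  shows "smooth_on S (\<lambda>x. inverse (f x))"
proof (rule smooth_on_compose[OF assms(1,2)])
  show "smooth_on (- {0}) (inverse :: real \<Rightarrow> real)" by (simp add: smooth_on_def Ck_on_inverse)
  show "f ` S \<subseteq> - {0}" using assms(3) by force
qed

lemma smooth_on_FD: "smooth_on S f \<Longrightarrow> smooth_on S (\<lambda>x. FD f x v)"
  unfolding smooth_on_def by (metis Ck_on.simps(2))

text \<open>Matrix fields are treated throughout as families \<open>L x v\<close> that are smooth in
  \<open>x\<close> for each fixed \<open>v\<close>; a moving argument is expanded in the basis of
  its finite-dimensional space.\<close>

lemma smooth_on_linear_field:
  fixes g :: "'u::real_normed_vector \<Rightarrow> 'v::euclidean_space" and L :: "'u \<Rightarrow> 'v \<Rightarrow> 'w::real_normed_vector"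
  assumes "open S" "\<And>x. x \<in> S \<Longrightarrow> linear (L x)" "\<And>v. smooth_on S (\<lambda>x. L x v)" "smooth_on S g"
  shows "smooth_on S (\<lambda>x. L x (g x))"
proof (subst smooth_on_cong[OF assms(1)])
  fix x assume "x \<in> S"
  interpret linear "L x" using assms(2)[OF \<open>x \<in> S\<close>] .
  have "L x (g x) = L x (\<Sum>b\<in>Basis. (g x \<bullet> b) *\<^sub>R b)" by (simp add: euclidean_representation)
  then show "L x (g x) = (\<Sum>b\<in>Basis. (g x \<bullet> b) *\<^sub>R L x b)" by (simp add: sum scale)
next
  show "smooth_on S (\<lambda>x. \<Sum>b\<in>Basis. (g x \<bullet> b) *\<^sub>R L x b)"
    by (intro smooth_on_sum smooth_on_scaleR smooth_on_bounded_linear[OF _ bounded_linear_inner_left] assms)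
qed

lemma smooth_on_FD_field:
  fixes f :: "'v::euclidean_space \<Rightarrow> 'w::real_normed_vector"
  assumes "open S" "smooth_on S f" "smooth_on S g"
  shows "smooth_on S (\<lambda>x. FD f x (g x))"
proof (rule smooth_on_linear_field[OF assms(1) _ smooth_on_FD[OF assms(2)] assms(3)])
  show "linear (FD f x)" if "x \<in> S" for x
    by (rule bounded_linear.linear[OF FD_bounded_linear[OF smooth_on_differentiable[OF assms(2) that]]])
qed

text \<open>This product rule serves for transition maps, Christoffel symbols, the matrix of the
  form and \<open>J\<close> alike. In its first summand the argument stays frozen at
  \<open>g x\<close>, which fits matrix fields that are known only through their values on fixed
  vectors.\<close>

lemma has_derivative_linear_field:
  fixes g :: "'u::real_normed_vector \<Rightarrow> 'v::euclidean_space" and L :: "'u \<Rightarrow> 'v \<Rightarrow> 'w::real_normed_vector"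
  assumes "open S" "x \<in> S" "\<And>x. x \<in> S \<Longrightarrow> linear (L x)" "\<And>v. (\<lambda>x. L x v) differentiable at x"
    "g differentiable at x"
  shows "((\<lambda>x. L x (g x)) has_derivative (\<lambda>d. FD (\<lambda>y. L y (g x)) x d + L x (FD g x d))) (at x)"
proof -
  have ex: "L y w = (\<Sum>b\<in>Basis. (w \<bullet> b) *\<^sub>R L y b)" if "y \<in> S" for y w
  proof -
    interpret linear "L y" using assms(3)[OF that] .
    have "L y w = L y (\<Sum>b\<in>Basis. (w \<bullet> b) *\<^sub>R b)" by (simp add: euclidean_representation)
    then show ?thesis by (simp add: sum scale)
  qed
  have 1: "((\<lambda>y. \<Sum>b\<in>Basis. (g y \<bullet> b) *\<^sub>R L y b) has_derivative
     (\<lambda>d. \<Sum>b\<in>Basis. (g x \<bullet> b) *\<^sub>R FD (\<lambda>x. L x b) x d + (FD g x d \<bullet> b) *\<^sub>R L x b)) (at x)"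
    by (auto intro!: derivative_eq_intros FD_works assms)
  have 2: "((\<lambda>y. \<Sum>b\<in>Basis. (g x \<bullet> b) *\<^sub>R L y b) has_derivative
     (\<lambda>d. \<Sum>b\<in>Basis. (g x \<bullet> b) *\<^sub>R FD (\<lambda>x. L x b) x d)) (at x)"
    by (auto intro!: derivative_eq_intros FD_works assms)
  have 3: "((\<lambda>y. L y (g x)) has_derivative
     (\<lambda>d. \<Sum>b\<in>Basis. (g x \<bullet> b) *\<^sub>R FD (\<lambda>x. L x b) x d)) (at x)"
    by (rule iffD2[OF has_derivative_cong_open[OF assms(1,2) ex] 2])
  have "(\<lambda>d. FD (\<lambda>y. L y (g x)) x d + L x (FD g x d)) =
     (\<lambda>d. \<Sum>b\<in>Basis. (g x \<bullet> b) *\<^sub>R FD (\<lambda>x. L x b) x d + (FD g x d \<bullet> b) *\<^sub>R L x b)"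
  proof
    fix d
    show "FD (\<lambda>y. L y (g x)) x d + L x (FD g x d) =
      (\<Sum>b\<in>Basis. (g x \<bullet> b) *\<^sub>R FD (\<lambda>x. L x b) x d + (FD g x d \<bullet> b) *\<^sub>R L x b)"
      unfolding FD_eq[OF 3] ex[OF assms(2), of "FD g x d"] sum.distrib ..
  qed
  then show ?thesis
    using iffD2[OF has_derivative_cong_open[OF assms(1,2) ex] 1] by simp
qed

section \<open>Bump functions\<close>

text \<open>The factor \<open>(1 / t) ^ n\<close> makes the span of the family closed under
  differentiation, so smoothness of the classical function \<open>exp (- (1 / t))\<close> extended
  by 0 follows by one induction for all \<open>n\<close> at once.\<close>

definition flat_exp :: "nat \<Rightarrow> real \<Rightarrow> real" where
  "flat_exp n t = (if t > 0 then (1 / t) ^ n * exp (- (1 / t)) else 0)"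

text \<open>From the right, the substitution of \<open>1 / t\<close> turns the limit into that of a
  power divided by the exponential at infinity.\<close>

lemma flat_exp_tendsto_0: "(flat_exp n \<longlongrightarrow> 0) (at 0)"
proof -
  have "((\<lambda>t. (inverse t) ^ n / exp (inverse t)) \<longlongrightarrow> (0::real)) (at_right 0)"
    using filterlim_compose[OF tendsto_power_div_exp_0 filterlim_inverse_at_top_right] .
  then have "(flat_exp n \<longlongrightarrow> 0) (at_right 0)"
    by (rule tendsto_cong[THEN iffD1, rotated])
      (auto simp: flat_exp_def eventually_at_filter inverse_eq_divide exp_minus divide_simps)
  moreover have "(flat_exp n \<longlongrightarrow> 0) (at_left 0)"
    by (rule tendsto_eventually) (auto simp: flat_exp_def eventually_at_filter)
  ultimately show ?thesis by (simp add: filterlim_split_at)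
qed

lemma flat_exp_deriv:
  "(flat_exp n has_real_derivative (flat_exp (n + 2) t - n * flat_exp (n + 1) t)) (at t)"
proof (cases t "0::real" rule: linorder_cases)
  case greater
  \<comment> \<open>The power rule leaves exponents \<open>m - Suc 0\<close> with truncated
    subtraction, so \<open>m = 0\<close> has to be kept apart.\<close>
  have pw: "t * t ^ (m - Suc 0) = (if m = 0 then t else t ^ m)" for m
    by (cases m) auto
  have "((\<lambda>t. (1 / t) ^ n * exp (- (1 / t))) has_real_derivative
      (flat_exp (n + 2) t - n * flat_exp (n + 1) t)) (at t)"
    using greater
    by (cases n) (auto intro!: derivative_eq_intros simp: pw flat_exp_def field_simps power2_eq_square)
  moreover have "open {0::real<..}" "t \<in> {0::real<..}" using greater by auto
  ultimately show ?thesis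
    by (rule has_field_derivative_transform_within_open) (auto simp: flat_exp_def)
next
  case less
  have "((\<lambda>t. 0) has_real_derivative (flat_exp (n + 2) t - n * flat_exp (n + 1) t)) (at t)"
    using less by (auto simp: flat_exp_def)
  moreover have "open {..<0::real}" "t \<in> {..<0::real}" using less by auto
  ultimately show ?thesis
    by (rule has_field_derivative_transform_within_open) (auto simp: flat_exp_def)
next
  case equal
  \<comment> \<open>Away from \<open>h = 0\<close> the difference quotient at 0 is
    \<open>flat_exp (Suc n) h\<close>, so the limit already known for all exponents applies.\<close>
  have "((\<lambda>h. (flat_exp n (0 + h) - flat_exp n 0) / h) \<longlongrightarrow> 0) (at 0)"
    by (rule Lim_transform_eventually[OF flat_exp_tendsto_0[of "Suc n"]])
      (auto simp: flat_exp_def eventually_at_filter)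
  then show ?thesis using equal by (simp add: DERIV_def flat_exp_def)
qed

lemma smooth_on_flat_exp: "smooth_on UNIV (flat_exp n)"
proof -
  have "Ck_on k UNIV (flat_exp n)" for k
  proof (induction k arbitrary: n)
    case 0
    then show ?case
      using flat_exp_deriv by (auto intro!: continuous_at_imp_continuous_on DERIV_isCont)
  next
    case (Suc k)
    have d: "(flat_exp n has_derivative (\<lambda>h. (flat_exp (n + 2) t - n * flat_exp (n + 1) t) * h)) (at t)"
      for t
      using flat_exp_deriv[of n t] by (simp add: has_field_derivative_def)
    have "(\<lambda>x. FD (flat_exp n) x v) =
        (\<lambda>x. v *\<^sub>R flat_exp (n + 2) x + (- real n * v) *\<^sub>R flat_exp (n + 1) x)" for v
      by (rule ext) (simp add: FD_eq[OF d] algebra_simps)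
    moreover have "Ck_on k UNIV (\<lambda>x. v *\<^sub>R flat_exp (n + 2) x + (- real n * v) *\<^sub>R flat_exp (n + 1) x)"
      for v
      by (intro Ck_on_add Ck_on_bounded_linear[OF _ bounded_linear_scaleR_right] Suc.IH) auto
    ultimately show ?case using d by (auto simp: differentiable_def)
  qed
  then show ?thesis by (simp add: smooth_on_def)
qed

text \<open>The function is \<open>g / (g + k)\<close>, where \<open>g\<close> is positive exactly
  in the open ball of radius \<open>R\<close> and \<open>k\<close> exactly outside the closed ball
  of radius \<open>R / 2\<close>. These two regions cover the space, so the denominator never
  vanishes; the quotient is 1 where \<open>k = 0\<close> and 0 where \<open>g = 0\<close>.\<close>

lemma smooth_bump:
  fixes x0 :: "'e::euclidean_space"
  assumes "open U" "x0 \<in> U"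
  obtains \<beta> :: "'e \<Rightarrow> real" and r R where "0 < r" "r \<le> R" "cball x0 R \<subseteq> U" "smooth_on UNIV \<beta>"
    "\<forall>x\<in>ball x0 r. \<beta> x = 1" "\<forall>x. x \<notin> cball x0 R \<longrightarrow> \<beta> x = 0"
proof -
  obtain R where R: "R > 0" "cball x0 R \<subseteq> U" using assms open_contains_cball by blast
  \<comment> \<open>The squared distance is polynomial and hence smooth at \<open>x0\<close> as
    well, unlike the distance.\<close>
  define q where "q x = (x - x0) \<bullet> (x - x0)" for x
  have q: "q x = (dist x0 x)\<^sup>2" for x by (metis dist_commute dist_norm power2_norm_eq_inner q_def)
  define g where "g x = flat_exp 0 (R\<^sup>2 - q x)" for x
  define k where "k x = flat_exp 0 (q x - (R / 2)\<^sup>2)" for x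
  have pos: "flat_exp 0 t \<ge> 0" "t > 0 \<Longrightarrow> flat_exp 0 t > 0" "t \<le> 0 \<Longrightarrow> flat_exp 0 t = 0" for t
    by (auto simp: flat_exp_def)
  have "R\<^sup>2 - q x > 0 \<or> q x - (R / 2)\<^sup>2 > 0" for x
    using R by (auto simp: power_divide) (smt (verit) zero_less_power)
  then have gk: "g x + k x \<noteq> 0" for x
    using pos by (smt (verit) g_def k_def)
  have sq: "smooth_on UNIV q" unfolding q_def
    by (intro smooth_on_inner smooth_on_diff smooth_on_ident smooth_on_const) auto
  have sg: "smooth_on UNIV g" unfolding g_def
    by (rule smooth_on_compose[OF _ _ smooth_on_flat_exp])
      (intro smooth_on_diff sq smooth_on_const | simp)+
  have sk: "smooth_on UNIV k" unfolding k_def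
    by (rule smooth_on_compose[OF _ _ smooth_on_flat_exp])
      (intro smooth_on_diff sq smooth_on_const | simp)+
  show thesis
  proof
    show "0 < R / 2" "R / 2 \<le> R" using R by auto
    show "cball x0 R \<subseteq> U" by fact
    show "smooth_on UNIV (\<lambda>x. g x * inverse (g x + k x))"
      using gk by (intro smooth_on_mult smooth_on_inverse smooth_on_add sg sk) auto
    show "\<forall>x\<in>ball x0 (R / 2). g x * inverse (g x + k x) = 1"
    proof
      fix x assume that: "x \<in> ball x0 (R / 2)"
      have "q x < (R / 2)\<^sup>2" unfolding q using that by (intro power_strict_mono) auto
      then have "k x = 0" using pos by (simp add: k_def)
      then show "g x * inverse (g x + k x) = 1" using gk[of x] by simp
    qed
    show "\<forall>x. x \<notin> cball x0 R \<longrightarrow> g x * inverse (g x + k x) = 0"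
    proof (intro allI impI)
      fix x assume that: "x \<notin> cball x0 R"
      have "q x > R\<^sup>2" using that R by (simp add: q power_strict_mono)
      then show "g x * inverse (g x + k x) = 0" using pos by (simp add: g_def)
    qed
  qed
qed

section \<open>Symmetry of second derivatives\<close>

text \<open>The mean value theorem is applied twice: in \<open>s\<close>, along \<open>u\<close>, to
  the increment of \<open>f\<close> in the direction \<open>v\<close>, then in \<open>t\<close>,
  along \<open>v\<close>, to the derivative in the direction \<open>u\<close>. The second difference
  is symmetric in \<open>u\<close> and \<open>v\<close> while the right-hand side is not, and this
  asymmetry yields the symmetry of second derivatives.\<close>

lemma second_difference:
  fixes f :: "'v::euclidean_space \<Rightarrow> real"
  assumes h: "0 < h" "h * (norm u + norm v) < d"
    and f: "\<And>y. y \<in> ball x d \<Longrightarrow> f differentiable at y"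
    and g: "\<And>y. y \<in> ball x d \<Longrightarrow> (\<lambda>y. FD f y u) differentiable at y"
  obtains z where "z \<in> ball x d"
    "f (x + h *\<^sub>R u + h *\<^sub>R v) - f (x + h *\<^sub>R u) - f (x + h *\<^sub>R v) + f x =
      h * h * FD (\<lambda>y. FD f y u) z v"
proof -
  have in_ball: "x + s *\<^sub>R u + t *\<^sub>R v \<in> ball x d" if "0 \<le> s" "s \<le> h" "0 \<le> t" "t \<le> h" for s t
  proof -
    have "norm (s *\<^sub>R u + t *\<^sub>R v) \<le> s * norm u + t * norm v"
      using that norm_triangle_ineq[of "s *\<^sub>R u" "t *\<^sub>R v"] by simp
    also have "\<dots> \<le> h * norm u + h * norm v"
      using that by (intro add_mono mult_right_mono) auto
    also have "\<dots> < d" using h by (simp add: algebra_simps)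
    finally have "dist x (x + (s *\<^sub>R u + t *\<^sub>R v)) < d"
      by (metis add_diff_cancel_left' dist_commute dist_norm)
    then show ?thesis by (simp add: add.assoc)
  qed
  have d1: "((\<lambda>s. f (x + s *\<^sub>R u + t *\<^sub>R v)) has_real_derivative FD f (x + s *\<^sub>R u + t *\<^sub>R v) u) (at s)"
    if "0 \<le> s" "s \<le> h" "0 \<le> t" "t \<le> h" for s t
  proof -
    have "((\<lambda>s. x + s *\<^sub>R u + t *\<^sub>R v) has_derivative (\<lambda>s. s *\<^sub>R u)) (at s)"
      by (auto intro!: derivative_eq_intros)
    from has_derivative_compose[OF this FD_works[OF f[OF in_ball[OF that]]]]
    show ?thesis
      using linear_cmul[OF bounded_linear.linear[OF FD_bounded_linear[OF f[OF in_ball[OF that]]]]]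
      by (simp add: has_field_derivative_def mult_commute_abs)
  qed
  have d2: "((\<lambda>t. FD f (x + s *\<^sub>R u + t *\<^sub>R v) u) has_real_derivative
      FD (\<lambda>y. FD f y u) (x + s *\<^sub>R u + t *\<^sub>R v) v) (at t)"
    if "0 \<le> s" "s \<le> h" "0 \<le> t" "t \<le> h" for s t
  proof -
    have "((\<lambda>t. x + s *\<^sub>R u + t *\<^sub>R v) has_derivative (\<lambda>t. t *\<^sub>R v)) (at t)"
      by (auto intro!: derivative_eq_intros)
    from has_derivative_compose[OF this FD_works[OF g[OF in_ball[OF that]]]]
    show ?thesis
      using linear_cmul[OF bounded_linear.linear[OF FD_bounded_linear[OF g[OF in_ball[OF that]]]]]
      by (simp add: has_field_derivative_def mult_commute_abs)
  qed
  have "\<exists>s>0. s < h \<and> (f (x + h *\<^sub>R u + h *\<^sub>R v) - f (x + h *\<^sub>R u + 0 *\<^sub>R v))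
      - (f (x + 0 *\<^sub>R u + h *\<^sub>R v) - f (x + 0 *\<^sub>R u + 0 *\<^sub>R v))
    = (h - 0) * (FD f (x + s *\<^sub>R u + h *\<^sub>R v) u - FD f (x + s *\<^sub>R u + 0 *\<^sub>R v) u)"
    using h by (intro MVT2 DERIV_diff d1) auto
  then obtain s where s: "0 < s" "s < h"
    "f (x + h *\<^sub>R u + h *\<^sub>R v) - f (x + h *\<^sub>R u) - f (x + h *\<^sub>R v) + f x
      = h * (FD f (x + s *\<^sub>R u + h *\<^sub>R v) u - FD f (x + s *\<^sub>R u + 0 *\<^sub>R v) u)"
    by auto
  have "\<exists>t>0. t < h \<and> FD f (x + s *\<^sub>R u + h *\<^sub>R v) u - FD f (x + s *\<^sub>R u + 0 *\<^sub>R v) u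
    = (h - 0) * FD (\<lambda>y. FD f y u) (x + s *\<^sub>R u + t *\<^sub>R v) v"
    using h s by (intro MVT2 d2) auto
  then obtain t where t: "0 < t" "t < h" "FD f (x + s *\<^sub>R u + h *\<^sub>R v) u - FD f (x + s *\<^sub>R u + 0 *\<^sub>R v) u
    = h * FD (\<lambda>y. FD f y u) (x + s *\<^sub>R u + t *\<^sub>R v) v"
    by auto
  show thesis
  proof
    show "x + s *\<^sub>R u + t *\<^sub>R v \<in> ball x d" using s t by (intro in_ball) auto
  qed (use s t in simp)
qed

lemma FD_commute_real:
  fixes f :: "'v::euclidean_space \<Rightarrow> real"
  assumes "open S" "x \<in> S" "smooth_on S f"
  shows "FD (\<lambda>y. FD f y u) x v = FD (\<lambda>y. FD f y v) x u"
proof (rule ccontr)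
  let ?a = "\<lambda>y. FD (\<lambda>y. FD f y u) y v" and ?b = "\<lambda>y. FD (\<lambda>y. FD f y v) y u"
  \<comment> \<open>Half the gap: two approximations with errors below \<open>e\<close> that share a
    common value cannot bridge it.\<close>
  define e where "e = \<bar>?a x - ?b x\<bar> / 2"
  assume "?a x \<noteq> ?b x"
  then have e: "e > 0" by (simp add: e_def)
  have c: "isCont ?a x" "isCont ?b x"
    using assms smooth_on_FD smooth_on_continuous continuous_on_eq_continuous_at by blast+
  obtain d1 where d1: "d1 > 0" "\<And>y. dist y x < d1 \<Longrightarrow> \<bar>?a y - ?a x\<bar> < e"
    using c(1) e unfolding continuous_at_eps_delta dist_real_def by metis
  obtain d2 where d2: "d2 > 0" "\<And>y. dist y x < d2 \<Longrightarrow> \<bar>?b y - ?b x\<bar> < e"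
    using c(2) e unfolding continuous_at_eps_delta dist_real_def by metis
  obtain d3 where d3: "d3 > 0" "ball x d3 \<subseteq> S" using assms open_contains_ball by blast
  define d where "d = min d1 (min d2 d3)"
  have d: "d > 0" using d1 d2 d3 by (simp add: d_def)
  \<comment> \<open>The summand 1 keeps the denominator positive when \<open>u\<close> and
    \<open>v\<close> vanish and makes \<open>h * (norm u + norm v) < d\<close> strict.\<close>
  define h where "h = d / (norm u + norm v + 1)"
  have n: "norm u + norm v + 1 > 0" by (smt (verit) norm_ge_zero)
  then have h0: "h > 0" using d by (simp add: h_def)
  have h1: "h * (norm u + norm v + 1) = d" using n by (simp add: h_def)
  have h: "h > 0" "h * (norm u + norm v) < d" "h * (norm v + norm u) < d"
    using h0 h1 by (auto simp: algebra_simps)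
  have B: "y \<in> S" if "y \<in> ball x d" for y using that d3 by (auto simp: d_def)
  have f: "f differentiable at y" "(\<lambda>y. FD f y w) differentiable at y" if "y \<in> ball x d" for y w
    using smooth_on_differentiable[OF _ B[OF that]] assms(3) smooth_on_FD by blast+
  obtain z where z: "z \<in> ball x d" "f (x + h *\<^sub>R u + h *\<^sub>R v) - f (x + h *\<^sub>R u) - f (x + h *\<^sub>R v) + f x =
      h * h * ?a z"
    using second_difference[OF h(1,2) f(1) f(2)] by blast
  obtain z' where z': "z' \<in> ball x d" "f (x + h *\<^sub>R v + h *\<^sub>R u) - f (x + h *\<^sub>R v) - f (x + h *\<^sub>R u) + f x =
      h * h * ?b z'"
    using second_difference[OF h(1,3) f(1) f(2)] by blast
  have "x + h *\<^sub>R v + h *\<^sub>R u = x + h *\<^sub>R u + h *\<^sub>R v" by (simp add: algebra_simps)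
  then have "h * h * ?a z = h * h * ?b z'" using z z' by (smt (verit))
  then have "?a z = ?b z'" using h by simp
  moreover have "\<bar>?a z - ?a x\<bar> < e" using z by (intro d1) (auto simp: d_def dist_commute)
  moreover have "\<bar>?b z' - ?b x\<bar> < e" using z' by (intro d2) (auto simp: d_def dist_commute)
  ultimately show False unfolding e_def by (smt (verit) field_sum_of_halves)
qed

text \<open>Reduced to components, since the mean value theorem behind the real case has no
  vector-valued form.\<close>

lemma FD_commute:
  fixes f :: "'v::euclidean_space \<Rightarrow> 'w::euclidean_space"
  assumes "open S" "x \<in> S" "smooth_on S f"
  shows "FD (\<lambda>y. FD f y u) x v = FD (\<lambda>y. FD f y v) x u"
proof (rule euclidean_eqI)
  fix b :: 'w
  have *: "FD (\<lambda>y. FD f y u) x v \<bullet> b = FD (\<lambda>y. FD (\<lambda>z. f z \<bullet> b) y u) x v" for u v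
  proof -
    have "FD (\<lambda>y. FD f y u) x v \<bullet> b = FD (\<lambda>y. FD f y u \<bullet> b) x v"
      using smooth_on_differentiable[OF smooth_on_FD[OF assms(3)] assms(2)]
      by (simp add: FD_bounded_linear_compose[OF bounded_linear_inner_left])
    also have "\<dots> = FD (\<lambda>y. FD (\<lambda>z. f z \<bullet> b) y u) x v"
    proof (rule fun_cong[OF FD_cong_open[OF assms(1,2)]])
      show "FD f y u \<bullet> b = FD (\<lambda>z. f z \<bullet> b) y u" if "y \<in> S" for y
        using smooth_on_differentiable[OF assms(3) that]
        by (simp add: FD_bounded_linear_compose[OF bounded_linear_inner_left])
    qed
    finally show ?thesis .
  qed
  have "smooth_on S (\<lambda>z. f z \<bullet> b)"
    by (rule smooth_on_bounded_linear[OF assms(1) bounded_linear_inner_left assms(3)])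
  then show "FD (\<lambda>y. FD f y u) x v \<bullet> b = FD (\<lambda>y. FD f y v) x u \<bullet> b"
    using FD_commute_real[OF assms(1,2)] by (simp add: *)
qed

lemma differentiable_neighbourhood:
  assumes "f differentiable at x" "open V" "f x \<in> V"
  obtains N where "open N" "x \<in> N" "\<And>y. y \<in> N \<Longrightarrow> f y \<in> V"
proof -
  have "continuous (at x) f" using assms(1) by (rule differentiable_imp_continuous_within)
  from this[unfolded continuous_at_open, rule_format, OF conjI[OF assms(2,3)]]
  show thesis using that by blast
qed

section \<open>Tangent spaces in charts\<close>

text \<open>Only the chart-level content of a manifold is kept, without a topology on the point set.
  The same calculus then applies to \<open>cot_atlas A\<close>, for which exactly this much is
  established.\<close>

locale atlas =
  fixes A :: "('a, 'e::euclidean_space) chart set"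
  assumes inj_chart: "c \<in> A \<Longrightarrow> inj_on (snd c) (fst c)"
    and open_overlap: "c \<in> A \<Longrightarrow> d \<in> A \<Longrightarrow> open (snd c ` (fst c \<inter> fst d))"
    and smooth_transition:
      "c \<in> A \<Longrightarrow> d \<in> A \<Longrightarrow> smooth_on (snd c ` (fst c \<inter> fst d)) (\<lambda>x. snd d (chart_inv c x))"
begin

lemma charts_atD: "c \<in> charts_at A p \<Longrightarrow> c \<in> A" "c \<in> charts_at A p \<Longrightarrow> p \<in> fst c"
  by (auto simp: charts_at_def)

lemma charts_atI: "c \<in> A \<Longrightarrow> p \<in> fst c \<Longrightarrow> c \<in> charts_at A p"
  by (auto simp: charts_at_def)

lemma points_iff: "p \<in> points A \<longleftrightarrow> charts_at A p \<noteq> {}"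
  by (force simp: charts_at_def points_def)

lemma some_chart_in: "c \<in> charts_at A p \<Longrightarrow> some_chart A p \<in> charts_at A p"
  unfolding some_chart_def by (rule someI)

lemma open_chart: "c \<in> A \<Longrightarrow> open (snd c ` fst c)"
  using open_overlap[of c c] by simp

lemma chart_inv_snd: "c \<in> A \<Longrightarrow> p \<in> fst c \<Longrightarrow> chart_inv c (snd c p) = p"
  unfolding chart_inv_def using inj_chart by (simp add: inv_into_f_f)

lemma chart_inv_in: "x \<in> snd c ` fst c \<Longrightarrow> chart_inv c x \<in> fst c"
  unfolding chart_inv_def by (rule inv_into_into)

lemma snd_chart_inv: "x \<in> snd c ` fst c \<Longrightarrow> snd c (chart_inv c x) = x"
  unfolding chart_inv_def by (rule f_inv_into_f)

lemma overlap_iff: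
  "c \<in> A \<Longrightarrow> x \<in> snd c ` (fst c \<inter> S) \<longleftrightarrow> x \<in> snd c ` fst c \<and> chart_inv c x \<in> S"
  using chart_inv_snd chart_inv_in snd_chart_inv by (smt (verit) IntE IntI image_iff)

lemma coords_in_overlap: "c \<in> charts_at A p \<Longrightarrow> d \<in> charts_at A p \<Longrightarrow> snd c p \<in> snd c ` (fst c \<inter> fst d)"
  by (auto dest: charts_atD)

lemma coords_in: "c \<in> charts_at A p \<Longrightarrow> snd c p \<in> snd c ` fst c"
  by (auto dest: charts_atD)

lemma charts_at_chart_inv: "c \<in> A \<Longrightarrow> x \<in> snd c ` fst c \<Longrightarrow> c \<in> charts_at A (chart_inv c x)"
  by (simp add: charts_atI chart_inv_in)

lemma differentiable_transition:
  assumes "c \<in> charts_at A p" "d \<in> charts_at A p"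
  shows "(\<lambda>x. snd d (chart_inv c x)) differentiable at (snd c p)"
  by (rule smooth_on_differentiable[OF smooth_transition coords_in_overlap])
    (use assms charts_atD in blast)+

definition trans_deriv :: "('a, 'e) chart \<Rightarrow> ('a, 'e) chart \<Rightarrow> 'a \<Rightarrow> 'e \<Rightarrow> 'e" where
  "trans_deriv c d p = FD (\<lambda>x. snd d (chart_inv c x)) (snd c p)"

lemma linear_trans_deriv:
  "c \<in> charts_at A p \<Longrightarrow> d \<in> charts_at A p \<Longrightarrow> linear (trans_deriv c d p)"
  unfolding trans_deriv_def
  by (rule bounded_linear.linear[OF FD_bounded_linear[OF differentiable_transition]])

text \<open>Near \<open>p\<close> the expression of \<open>F\<close> in \<open>d\<close> is its
  expression in \<open>c\<close> composed with the transition map. \<open>F\<close> may be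
  vector-valued: typical choices are a coordinate map, or the component \<open>Z q d\<close> of a
  field in a fixed chart.\<close>

lemma change_chart:
  assumes c: "c \<in> charts_at A p" and d: "d \<in> charts_at A p"
    and F: "(\<lambda>x. F (chart_inv c x)) differentiable at (snd c p)"
  shows "(\<lambda>x. F (chart_inv d x)) differentiable at (snd d p)"
    and "FD (\<lambda>x. F (chart_inv d x)) (snd d p) u
      = FD (\<lambda>x. F (chart_inv c x)) (snd c p) (trans_deriv d c p u)"
proof -
  note cA = charts_atD[OF c] and dA = charts_atD[OF d]
  have p: "chart_inv d (snd d p) = p" using dA by (simp add: chart_inv_snd)
  have eq: "F (chart_inv d y) = F (chart_inv c (snd c (chart_inv d y)))"
    if "y \<in> snd d ` (fst d \<inter> fst c)" for y
    using that cA dA by (auto simp: overlap_iff chart_inv_snd)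
  have F': "(\<lambda>x. F (chart_inv c x)) differentiable at (snd c (chart_inv d (snd d p)))"
    using F by (simp add: p)
  have "((\<lambda>y. F (chart_inv c (snd c (chart_inv d y)))) has_derivative
      (\<lambda>u. FD (\<lambda>x. F (chart_inv c x)) (snd c p) (trans_deriv d c p u))) (at (snd d p))"
    using has_derivative_compose[OF FD_works[OF differentiable_transition[OF d c]] FD_works[OF F']]
    unfolding trans_deriv_def by (simp add: p)
  then have *: "((\<lambda>y. F (chart_inv d y)) has_derivative
      (\<lambda>u. FD (\<lambda>x. F (chart_inv c x)) (snd c p) (trans_deriv d c p u))) (at (snd d p))"
    using has_derivative_cong_open[OF open_overlap coords_in_overlap[OF d c] eq] cA dA by simp
  then show "(\<lambda>x. F (chart_inv d x)) differentiable at (snd d p)"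
    by (auto simp: differentiable_def)
  show "FD (\<lambda>x. F (chart_inv d x)) (snd d p) u
      = FD (\<lambda>x. F (chart_inv c x)) (snd c p) (trans_deriv d c p u)"
    using FD_eq[OF *] by simp
qed

lemma trans_deriv_self:
  assumes "c \<in> charts_at A p"
  shows "trans_deriv c c p u = u"
proof -
  have "FD (\<lambda>x. snd c (chart_inv c x)) (snd c p) = FD (\<lambda>x. x) (snd c p)"
    using assms by (intro FD_cong_open[OF open_chart coords_in]) (auto simp: snd_chart_inv dest: charts_atD)
  then show ?thesis by (simp add: trans_deriv_def)
qed

text \<open>The cocycle rule is \<open>change_chart\<close> with the coordinate map
  \<open>snd e\<close> as the function.\<close>

lemma trans_deriv_trans:
  assumes "c \<in> charts_at A p" "d \<in> charts_at A p" "e \<in> charts_at A p"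
  shows "trans_deriv d e p (trans_deriv c d p u) = trans_deriv c e p u"
  using change_chart(2)[OF assms(2,1) differentiable_transition[OF assms(2,3)]]
  unfolding trans_deriv_def by simp

lemma coord_vec_apply:
  "coord_vec A c p u d = (if d \<in> charts_at A p then trans_deriv c d p u else 0)"
  by (simp add: coord_vec_def trans_deriv_def comp_def)

lemma tangent_space_iff:
  "v \<in> tangent_space A p \<longleftrightarrow> (\<forall>c\<in>charts_at A p. \<forall>d\<in>charts_at A p. v d = trans_deriv c d p (v c)) \<and>
    (\<forall>c. c \<notin> charts_at A p \<longrightarrow> v c = 0)"
  by (simp add: tangent_space_def trans_deriv_def comp_def)

lemma tangent_trans:
  assumes "v \<in> tangent_space A p" "c \<in> charts_at A p" "d \<in> charts_at A p"
  shows "trans_deriv c d p (v c) = v d"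
proof -
  have "\<forall>c\<in>charts_at A p. \<forall>d\<in>charts_at A p. v d = trans_deriv c d p (v c)"
    using assms(1) unfolding tangent_space_iff by (rule conjunct1)
  from bspec[OF bspec[OF this assms(2)] assms(3)] show ?thesis by (rule sym)
qed

lemma tangent_zero: "v \<in> tangent_space A p \<Longrightarrow> c \<notin> charts_at A p \<Longrightarrow> v c = 0"
  unfolding tangent_space_iff by blast

lemma tangentI:
  assumes "\<And>c d. c \<in> charts_at A p \<Longrightarrow> d \<in> charts_at A p \<Longrightarrow> v d = trans_deriv c d p (v c)"
    and "\<And>c. c \<notin> charts_at A p \<Longrightarrow> v c = 0"
  shows "v \<in> tangent_space A p"
  unfolding tangent_space_iff using assms by (intro conjI ballI allI impI)

lemma coord_vec_in: "c \<in> charts_at A p \<Longrightarrow> coord_vec A c p u \<in> tangent_space A p"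
  by (rule tangentI) (simp_all add: coord_vec_apply trans_deriv_trans)

lemma coord_vec_self: "c \<in> charts_at A p \<Longrightarrow> coord_vec A c p u c = u"
  by (simp add: coord_vec_apply trans_deriv_self)

lemma coord_vec_eq: "c \<in> charts_at A p \<Longrightarrow> v \<in> tangent_space A p \<Longrightarrow> coord_vec A c p (v c) = v"
  by (rule ext) (simp add: coord_vec_apply tangent_trans[of v] tangent_zero)

lemma tangent_eqI:
  "c \<in> charts_at A p \<Longrightarrow> v \<in> tangent_space A p \<Longrightarrow> w \<in> tangent_space A p \<Longrightarrow> v c = w c \<Longrightarrow> v = w"
  by (metis coord_vec_eq)

lemma vadd_in: "v \<in> tangent_space A p \<Longrightarrow> w \<in> tangent_space A p \<Longrightarrow> v +\<^sub>v w \<in> tangent_space A p"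
  by (rule tangentI) (simp_all add: vadd_def linear_add[OF linear_trans_deriv] tangent_trans[of v] tangent_trans[of w] tangent_zero)

lemma vdiff_in: "v \<in> tangent_space A p \<Longrightarrow> w \<in> tangent_space A p \<Longrightarrow> v -\<^sub>v w \<in> tangent_space A p"
  by (rule tangentI) (simp_all add: vdiff_def linear_diff[OF linear_trans_deriv] tangent_trans[of v] tangent_trans[of w] tangent_zero)

lemma vscale_in: "v \<in> tangent_space A p \<Longrightarrow> a *\<^sub>v v \<in> tangent_space A p"
  by (rule tangentI) (simp_all add: vscale_def linear_cmul[OF linear_trans_deriv] tangent_trans[of v] tangent_zero)

lemma vzero_in: "0\<^sub>v \<in> tangent_space A p"
  by (rule tangentI) (simp_all add: vzero_def linear_0[OF linear_trans_deriv] tangent_zero)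

lemma coord_vec_add: "c \<in> charts_at A p \<Longrightarrow>
    coord_vec A c p (u + v) = coord_vec A c p u +\<^sub>v coord_vec A c p v"
  by (auto simp: coord_vec_apply vadd_def linear_add[OF linear_trans_deriv])

lemma coord_vec_scale: "c \<in> charts_at A p \<Longrightarrow>
    coord_vec A c p (a *\<^sub>R u) = a *\<^sub>v coord_vec A c p u"
  by (auto simp: coord_vec_apply vscale_def linear_cmul[OF linear_trans_deriv])

lemma lie_deriv_chart:
  assumes "c \<in> charts_at A p" "X p \<in> tangent_space A p"
    "(\<lambda>x. f (chart_inv c x)) differentiable at (snd c p)"
  shows "lie_deriv A X f p = FD (\<lambda>x. f (chart_inv c x)) (snd c p) (X p c)"
  using change_chart(2)[OF assms(1) some_chart_in[OF assms(1)] assms(3), of "X p (some_chart A p)"]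
    tangent_trans[OF assms(2) some_chart_in[OF assms(1)] assms(1)]
  by (simp add: lie_deriv_def comp_def)

text \<open>A neighbourhood mapped into the domain of \<open>e\<close> has to be supplied
  separately: differentiability of the coordinate expression does not control where \<open>F\<close>
  itself goes, and \<open>chart_inv e\<close> undoes \<open>snd e\<close> only on that
  domain.\<close>

lemma pushforward_chart:
  assumes B: "atlas B" and c: "c \<in> charts_at A p" and e: "e \<in> charts_at B (F p)"
    and v: "v \<in> tangent_space A p"
    and diff: "(\<lambda>x. snd e (F (chart_inv c x))) differentiable at (snd c p)"
    and N: "open N" "snd c p \<in> N" "\<And>x. x \<in> N \<Longrightarrow> F (chart_inv c x) \<in> fst e"
  shows "pushforward A B F p v
    = coord_vec B e (F p) (FD (\<lambda>x. snd e (F (chart_inv c x))) (snd c p) (v c))"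
proof
  fix d
  interpret B: atlas B by fact
  let ?c = "some_chart A p"
  have p: "chart_inv c (snd c p) = p" using c by (simp add: chart_inv_snd charts_atD)
  note eB = B.charts_atD[OF e]
  show "pushforward A B F p v d
    = coord_vec B e (F p) (FD (\<lambda>x. snd e (F (chart_inv c x))) (snd c p) (v c)) d"
  proof (cases "d \<in> charts_at B (F p)")
    case True
    note dB = B.charts_atD[OF True]
    have "snd e (F (chart_inv c (snd c p))) \<in> snd e ` (fst e \<inter> fst d)"
      using p B.coords_in_overlap[OF e True] by simp
    then obtain N' where N': "open N'" "snd c p \<in> N'"
      "\<And>x. x \<in> N' \<Longrightarrow> snd e (F (chart_inv c x)) \<in> snd e ` (fst e \<inter> fst d)"
      using differentiable_neighbourhood[OF diff B.open_overlap[OF eB(1) dB(1)]] by blast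
    have eq: "snd d (chart_inv e (snd e (F (chart_inv c x)))) = snd d (F (chart_inv c x))"
      if "x \<in> N \<inter> N'" for x
      using that N(3)[of x] eB by (auto simp: B.chart_inv_snd)
    have tr: "(\<lambda>x. snd d (chart_inv e x)) differentiable at (snd e (F (chart_inv c (snd c p))))"
      using B.differentiable_transition[OF e True] by (simp add: p)
    have h: "((\<lambda>x. snd d (chart_inv e (snd e (F (chart_inv c x))))) has_derivative
      (\<lambda>u. B.trans_deriv e d (F p) (FD (\<lambda>x. snd e (F (chart_inv c x))) (snd c p) u))) (at (snd c p))"
      using has_derivative_compose[OF FD_works[OF diff] FD_works[OF tr]]
      unfolding B.trans_deriv_def by (simp add: p)
    have *: "((\<lambda>x. snd d (F (chart_inv c x))) has_derivative
      (\<lambda>u. B.trans_deriv e d (F p) (FD (\<lambda>x. snd e (F (chart_inv c x))) (snd c p) u))) (at (snd c p))"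
      by (rule iffD1[OF has_derivative_cong_open[where S = "N \<inter> N'"] h]) (use eq N N' in auto)
    have "pushforward A B F p v d = FD (\<lambda>x. snd d (F (chart_inv ?c x))) (snd ?c p) (v ?c)"
      using True by (simp add: pushforward_def Let_def comp_def)
    also have "\<dots> = FD (\<lambda>x. snd d (F (chart_inv c x))) (snd c p) (trans_deriv ?c c p (v ?c))"
      using * by (intro change_chart(2)[where F = "\<lambda>q. snd d (F q)", OF c some_chart_in[OF c]])
        (auto simp: differentiable_def)
    also have "\<dots> = B.trans_deriv e d (F p) (FD (\<lambda>x. snd e (F (chart_inv c x))) (snd c p) (v c))"
      using FD_eq[OF *] tangent_trans[OF v some_chart_in[OF c] c] by simp
    finally show ?thesis using True by (simp add: B.coord_vec_apply)
  next
    case False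
    then show ?thesis by (simp add: pushforward_def B.coord_vec_apply)
  qed
qed

section \<open>Vector fields and brackets in charts\<close>

lemma vector_fieldsD:
  assumes "X \<in> vector_fields A"
  shows "X p \<in> tangent_space A p"
    and "c \<in> A \<Longrightarrow> smooth_on (snd c ` fst c) (\<lambda>x. X (chart_inv c x) c)"
    and "c \<in> charts_at A p \<Longrightarrow> (\<lambda>x. X (chart_inv c x) c) differentiable at (snd c p)"
proof -
  show 1: "c \<in> A \<Longrightarrow> smooth_on (snd c ` fst c) (\<lambda>x. X (chart_inv c x) c)"
    using assms by (auto simp: vector_fields_def)
  show "X p \<in> tangent_space A p"
    using assms by (auto simp: vector_fields_def)
  show "c \<in> charts_at A p \<Longrightarrow> (\<lambda>x. X (chart_inv c x) c) differentiable at (snd c p)"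
    using 1 smooth_on_differentiable coords_in charts_atD by blast
qed

lemma points_charts: "c \<in> charts_at A p \<Longrightarrow> p \<in> points A"
  by (auto simp: points_iff)

text \<open>The derivative of the components of a field transforms with an extra term, the second
  derivative of the transition map in the directions of both fields; it cancels in the bracket by
  symmetry. Tangency is asked for on \<open>points A\<close> and differentiability at
  \<open>p\<close> alone, so that fields of the form \<open>J q (X q)\<close> are covered.\<close>

lemma bracket_in_tangent:
  assumes c: "c \<in> charts_at A p"
    and X: "\<And>q. q \<in> points A \<Longrightarrow> X q \<in> tangent_space A q" "(\<lambda>x. X (chart_inv c x) c) differentiable at (snd c p)"
    and Y: "\<And>q. q \<in> points A \<Longrightarrow> Y q \<in> tangent_space A q" "(\<lambda>x. Y (chart_inv c x) c) differentiable at (snd c p)"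
  shows "bracket A X Y p \<in> tangent_space A p"
proof -
  have main: "bracket A X Y p d = trans_deriv c d p (bracket A X Y p c)" if d: "d \<in> charts_at A p" for d
  proof -
    note cA = charts_atD[OF c] and dA = charts_atD[OF d]
    let ?t = "\<lambda>x. snd d (chart_inv c x)"
    let ?S = "snd c ` (fst c \<inter> fst d)"
    have S: "open ?S" "smooth_on ?S ?t" "snd c p \<in> ?S"
      using open_overlap smooth_transition coords_in_overlap c d cA dA by auto
    have p: "chart_inv c (snd c p) = p" using c by (simp add: chart_inv_snd charts_atD)
    have tr: "FD ?t x (Z (chart_inv c x) c) = Z (chart_inv c x) d"
      if "x \<in> ?S" "\<And>q. q \<in> points A \<Longrightarrow> Z q \<in> tangent_space A q" for x Z
    proof -
      have x: "x \<in> snd c ` fst c" "chart_inv c x \<in> fst d" using that cA dA by (auto simp: overlap_iff)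
      then have "c \<in> charts_at A (chart_inv c x)" "d \<in> charts_at A (chart_inv c x)"
        using cA dA by (simp_all add: charts_atI chart_inv_in)
      from tangent_trans[OF that(2)[OF points_charts[OF this(1)]] this] show ?thesis using x by (simp add: trans_deriv_def snd_chart_inv)
    qed
    \<comment> \<open>Change of chart for the derivative of components. The first summand, a second
      derivative of the transition map, is the one that is not tensorial.\<close>
    have *: "FD (\<lambda>x. Z (chart_inv d x) d) (snd d p) (W p d)
       = FD (\<lambda>y. FD ?t y (Z p c)) (snd c p) (W p c)
         + FD ?t (snd c p) (FD (\<lambda>x. Z (chart_inv c x) c) (snd c p) (W p c))"
      if Z: "\<And>q. q \<in> points A \<Longrightarrow> Z q \<in> tangent_space A q" "(\<lambda>x. Z (chart_inv c x) c) differentiable at (snd c p)"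
        and W: "\<And>q. q \<in> points A \<Longrightarrow> W q \<in> tangent_space A q" for Z W
    proof -
      have "((\<lambda>x. FD ?t x (Z (chart_inv c x) c)) has_derivative
          (\<lambda>u. FD (\<lambda>y. FD ?t y (Z (chart_inv c (snd c p)) c)) (snd c p) u
           + FD ?t (snd c p) (FD (\<lambda>x. Z (chart_inv c x) c) (snd c p) u))) (at (snd c p))"
        by (rule has_derivative_linear_field[OF S(1,3) _ _ Z(2)])
          (use S in \<open>auto intro!: bounded_linear.linear[OF FD_bounded_linear] smooth_on_differentiable smooth_on_FD\<close>)
      then have h: "((\<lambda>x. Z (chart_inv c x) d) has_derivative
          (\<lambda>u. FD (\<lambda>y. FD ?t y (Z p c)) (snd c p) u
           + FD ?t (snd c p) (FD (\<lambda>x. Z (chart_inv c x) c) (snd c p) u))) (at (snd c p))"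
        using has_derivative_transform_within_open[OF _ S(1,3) tr[of _ Z]] Z(1) p by simp
      have "FD (\<lambda>x. Z (chart_inv d x) d) (snd d p) (W p d)
        = FD (\<lambda>x. Z (chart_inv c x) d) (snd c p) (trans_deriv d c p (W p d))"
        using h by (intro change_chart(2)[where F = "\<lambda>q. Z q d", OF c d]) (auto simp: differentiable_def)
      then show ?thesis using FD_eq[OF h] tangent_trans[OF W[OF points_charts[OF c]] d c] by simp
    qed
    have "FD (\<lambda>y. FD ?t y (Y p c)) (snd c p) (X p c) = FD (\<lambda>y. FD ?t y (X p c)) (snd c p) (Y p c)"
      by (rule FD_commute[OF S(1,3,2)])
    moreover have "linear (FD ?t (snd c p))"
      using linear_trans_deriv[OF c d] by (simp add: trans_deriv_def)
    ultimately show ?thesis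
      using c d *[OF Y X(1)] *[OF X Y(1)] by (simp add: bracket_def trans_deriv_def linear_diff)
  qed
  show ?thesis
  proof (intro tangentI)
    fix e d assume "e \<in> charts_at A p" "d \<in> charts_at A p"
    then show "bracket A X Y p d = trans_deriv e d p (bracket A X Y p e)"
      using main[of d] main[of e] trans_deriv_trans[OF c, of e d] by metis
  qed (simp add: bracket_def)
qed

lemma bracket_apply: "c \<in> charts_at A p \<Longrightarrow> bracket A X Y p c =
    FD (\<lambda>x. Y (chart_inv c x) c) (snd c p) (X p c) - FD (\<lambda>x. X (chart_inv c x) c) (snd c p) (Y p c)"
  by (simp add: bracket_def)

lemma bracket_vector_field:
  assumes "X \<in> vector_fields A" "Y \<in> vector_fields A"
  shows "bracket A X Y \<in> vector_fields A"
  unfolding vector_fields_def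
proof (intro CollectI conjI allI ballI)
  fix p
  show "bracket A X Y p \<in> tangent_space A p"
  proof (cases "charts_at A p = {}")
    case True
    then show ?thesis by (intro tangentI) (simp_all add: bracket_def)
  next
    case False
    then obtain c where "c \<in> charts_at A p" by blast
    then show ?thesis
      by (rule bracket_in_tangent) (use assms vector_fieldsD(1,3) \<open>c \<in> charts_at A p\<close> in auto)
  qed
next
  fix c assume c: "c \<in> A"
  let ?X = "\<lambda>x. X (chart_inv c x) c" and ?Y = "\<lambda>x. Y (chart_inv c x) c"
  have "smooth_on (snd c ` fst c) (\<lambda>x. FD ?Y x (?X x) - FD ?X x (?Y x))"
    by (intro smooth_on_diff smooth_on_FD_field open_chart c vector_fieldsD(2) assms)
  then show "smooth_on (snd c ` fst c) (\<lambda>x. bracket A X Y (chart_inv c x) c)"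
    using c by (subst smooth_on_cong[OF open_chart[OF c]])
      (auto simp: bracket_apply[OF charts_at_chart_inv[OF c]] snd_chart_inv chart_inv_snd)
qed

end

section \<open>Extending local fields by bump functions\<close>

context atlas
begin

lemma smooth_change:
  assumes c: "c \<in> A" and d: "d \<in> A"
    and F: "smooth_on (snd c ` (fst c \<inter> fst d)) (\<lambda>x. F (chart_inv c x))"
  shows "smooth_on (snd d ` (fst d \<inter> fst c)) (\<lambda>y. F (chart_inv d y))"
proof -
  have "smooth_on (snd d ` (fst d \<inter> fst c)) (\<lambda>y. F (chart_inv c (snd c (chart_inv d y))))"
    using c d by (intro smooth_on_compose[OF open_overlap smooth_transition F])
      (auto simp: chart_inv_snd)
  then show ?thesis
    using c d by (subst smooth_on_cong[OF open_overlap[OF d c],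
          where g = "\<lambda>y. F (chart_inv c (snd c (chart_inv d y)))"])
      (auto simp: chart_inv_snd)
qed

lemma smooth_change_chart:
  assumes c: "c \<in> A" and d: "d \<in> A"
    and F: "smooth_on (snd c ` fst c) (\<lambda>x. F (chart_inv c x))"
  shows "smooth_on (snd d ` (fst d \<inter> fst c)) (\<lambda>y. F (chart_inv d y))"
  by (rule smooth_change[OF c d smooth_on_subset[OF F]]) auto

text \<open>In the chart \<open>c\<close> the component is a directional derivative of the
  transition map from \<open>c\<close> to \<open>d\<close>; \<open>smooth_change\<close> carries its
  smoothness over to \<open>d\<close>.\<close>

lemma smooth_coord_vec:
  assumes c: "c \<in> A" and d: "d \<in> A"
  shows "smooth_on (snd d ` (fst d \<inter> fst c)) (\<lambda>y. coord_vec A c (chart_inv d y) u d)"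
proof (rule smooth_change[OF c d])
  have "smooth_on (snd c ` (fst c \<inter> fst d)) (\<lambda>x. FD (\<lambda>x. snd d (chart_inv c x)) x u)"
    by (rule smooth_on_FD[OF smooth_transition[OF c d]])
  then show "smooth_on (snd c ` (fst c \<inter> fst d)) (\<lambda>x. coord_vec A c (chart_inv c x) u d)"
    using c d by (subst smooth_on_cong[OF open_overlap[OF c d],
          where g = "\<lambda>x. FD (\<lambda>x. snd d (chart_inv c x)) x u"])
      (auto simp: chart_inv_snd coord_vec_apply trans_deriv_def charts_atI)
qed

end

locale manifold =
  fixes T :: "'a topology" and A :: "('a, 'e::euclidean_space) chart set"
  assumes smooth_manifold: "smooth_manifold T A"
begin

lemma openin_chart: "c \<in> A \<Longrightarrow> openin T (fst c)"
  using smooth_manifold unfolding smooth_manifold_def by (cases c) auto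

lemma homeomorphic_chart:
  "c \<in> A \<Longrightarrow> homeomorphic_map (subtopology T (fst c)) (top_of_set (snd c ` fst c)) (snd c)"
  using smooth_manifold unfolding smooth_manifold_def by (cases c) auto

lemma topspace_chart: "c \<in> A \<Longrightarrow> topspace (subtopology T (fst c)) = fst c"
  using openin_subset[OF openin_chart] by (simp add: Int_absorb1)

lemma open_image_chart:
  assumes "c \<in> A" "openin T V" "V \<subseteq> fst c"
  shows "open (snd c ` V)"
proof -
  have "openin (subtopology T (fst c)) V"
    using assms openin_chart by (simp add: openin_open_subtopology)
  then have "openin (top_of_set (snd c ` fst c)) (snd c ` V)"
    using homeomorphic_map_openness[OF homeomorphic_chart[OF assms(1)], unfolded topspace_chart[OF assms(1)]]
      assms(3) by blast
  moreover have "open (snd c ` fst c)"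
    using smooth_manifold assms(1) unfolding smooth_manifold_def by (cases c) auto
  ultimately show ?thesis by (rule openin_open_trans)
qed

sublocale atlas A
proof
  fix c d assume c: "c \<in> A" and d: "d \<in> A"
  show "inj_on (snd c) (fst c)"
    using homeomorphic_imp_injective_map[OF homeomorphic_chart[OF c], unfolded topspace_chart[OF c]] .
  show "open (snd c ` (fst c \<inter> fst d))"
    by (rule open_image_chart[OF c openin_Int[OF openin_chart[OF c] openin_chart[OF d]]]) auto
  show "smooth_on (snd c ` (fst c \<inter> fst d)) (\<lambda>x. snd d (chart_inv c x))"
  proof -
    have "\<forall>c\<in>A. \<forall>d\<in>A. smooth_on (snd c ` (fst c \<inter> fst d)) (snd d \<circ> chart_inv c)"
      using smooth_manifold unfolding smooth_manifold_def by (elim conjE)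
    from this[rule_format, OF c d] show ?thesis by (simp add: comp_def)
  qed
qed

text \<open>Vanishing outside a set closed in all of \<open>T\<close> makes extension by zero
  smooth: the complement of \<open>K\<close> and the chart domain are open and cover the manifold.
  The value 1 near a point is not included, so that a bump times a function smooth in the chart is
  again a bump.\<close>

definition bump :: "('a, 'e) chart \<Rightarrow> ('a \<Rightarrow> real) \<Rightarrow> bool" where
  "bump c \<rho> \<longleftrightarrow> (\<exists>K. closedin T K \<and> K \<subseteq> fst c \<and> (\<forall>q. q \<notin> K \<longrightarrow> \<rho> q = 0)) \<and>
     smooth_on (snd c ` fst c) (\<lambda>x. \<rho> (chart_inv c x))"

lemma bump_zero: "bump c \<rho> \<Longrightarrow> q \<notin> fst c \<Longrightarrow> \<rho> q = 0"
  unfolding bump_def by blast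

lemma bump_smooth: "bump c \<rho> \<Longrightarrow> smooth_on (snd c ` fst c) (\<lambda>x. \<rho> (chart_inv c x))"
  unfolding bump_def by blast

lemma bump_exists:
  assumes c: "c \<in> charts_at A p"
  obtains \<rho> N where "bump c \<rho>" "open N" "snd c p \<in> N" "N \<subseteq> snd c ` fst c"
    "\<forall>x\<in>N. \<rho> (chart_inv c x) = 1"
proof -
  note cA = charts_atD[OF c]
  obtain \<beta> :: "'e \<Rightarrow> real" and r R where \<beta>: "0 < r" "r \<le> R" "cball (snd c p) R \<subseteq> snd c ` fst c"
    "smooth_on UNIV \<beta>" "\<forall>x\<in>ball (snd c p) r. \<beta> x = 1"
    "\<forall>x. x \<notin> cball (snd c p) R \<longrightarrow> \<beta> x = 0"
    by (rule smooth_bump[OF open_chart[OF cA(1)] coords_in[OF c]])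
  define K where "K = {q \<in> fst c. snd c q \<in> cball (snd c p) R}"
  have K: "K \<subseteq> fst c" by (auto simp: K_def)
  have "snd c ` K = cball (snd c p) R"
    using \<beta>(3) by (auto simp: K_def)
  then have "compactin (top_of_set (snd c ` fst c)) (snd c ` K)"
    using \<beta>(3) by (simp add: compactin_subtopology)
  then have "compactin (subtopology T (fst c)) K"
    using homeomorphic_map_compactness[OF homeomorphic_chart[OF cA(1)], unfolded topspace_chart[OF cA(1)]]
      K by blast
  then have "compactin T K" by (simp add: compactin_subtopology)
  \<comment> \<open>\<open>K\<close> is compact because the chart carries it onto a closed ball.
    That it is closed in the whole of \<open>T\<close>, and not just in the chart domain, comes from
    the Hausdorff property.\<close>
  moreover have "Hausdorff_space T" using smooth_manifold by (simp add: smooth_manifold_def)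
  ultimately have cl: "closedin T K" by (metis compactin_imp_closedin)
  define \<rho> where "\<rho> q = (if q \<in> fst c then \<beta> (snd c q) else 0)" for q
  have \<rho>\<beta>: "\<rho> (chart_inv c x) = \<beta> x" if "x \<in> snd c ` fst c" for x
    using that by (simp add: \<rho>_def chart_inv_in snd_chart_inv)
  have "smooth_on (snd c ` fst c) \<beta>" by (rule smooth_on_subset[OF \<beta>(4)]) simp
  then have "smooth_on (snd c ` fst c) (\<lambda>x. \<rho> (chart_inv c x))"
    using smooth_on_cong[OF open_chart[OF cA(1)] \<rho>\<beta>] by simp
  then have "bump c \<rho>"
    unfolding bump_def using cl K \<beta>(6) by (auto simp: \<rho>_def K_def)
  moreover have ball: "ball (snd c p) r \<subseteq> snd c ` fst c"
    using \<beta>(2,3) by (meson ball_subset_cball subset_ball order_trans)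
  moreover have "\<rho> (chart_inv c x) = 1" if "x \<in> ball (snd c p) r" for x
    using ball that \<beta>(5) \<rho>\<beta> by auto
  ultimately show thesis using that[of \<rho> "ball (snd c p) r"] \<beta>(1) by simp
qed

text \<open>Around a point of the domain of \<open>c\<close> smoothness is assumed; around any other
  point the complement of the closed set \<open>K\<close> is a neighbourhood on which
  \<open>G\<close> vanishes.\<close>

lemma extend_by_zero:
  fixes G :: "'a \<Rightarrow> 'w::real_normed_vector"
  assumes c: "c \<in> A" and d: "d \<in> A" and \<rho>: "bump c \<rho>" and G: "\<And>q. \<rho> q = 0 \<Longrightarrow> G q = 0"
    and S: "smooth_on (snd d ` (fst d \<inter> fst c)) (\<lambda>y. G (chart_inv d y))"
  shows "smooth_on (snd d ` fst d) (\<lambda>y. G (chart_inv d y))"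
proof (rule smooth_on_local)
  obtain K where K: "closedin T K" "K \<subseteq> fst c" "\<And>q. q \<notin> K \<Longrightarrow> \<rho> q = 0"
    using \<rho> unfolding bump_def by blast
  fix y assume y: "y \<in> snd d ` fst d"
  show "\<exists>N. open N \<and> y \<in> N \<and> smooth_on N (\<lambda>y. G (chart_inv d y))"
  proof (cases "chart_inv d y \<in> fst c")
    case True
    then show ?thesis using S open_overlap[OF d c] y d by (metis overlap_iff)
  next
    case False
    let ?N = "snd d ` (fst d - K)"
    have N: "open ?N" by (rule open_image_chart[OF d openin_diff[OF openin_chart[OF d] K(1)]]) auto
    moreover have "y \<in> ?N" using y False K(2) d by (auto simp: chart_inv_snd)
    moreover have "smooth_on ?N (\<lambda>y. G (chart_inv d y))"
      using d K(3) G by (subst smooth_on_cong[OF N, where g = "\<lambda>y. 0"])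
        (auto simp: chart_inv_snd smooth_on_const)
    ultimately show ?thesis by blast
  qed
qed

lemma bump_smooth_fun:
  assumes "c \<in> A" "bump c \<rho>"
  shows "smooth_fun A \<rho>"
  unfolding smooth_fun_def comp_def
proof
  fix d assume d: "d \<in> A"
  show "smooth_on (snd d ` fst d) (\<lambda>x. \<rho> (chart_inv d x))"
    by (rule extend_by_zero[OF assms(1) d assms(2) _ smooth_change_chart[OF assms(1) d bump_smooth[OF assms(2)]]])
qed

lemma bump_mult:
  assumes "c \<in> A" "bump c \<rho>" "smooth_on (snd c ` fst c) (\<lambda>x. g (chart_inv c x))"
  shows "bump c (\<lambda>q. \<rho> q * g q)"
  using assms unfolding bump_def by (auto intro!: smooth_on_mult open_chart)

lemma bump_vector_field:
  assumes c: "c \<in> A" and \<rho>: "bump c \<rho>"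
  shows "(\<lambda>q. \<rho> q *\<^sub>v coord_vec A c q u) \<in> vector_fields A"
  unfolding vector_fields_def
proof (intro CollectI conjI allI ballI)
  fix q
  show "\<rho> q *\<^sub>v coord_vec A c q u \<in> tangent_space A q"
  proof (cases "q \<in> fst c")
    case True
    then show ?thesis using c by (intro vscale_in coord_vec_in charts_atI)
  next
    case False
    then have "\<rho> q *\<^sub>v coord_vec A c q u = 0\<^sub>v"
      using bump_zero[OF \<rho>] by (simp add: vscale_def vzero_def)
    then show ?thesis by (simp add: vzero_in)
  qed
next
  fix d assume d: "d \<in> A"
  have "smooth_on (snd d ` (fst d \<inter> fst c)) (\<lambda>y. \<rho> (chart_inv d y))"
    by (rule smooth_change_chart[OF c d bump_smooth[OF \<rho>]])
  then have "smooth_on (snd d ` (fst d \<inter> fst c)) (\<lambda>y. \<rho> (chart_inv d y) *\<^sub>R coord_vec A c (chart_inv d y) u d)"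
    using c d by (intro smooth_on_scaleR open_overlap smooth_coord_vec)
  then show "smooth_on (snd d ` fst d) (\<lambda>y. (\<rho> (chart_inv d y) *\<^sub>v coord_vec A c (chart_inv d y) u) d)"
    by (intro extend_by_zero[OF c d \<rho>, where G = "\<lambda>q. (\<rho> q *\<^sub>v coord_vec A c q u) d"])
      (auto simp: vscale_def)
qed

text \<open>Lets identities at \<open>p\<close> be tested on global fields, the only arguments that
  \<open>D\<close> accepts.\<close>

lemma vector_field_through:
  assumes c: "c \<in> charts_at A p"
  obtains X where "X \<in> vector_fields A" "X p c = u"
proof -
  obtain \<rho> N where "bump c \<rho>" "snd c p \<in> N" "\<forall>x\<in>N. \<rho> (chart_inv c x) = 1"
    by (rule bump_exists[OF c])
  then have "\<rho> p = 1" using charts_atD[OF c] chart_inv_snd by metis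
  then have "(\<rho> p *\<^sub>v coord_vec A c p u) c = u" using c by (simp add: vscale_def coord_vec_self)
  then show thesis
    using that[OF bump_vector_field[OF charts_atD(1)[OF c] \<open>bump c \<rho>\<close>]] by simp
qed

text \<open>Supplies global one-forms with prescribed components near a point, from which the
  elements of the horizontal space are built.\<close>

lemma bump_one_form:
  assumes c: "c \<in> A" and \<rho>: "bump c \<rho>" and g: "smooth_on (snd c ` fst c) (\<lambda>x. g (chart_inv c x))"
  shows "(\<lambda>q v. if v \<in> tangent_space A q then \<rho> q * (g q \<bullet> v c) else 0) \<in> one_forms A"
    (is "?s \<in> _")
  unfolding one_forms_def
proof (intro CollectI conjI allI ballI)
  show "?s p \<in> cotangent_space A p" for p
    unfolding cotangent_space_def
    by (auto simp: vadd_in vscale_in) (auto simp: vadd_def vscale_def algebra_simps inner_add_right)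
next
  fix d u assume d: "d \<in> A"
  have 1: "smooth_on (snd d ` (fst d \<inter> fst c)) (\<lambda>y. \<rho> (chart_inv d y))"
    by (rule smooth_change_chart[OF c d bump_smooth[OF \<rho>]])
  have 2: "smooth_on (snd d ` (fst d \<inter> fst c)) (\<lambda>y. g (chart_inv d y))"
    by (rule smooth_change_chart[OF c d g])
  have 3: "smooth_on (snd d ` (fst d \<inter> fst c)) (\<lambda>y. coord_vec A d (chart_inv d y) u c)"
    using smooth_change[where F = "\<lambda>q. coord_vec A d q u c", OF c d smooth_coord_vec[OF d c]] .
  have "smooth_on (snd d ` (fst d \<inter> fst c))
      (\<lambda>y. \<rho> (chart_inv d y) * (g (chart_inv d y) \<bullet> coord_vec A d (chart_inv d y) u c))"
    using c d by (intro smooth_on_mult smooth_on_inner open_overlap 1 2 3)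
  then have "smooth_on (snd d ` (fst d \<inter> fst c))
      (\<lambda>y. ?s (chart_inv d y) (coord_vec A d (chart_inv d y) u))"
    using c d by (subst smooth_on_cong[OF open_overlap[OF d c], where g = "\<lambda>y. \<rho> (chart_inv d y) *
          (g (chart_inv d y) \<bullet> coord_vec A d (chart_inv d y) u c)"])
      (auto simp: coord_vec_in charts_atI chart_inv_snd)
  then show "smooth_on (snd d ` fst d) (\<lambda>y. ?s (chart_inv d y) (coord_vec A d (chart_inv d y) u))"
    by (intro extend_by_zero[OF c d \<rho>, where G = "\<lambda>q. ?s q (coord_vec A d q u)"]) auto
qed

end

section \<open>Christoffel symbols\<close>

locale connected_manifold = manifold T A
  for T :: "'a topology" and A :: "('a, 'e::euclidean_space) chart set" +
  fixes D :: "('a, 'e) conn"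
  assumes linear_connection: "linear_connection A D"
begin

lemma conn_in: "X \<in> vector_fields A \<Longrightarrow> Y \<in> vector_fields A \<Longrightarrow> D X Y \<in> vector_fields A"
  using linear_connection by (simp add: linear_connection_def)

lemma conn_add1: "X \<in> vector_fields A \<Longrightarrow> X' \<in> vector_fields A \<Longrightarrow> Y \<in> vector_fields A \<Longrightarrow>
    D (\<lambda>p. X p +\<^sub>v X' p) Y = (\<lambda>p. D X Y p +\<^sub>v D X' Y p)"
  using linear_connection by (simp add: linear_connection_def)

lemma conn_add2: "X \<in> vector_fields A \<Longrightarrow> Y \<in> vector_fields A \<Longrightarrow> Y' \<in> vector_fields A \<Longrightarrow>
    D X (\<lambda>p. Y p +\<^sub>v Y' p) = (\<lambda>p. D X Y p +\<^sub>v D X Y' p)"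
  using linear_connection by (simp add: linear_connection_def)

lemma conn_scale1: "smooth_fun A f \<Longrightarrow> X \<in> vector_fields A \<Longrightarrow> Y \<in> vector_fields A \<Longrightarrow>
    D (\<lambda>p. f p *\<^sub>v X p) Y = (\<lambda>p. f p *\<^sub>v D X Y p)"
  using linear_connection by (simp add: linear_connection_def)

lemma conn_scale2: "smooth_fun A f \<Longrightarrow> X \<in> vector_fields A \<Longrightarrow> Y \<in> vector_fields A \<Longrightarrow>
    D X (\<lambda>p. f p *\<^sub>v Y p) = (\<lambda>p. (lie_deriv A X f p *\<^sub>v Y p) +\<^sub>v (f p *\<^sub>v D X Y p))"
  using linear_connection by (simp add: linear_connection_def)

lemma smooth_funD: "smooth_fun A f \<Longrightarrow> c \<in> A \<Longrightarrow> smooth_on (snd c ` fst c) (\<lambda>x. f (chart_inv c x))"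
  by (simp add: smooth_fun_def comp_def)

lemma vector_field_scale:
  assumes "smooth_fun A f" "X \<in> vector_fields A"
  shows "(\<lambda>p. f p *\<^sub>v X p) \<in> vector_fields A"
  unfolding vector_fields_def
proof (intro CollectI conjI allI ballI)
  show "f p *\<^sub>v X p \<in> tangent_space A p" for p
    by (rule vscale_in[OF vector_fieldsD(1)[OF assms(2)]])
  show "smooth_on (snd c ` fst c) (\<lambda>x. (f (chart_inv c x) *\<^sub>v X (chart_inv c x)) c)" if "c \<in> A" for c
    unfolding vscale_def
    by (rule smooth_on_scaleR[OF open_chart smooth_funD vector_fieldsD(2)]) (fact that assms)+
qed

lemma vector_field_add:
  assumes "X \<in> vector_fields A" "Y \<in> vector_fields A"
  shows "(\<lambda>p. X p +\<^sub>v Y p) \<in> vector_fields A"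
  unfolding vector_fields_def
proof (intro CollectI conjI allI ballI)
  show "X p +\<^sub>v Y p \<in> tangent_space A p" for p
    by (rule vadd_in[OF assms[THEN vector_fieldsD(1)]])
  show "smooth_on (snd c ` fst c) (\<lambda>x. (X (chart_inv c x) +\<^sub>v Y (chart_inv c x)) c)" if "c \<in> A" for c
    unfolding vadd_def
    by (rule smooth_on_add[OF open_chart vector_fieldsD(2) vector_fieldsD(2)]) (fact that assms)+
qed

lemma smooth_fun_const: "smooth_fun A (\<lambda>p. k)"
  by (simp add: smooth_fun_def comp_def smooth_on_const)

text \<open>The connection rules are stated for two summands, while an expansion in a frame needs
  them for sums with function coefficients. Membership in \<open>vector_fields\<close> is part of
  the claim because the induction step needs it for the partial sum.\<close>

lemma conn_sum:
  assumes "finite I" "\<And>i. i \<in> I \<Longrightarrow> smooth_fun A (f i)" "\<And>i. i \<in> I \<Longrightarrow> E i \<in> vector_fields A"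
    and Y: "Y \<in> vector_fields A"
  shows "(\<lambda>q d. \<Sum>i\<in>I. f i q *\<^sub>R E i q d) \<in> vector_fields A \<and>
    D (\<lambda>q d. \<Sum>i\<in>I. f i q *\<^sub>R E i q d) Y = (\<lambda>q d. \<Sum>i\<in>I. f i q *\<^sub>R D (E i) Y q d) \<and>
    D Y (\<lambda>q d. \<Sum>i\<in>I. f i q *\<^sub>R E i q d) =
      (\<lambda>q d. \<Sum>i\<in>I. lie_deriv A Y (f i) q *\<^sub>R E i q d + f i q *\<^sub>R D Y (E i) q d)"
  using assms(1,2,3)
proof (induction I)
  case empty
  \<comment> \<open>The connection rules do not mention the zero field; it is produced as
    \<open>0 *\<^sub>v Y\<close>, a multiple of \<open>Y\<close> by a constant function.\<close>
  have z: "(\<lambda>q d. 0) = (\<lambda>q. 0 *\<^sub>v Y q)" by (simp add: vscale_def)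
  have l: "lie_deriv A Y (\<lambda>q. 0) q = 0" for q by (simp add: lie_deriv_def comp_def Let_def)
  show ?case
    using conn_scale1[OF smooth_fun_const Y Y, of 0] conn_scale2[OF smooth_fun_const Y Y, of 0]
      vector_field_scale[OF smooth_fun_const Y, of 0]
    by (simp add: z[symmetric] l) (simp add: vscale_def vadd_def)
next
  case (insert i I)
  define S where "S = (\<lambda>q d. \<Sum>i\<in>I. f i q *\<^sub>R E i q d)"
  have e: "(\<lambda>q d. \<Sum>i\<in>insert i I. f i q *\<^sub>R E i q d) = (\<lambda>q. (f i q *\<^sub>v E i q) +\<^sub>v S q)"
    using insert.hyps by (simp add: S_def vadd_def vscale_def)
  have IH: "S \<in> vector_fields A" "D S Y = (\<lambda>q d. \<Sum>i\<in>I. f i q *\<^sub>R D (E i) Y q d)"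
    "D Y S = (\<lambda>q d. \<Sum>i\<in>I. lie_deriv A Y (f i) q *\<^sub>R E i q d + f i q *\<^sub>R D Y (E i) q d)"
    using insert unfolding S_def by auto
  have fi: "smooth_fun A (f i)" "E i \<in> vector_fields A" using insert.prems by auto
  have fE: "(\<lambda>q. f i q *\<^sub>v E i q) \<in> vector_fields A" by (rule vector_field_scale[OF fi])
  show ?case
    unfolding e conn_add1[OF fE IH(1) Y] conn_add2[OF Y fE IH(1)] conn_scale1[OF fi Y]
      conn_scale2[OF fi(1) Y fi(2)] IH(2,3)
    using vector_field_add[OF fE IH(1)] insert.hyps by (simp add: vadd_def vscale_def)
qed

text \<open>A coordinate frame is not global, so it is cut off by a bump \<open>\<rho>\<close>, and
  the fields are multiplied by the square of \<open>\<rho>\<close> before being expanded in it. On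
  \<open>N\<close>, where \<open>\<rho>\<close> is 1, this changes neither the fields nor the result
  of \<open>D\<close>: the connection is linear over functions in the first argument, and in the
  second the Leibniz term contains a derivative of a locally constant function.\<close>

lemma christoffel_exists:
  assumes c: "c \<in> charts_at A p"
  obtains \<Gamma> :: "'e \<Rightarrow> 'e \<Rightarrow> 'e \<Rightarrow> 'e" and N where "open N" "snd c p \<in> N" "N \<subseteq> snd c ` fst c"
    "\<And>x v. linear (\<lambda>u. \<Gamma> x u v)" "\<And>x u. linear (\<Gamma> x u)" "\<And>u v. smooth_on N (\<lambda>x. \<Gamma> x u v)"
    "\<And>X Y x. X \<in> vector_fields A \<Longrightarrow> Y \<in> vector_fields A \<Longrightarrow> x \<in> N \<Longrightarrow>
      D X Y (chart_inv c x) c = FD (\<lambda>x. Y (chart_inv c x) c) x (X (chart_inv c x) c)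
        + \<Gamma> x (X (chart_inv c x) c) (Y (chart_inv c x) c)"
proof -
  note cA = charts_atD[OF c]
  obtain \<rho> N where \<rho>: "bump c \<rho>" and N: "open N" "snd c p \<in> N" "N \<subseteq> snd c ` fst c"
    and "\<forall>x\<in>N. \<rho> (chart_inv c x) = 1"
    by (rule bump_exists[OF c])
  then have \<rho>1: "\<And>x. x \<in> N \<Longrightarrow> \<rho> (chart_inv c x) = 1" by blast
  define E where "E b = (\<lambda>q. \<rho> q *\<^sub>v coord_vec A c q b)" for b
  have E: "E b \<in> vector_fields A" for b unfolding E_def by (rule bump_vector_field[OF cA(1) \<rho>])
  \<comment> \<open>Bilinearity holds at every \<open>x\<close> by construction, whereas smoothness
    and the formula for \<open>D\<close> are claimed on \<open>N\<close> alone.\<close>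
  define \<Gamma> where "\<Gamma> x u v = (\<Sum>b\<in>Basis. \<Sum>b'\<in>Basis. ((u \<bullet> b) * (v \<bullet> b')) *\<^sub>R D (E b) (E b') (chart_inv c x) c)"
    for x u v
  have \<rho>2: "smooth_fun A (\<lambda>q. \<rho> q * \<rho> q)"
    using \<rho> cA by (intro bump_smooth_fun[OF cA(1)] bump_mult) (auto simp: bump_def)
  have comp: "smooth_fun A (\<lambda>q. \<rho> q * (Y q c \<bullet> b))" if "Y \<in> vector_fields A" for Y b
    using cA that by (intro bump_smooth_fun[OF cA(1)] bump_mult \<rho>
        smooth_on_bounded_linear[OF open_chart bounded_linear_inner_left] vector_fieldsD(2))
  \<comment> \<open>One factor \<open>\<rho>\<close> makes the coefficient a global smooth function,
    the other makes the frame vector a global field.\<close>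
  have exp: "(\<lambda>q. (\<rho> q * \<rho> q) *\<^sub>v Y q) = (\<lambda>q d. \<Sum>b\<in>Basis. (\<rho> q * (Y q c \<bullet> b)) *\<^sub>R E b q d)"
    if Y: "Y \<in> vector_fields A" for Y
  proof (intro ext)
    fix q d
    show "((\<rho> q * \<rho> q) *\<^sub>v Y q) d = (\<Sum>b\<in>Basis. (\<rho> q * (Y q c \<bullet> b)) *\<^sub>R E b q d)"
    proof (cases "q \<in> fst c")
      case True
      then have cq: "c \<in> charts_at A q" using cA by (simp add: charts_atI)
      have "Y q d = (\<Sum>b\<in>Basis. (Y q c \<bullet> b) *\<^sub>R coord_vec A c q b d)"
      proof (cases "d \<in> charts_at A q")
        case True
        interpret linear "trans_deriv c d q" by (rule linear_trans_deriv[OF cq True])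
        have "Y q d = trans_deriv c d q (\<Sum>b\<in>Basis. (Y q c \<bullet> b) *\<^sub>R b)"
          using tangent_trans[OF vector_fieldsD(1)[OF Y] cq True] by (simp add: euclidean_representation)
        then show ?thesis using True by (simp add: sum scale coord_vec_apply)
      next
        case False
        then show ?thesis
          using tangent_zero[OF vector_fieldsD(1)[OF Y] False] by (simp add: coord_vec_apply)
      qed
      then show ?thesis by (simp add: E_def vscale_def scaleR_sum_right mult_ac)
    next
      case False
      then show ?thesis using bump_zero[OF \<rho>] by (simp add: E_def vscale_def)
    qed
  qed
  show thesis
  proof
    show "open N" "snd c p \<in> N" "N \<subseteq> snd c ` fst c" by fact+
    show "linear (\<lambda>u. \<Gamma> x u v)" for x v
      by (rule linearI) (simp_all add: \<Gamma>_def inner_add_left algebra_simps sum.distrib scaleR_sum_right)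
    show "linear (\<Gamma> x u)" for x u
      by (rule linearI) (simp_all add: \<Gamma>_def inner_add_left algebra_simps sum.distrib scaleR_sum_right)
    show "smooth_on N (\<lambda>x. \<Gamma> x u v)" for u v
      unfolding \<Gamma>_def
      by (intro smooth_on_sum N smooth_on_bounded_linear[OF _ bounded_linear_scaleR_right]
          smooth_on_subset[OF _ N(3)] vector_fieldsD(2) conn_in E cA)
    fix X Y x assume X: "X \<in> vector_fields A" and Y: "Y \<in> vector_fields A" and x: "x \<in> N"
    let ?q = "chart_inv c x"
    have xc: "x \<in> snd c ` fst c" using x N by blast
    have cq: "c \<in> charts_at A ?q" and sq: "snd c ?q = x"
      using xc cA by (simp_all add: charts_at_chart_inv snd_chart_inv)
    have Eq: "E b ?q c = b" for b
      using \<rho>1[OF x] cq by (simp add: E_def vscale_def coord_vec_self)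
    have dY: "(\<lambda>x. Y (chart_inv c x) c) differentiable at x"
      using vector_fieldsD(3)[OF Y cq] by (simp add: sq)
    have "D X Y ?q c = D (\<lambda>q. (\<rho> q * \<rho> q) *\<^sub>v X q) Y ?q c"
      using \<rho>1[OF x] by (subst conn_scale1[OF \<rho>2 X Y]) (simp add: vscale_def)
    also have "\<dots> = (\<Sum>b\<in>Basis. (X ?q c \<bullet> b) *\<^sub>R D (E b) Y ?q c)"
      unfolding exp[OF X] using \<rho>1[OF x] conn_sum[where f = "\<lambda>b q. \<rho> q * (X q c \<bullet> b)" and E = E,
          OF finite_Basis comp[OF X] E Y] by simp
    also have "\<dots> = (\<Sum>b\<in>Basis. (X ?q c \<bullet> b) *\<^sub>R (FD (\<lambda>x. Y (chart_inv c x) c) x b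
        + (\<Sum>b'\<in>Basis. (Y ?q c \<bullet> b') *\<^sub>R D (E b) (E b') ?q c)))"
    proof (intro sum.cong refl arg_cong2[where f = scaleR])
      fix b :: 'e
      \<comment> \<open>The square of \<open>\<rho>\<close> is constant on \<open>N\<close>, so the
        Leibniz term with its derivative drops out.\<close>
      have "FD (\<lambda>x. \<rho> (chart_inv c x) * \<rho> (chart_inv c x)) x = FD (\<lambda>x. 1) x"
        by (rule FD_cong_open[OF N(1) x]) (simp add: \<rho>1)
      moreover have "lie_deriv A (E b) (\<lambda>q. \<rho> q * \<rho> q) ?q
        = FD (\<lambda>x. \<rho> (chart_inv c x) * \<rho> (chart_inv c x)) (snd c ?q) (E b ?q c)"
        using smooth_on_differentiable[OF smooth_funD[OF \<rho>2 cA(1)] xc]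
        by (intro lie_deriv_chart[OF cq, where X = "E b", OF vector_fieldsD(1)[OF E]]) (simp add: sq)
      ultimately have "D (E b) Y ?q c = D (E b) (\<lambda>q. (\<rho> q * \<rho> q) *\<^sub>v Y q) ?q c"
        using \<rho>1[OF x] by (subst conn_scale2[OF \<rho>2 E Y]) (simp add: vscale_def vadd_def sq)
      also have "\<dots> = (\<Sum>b'\<in>Basis. lie_deriv A (E b) (\<lambda>q. \<rho> q * (Y q c \<bullet> b')) ?q *\<^sub>R b'
          + (Y ?q c \<bullet> b') *\<^sub>R D (E b) (E b') ?q c)"
        unfolding exp[OF Y] using \<rho>1[OF x] conn_sum[where f = "\<lambda>b q. \<rho> q * (Y q c \<bullet> b)" and E = E,
          OF finite_Basis comp[OF Y] E E] by (simp add: Eq)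
      also have "\<dots> = (\<Sum>b'\<in>Basis. (FD (\<lambda>x. Y (chart_inv c x) c) x b \<bullet> b') *\<^sub>R b'
          + (Y ?q c \<bullet> b') *\<^sub>R D (E b) (E b') ?q c)"
      proof (intro sum.cong refl arg_cong2[where f = "(+)"] arg_cong2[where f = scaleR])
        fix b' :: 'e
        have "lie_deriv A (E b) (\<lambda>q. \<rho> q * (Y q c \<bullet> b')) ?q
          = FD (\<lambda>x. \<rho> (chart_inv c x) * (Y (chart_inv c x) c \<bullet> b')) (snd c ?q) (E b ?q c)"
          using smooth_on_differentiable[OF smooth_funD[OF comp[OF Y] cA(1)] xc]
          by (intro lie_deriv_chart[OF cq, where X = "E b", OF vector_fieldsD(1)[OF E]]) (simp add: sq)
        also have "\<dots> = FD (\<lambda>x. Y (chart_inv c x) c \<bullet> b') x b"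
          unfolding Eq sq by (rule fun_cong[OF FD_cong_open[OF N(1) x]]) (simp add: \<rho>1)
        also have "\<dots> = FD (\<lambda>x. Y (chart_inv c x) c) x b \<bullet> b'"
          by (rule FD_bounded_linear_compose[OF bounded_linear_inner_left dY])
        finally show "lie_deriv A (E b) (\<lambda>q. \<rho> q * (Y q c \<bullet> b')) ?q
          = FD (\<lambda>x. Y (chart_inv c x) c) x b \<bullet> b'" .
      qed
      finally show "D (E b) Y ?q c = FD (\<lambda>x. Y (chart_inv c x) c) x b
          + (\<Sum>b'\<in>Basis. (Y ?q c \<bullet> b') *\<^sub>R D (E b) (E b') ?q c)"
        by (simp add: sum.distrib euclidean_representation)
    qed
    also have "\<dots> = FD (\<lambda>x. Y (chart_inv c x) c) x (X ?q c) + \<Gamma> x (X ?q c) (Y ?q c)"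
      unfolding FD_expand[OF dY, of "X ?q c"]
      by (simp add: \<Gamma>_def algebra_simps sum.distrib scaleR_sum_right)
    finally show "D X Y ?q c = FD (\<lambda>x. Y (chart_inv c x) c) x (X ?q c) + \<Gamma> x (X ?q c) (Y ?q c)" .
  qed
qed

end

section \<open>The cotangent bundle\<close>

context atlas
begin

text \<open>Covectors are identified with vectors of the model space through its inner product, so
  that the pairing with a tangent vector becomes an inner product of components;
  \<open>cov_of\<close> is the inverse identification.\<close>

definition cov_comp :: "('a, 'e) chart \<Rightarrow> 'a \<Rightarrow> ('a, 'e) covec \<Rightarrow> 'e" where
  "cov_comp c p \<alpha> = (\<Sum>b\<in>Basis. \<alpha> (coord_vec A c p b) *\<^sub>R b)"

definition cov_of :: "('a, 'e) chart \<Rightarrow> 'a \<Rightarrow> 'e \<Rightarrow> ('a, 'e) covec" where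
  "cov_of c p \<xi> = (\<lambda>v. if v \<in> tangent_space A p then \<xi> \<bullet> v c else 0)"

lemma cov_of_in: "cov_of c p \<xi> \<in> cotangent_space A p"
  unfolding cotangent_space_def cov_of_def
  by (auto simp: vadd_in vscale_in) (auto simp: vadd_def vscale_def inner_add_right)

lemma cov_comp_of: "c \<in> charts_at A p \<Longrightarrow> cov_comp c p (cov_of c p \<xi>) = \<xi>"
  by (simp add: cov_comp_def cov_of_def coord_vec_in coord_vec_self euclidean_representation)

lemma cotangentD:
  assumes "\<alpha> \<in> cotangent_space A p"
  shows "v \<in> tangent_space A p \<Longrightarrow> w \<in> tangent_space A p \<Longrightarrow> \<alpha> (v +\<^sub>v w) = \<alpha> v + \<alpha> w"
    and "v \<in> tangent_space A p \<Longrightarrow> \<alpha> (a *\<^sub>v v) = a * \<alpha> v"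
    and "v \<notin> tangent_space A p \<Longrightarrow> \<alpha> v = 0"
  using assms by (auto simp: cotangent_space_def)

lemma linear_cov:
  assumes "c \<in> charts_at A p" "\<alpha> \<in> cotangent_space A p"
  shows "linear (\<lambda>u. \<alpha> (coord_vec A c p u))"
  by (rule linearI)
    (simp_all add: assms coord_vec_add coord_vec_scale cotangentD[OF assms(2)] coord_vec_in)

lemma cov_comp_apply:
  assumes c: "c \<in> charts_at A p" and \<alpha>: "\<alpha> \<in> cotangent_space A p" and v: "v \<in> tangent_space A p"
  shows "\<alpha> v = cov_comp c p \<alpha> \<bullet> v c"
proof -
  interpret linear "\<lambda>u. \<alpha> (coord_vec A c p u)" by (rule linear_cov[OF c \<alpha>])
  have "\<alpha> v = \<alpha> (coord_vec A c p (\<Sum>b\<in>Basis. (v c \<bullet> b) *\<^sub>R b))"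
    by (simp add: euclidean_representation coord_vec_eq[OF c v])
  also have "\<dots> = cov_comp c p \<alpha> \<bullet> v c"
    by (simp add: sum scale cov_comp_def inner_sum_left inner_commute[of "v c"] mult.commute)
  finally show ?thesis .
qed

lemma cov_of_comp:
  assumes "c \<in> charts_at A p" "\<alpha> \<in> cotangent_space A p"
  shows "cov_of c p (cov_comp c p \<alpha>) = \<alpha>"
  using cov_comp_apply[OF assms] cotangentD(3)[OF assms(2)] by (auto simp: cov_of_def)

lemma cotangent_add: "\<alpha> \<in> cotangent_space A p \<Longrightarrow> \<beta> \<in> cotangent_space A p \<Longrightarrow> \<alpha> +\<^sub>v \<beta> \<in> cotangent_space A p"
  unfolding cotangent_space_def by (auto simp: vadd_def algebra_simps)

lemma cotangent_scale: "\<alpha> \<in> cotangent_space A p \<Longrightarrow> a *\<^sub>v \<alpha> \<in> cotangent_space A p"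
  unfolding cotangent_space_def by (auto simp: vscale_def algebra_simps)

lemma cov_comp_add: "cov_comp c p (\<alpha> +\<^sub>v \<beta>) = cov_comp c p \<alpha> + cov_comp c p \<beta>"
  by (simp add: cov_comp_def vadd_def algebra_simps sum.distrib)

lemma cov_comp_scale: "cov_comp c p (a *\<^sub>v \<alpha>) = a *\<^sub>R cov_comp c p \<alpha>"
  by (simp add: cov_comp_def vscale_def scaleR_sum_right)

lemma snd_cot_chart: "snd (cot_chart A c) z = (snd c (fst z), cov_comp c (fst z) (snd z))"
  by (simp add: cot_chart_def cov_comp_def split_beta)

lemma fst_cot_chart: "z \<in> fst (cot_chart A c) \<longleftrightarrow> fst z \<in> fst c \<and> snd z \<in> cotangent_space A (fst z)"
  by (auto simp: cot_chart_def split_beta)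

section \<open>The induced charts of the cotangent bundle and their transition maps\<close>

lemma inj_cot_chart:
  assumes c: "c \<in> A"
  shows "inj_on (snd (cot_chart A c)) (fst (cot_chart A c))"
proof (rule inj_onI)
  fix z w assume z: "z \<in> fst (cot_chart A c)" and w: "w \<in> fst (cot_chart A c)"
    and eq: "snd (cot_chart A c) z = snd (cot_chart A c) w"
  have 1: "fst z = fst w"
    using inj_onD[OF inj_chart[OF c], of "fst z" "fst w"] eq z w by (simp add: snd_cot_chart fst_cot_chart)
  have cz: "c \<in> charts_at A (fst z)" using z c by (simp add: fst_cot_chart charts_atI)
  have "snd z = cov_of c (fst z) (cov_comp c (fst z) (snd z))"
    using z cz by (simp add: cov_of_comp fst_cot_chart)
  also have "\<dots> = cov_of c (fst z) (cov_comp c (fst z) (snd w))"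
    using eq 1 by (simp add: snd_cot_chart)
  also have "\<dots> = snd w"
    using w cz 1 by (simp add: cov_of_comp fst_cot_chart)
  finally show "z = w" using 1 by (simp add: prod_eq_iff)
qed

lemma cot_chart_inv:
  assumes c: "c \<in> A" and x: "x \<in> snd c ` fst c"
  shows "chart_inv (cot_chart A c) (x, \<xi>) = (chart_inv c x, cov_of c (chart_inv c x) \<xi>)"
  unfolding chart_inv_def[of "cot_chart A c"]
  by (rule inv_into_f_eq[OF inj_cot_chart[OF c]])
    (simp_all add: fst_cot_chart snd_cot_chart cov_of_in chart_inv_in x snd_chart_inv
      cov_comp_of charts_at_chart_inv c)

lemma cot_overlap:
  assumes c: "c \<in> A"
  shows "snd (cot_chart A c) ` (fst (cot_chart A c) \<inter> fst (cot_chart A d))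
    = (snd c ` (fst c \<inter> fst d)) \<times> UNIV"
proof (intro equalityI subsetI)
  fix y assume y: "y \<in> (snd c ` (fst c \<inter> fst d)) \<times> (UNIV :: 'e set)"
  then obtain p where p: "p \<in> fst c" "p \<in> fst d" "fst y = snd c p" by auto
  then have "y = snd (cot_chart A c) (p, cov_of c p (snd y))"
    using c by (simp add: snd_cot_chart cov_comp_of charts_atI prod_eq_iff)
  then show "y \<in> snd (cot_chart A c) ` (fst (cot_chart A c) \<inter> fst (cot_chart A d))"
    using p by (auto simp: fst_cot_chart cov_of_in intro!: image_eqI)
qed (auto simp: snd_cot_chart fst_cot_chart)

lemma cov_comp_change:
  assumes "c \<in> charts_at A p" "d \<in> charts_at A p" "\<alpha> \<in> cotangent_space A p"
  shows "cov_comp d p \<alpha> = (\<Sum>b\<in>Basis. (cov_comp c p \<alpha> \<bullet> coord_vec A d p b c) *\<^sub>R b)"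
  unfolding cov_comp_def[of d]
  by (intro sum.cong refl arg_cong2[where f = scaleR] cov_comp_apply assms coord_vec_in)

text \<open>A transition map is that of the base in the first component and linear in the fibre
  variable in the second. Its coefficients are entries of the transposed Jacobian of the opposite
  transition of the base, that is, components of \<open>coord_vec A d\<close>.\<close>

lemma atlas_cot: "atlas (cot_atlas A)"
proof
  fix c' d' assume "c' \<in> cot_atlas A" "d' \<in> cot_atlas A"
  then obtain c d where c: "c \<in> A" "c' = cot_chart A c" and d: "d \<in> A" "d' = cot_chart A d"
    by (auto simp: cot_atlas_def)
  show "inj_on (snd c') (fst c')" using inj_cot_chart c by simp
  let ?S = "(snd c ` (fst c \<inter> fst d)) \<times> (UNIV :: 'e set)"
  have S: "open ?S" using c d by (intro open_Times open_overlap) auto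
  then show "open (snd c' ` (fst c' \<inter> fst d'))" using cot_overlap c d by simp
  have eq: "snd d' (chart_inv c' y) = (snd d (chart_inv c (fst y)),
      \<Sum>b\<in>Basis. (snd y \<bullet> coord_vec A d (chart_inv c (fst y)) b c) *\<^sub>R b)" if y: "y \<in> ?S" for y
  proof -
    let ?q = "chart_inv c (fst y)"
    have x: "fst y \<in> snd c ` fst c" "?q \<in> fst d"
      using y c(1) by (auto simp: chart_inv_snd)
    then have "c \<in> charts_at A ?q" "d \<in> charts_at A ?q"
      using c d by (simp_all add: charts_atI chart_inv_in)
    then show ?thesis
      using cot_chart_inv[OF c(1) x(1), of "snd y"] cov_comp_change[of c ?q d "cov_of c ?q (snd y)"]
      by (simp add: c d snd_cot_chart cov_of_in cov_comp_of)
  qed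
  have iff: "smooth_on ?S (\<lambda>y. snd d' (chart_inv c' y)) \<longleftrightarrow> smooth_on ?S (\<lambda>y. (snd d (chart_inv c (fst y)),
      \<Sum>b\<in>Basis. (snd y \<bullet> coord_vec A d (chart_inv c (fst y)) b c) *\<^sub>R b))"
    by (rule smooth_on_cong[OF S eq])
  have "smooth_on ?S (\<lambda>y. (snd d (chart_inv c (fst y)),
      \<Sum>b\<in>Basis. (snd y \<bullet> coord_vec A d (chart_inv c (fst y)) b c) *\<^sub>R b))"
    using c d
    by (intro smooth_on_Pair smooth_on_sum S smooth_on_bounded_linear[OF S bounded_linear_scaleR_left]
       smooth_on_inner smooth_on_compose[OF S _ smooth_transition]
       smooth_on_compose[OF S _ smooth_coord_vec]
       smooth_on_bounded_linear[OF S bounded_linear_fst smooth_on_ident[OF S]]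
       smooth_on_bounded_linear[OF S bounded_linear_snd smooth_on_ident[OF S]]) auto
  then show "smooth_on (snd c' ` (fst c' \<inter> fst d')) (\<lambda>x. snd d' (chart_inv c' x))"
    unfolding iff[symmetric] using c d by (simp add: cot_overlap)
qed

section \<open>Vertical lifts, the projection and sections in induced charts\<close>

lemma cot_charts_atI:
  "c \<in> charts_at A (fst z) \<Longrightarrow> snd z \<in> cotangent_space A (fst z) \<Longrightarrow>
    cot_chart A c \<in> charts_at (cot_atlas A) z"
  by (auto simp: charts_at_def cot_atlas_def fst_cot_chart)

lemma cot_charts_atE:
  assumes "d \<in> charts_at (cot_atlas A) z"
  obtains c where "c \<in> charts_at A (fst z)" "d = cot_chart A c" "snd z \<in> cotangent_space A (fst z)"
  using assms by (auto simp: charts_at_def cot_atlas_def fst_cot_chart)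

text \<open>In the induced chart the defining curve is affine with velocity
  \<open>(0, cov_comp c (fst z) \<beta>)\<close>; the remaining charts follow by the chain
  rule.\<close>

lemma vlift_chart:
  assumes c: "c \<in> charts_at A (fst z)" and z: "snd z \<in> cotangent_space A (fst z)"
    and \<beta>: "\<beta> \<in> cotangent_space A (fst z)"
  shows "vlift A z \<beta> = coord_vec (cot_atlas A) (cot_chart A c) z (0, cov_comp c (fst z) \<beta>)"
proof
  fix d
  interpret cot: atlas "cot_atlas A" by (rule atlas_cot)
  let ?e = "cot_chart A c" and ?w = "(0, cov_comp c (fst z) \<beta>)"
  have e: "?e \<in> charts_at (cot_atlas A) z" by (rule cot_charts_atI[OF c z])
  show "vlift A z \<beta> d = coord_vec (cot_atlas A) ?e z ?w d"
  proof (cases "d \<in> charts_at (cot_atlas A) z")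
    case True
    let ?g = "\<lambda>t. (fst z, snd z +\<^sub>v (t *\<^sub>v \<beta>))"
    have g0: "?g 0 = z" by (simp add: vadd_def vscale_def)
    have inv: "chart_inv ?e (snd ?e (?g t)) = ?g t" for t
      using c z \<beta> cot.charts_atD(1)[OF e]
      by (intro cot.chart_inv_snd) (simp_all add: fst_cot_chart charts_atD cotangent_add cotangent_scale)
    have "((\<lambda>t. snd ?e (?g t)) has_derivative (\<lambda>h. h *\<^sub>R ?w)) (at 0)"
      unfolding snd_cot_chart by (auto simp: cov_comp_add cov_comp_scale intro!: derivative_eq_intros)
    moreover have "((\<lambda>y. snd d (chart_inv ?e y)) has_derivative cot.trans_deriv ?e d z) (at (snd ?e (?g 0)))"
      unfolding cot.trans_deriv_def g0 by (rule FD_works[OF cot.differentiable_transition[OF e True]])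
    ultimately have "((\<lambda>t. snd d (chart_inv ?e (snd ?e (?g t)))) has_derivative
        (\<lambda>h. cot.trans_deriv ?e d z (h *\<^sub>R ?w))) (at 0)"
      by (rule has_derivative_compose)
    then have "((\<lambda>t. snd d (?g t)) has_vector_derivative cot.trans_deriv ?e d z ?w) (at 0)"
      unfolding has_vector_derivative_def inv linear_cmul[OF cot.linear_trans_deriv[OF e True]] .
    then show ?thesis
      using True by (simp add: vlift_def cot.coord_vec_apply vector_derivative_at)
  next
    case False
    then show ?thesis by (simp add: vlift_def cot.coord_vec_apply)
  qed
qed

text \<open>With respect to \<open>cot_chart A c\<close> and \<open>c\<close> the projection is
  \<open>fst\<close>, which is its own derivative.\<close>

lemma pushforward_fst:
  assumes c: "c \<in> charts_at A (fst z)" and z: "snd z \<in> cotangent_space A (fst z)"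
  shows "pushforward (cot_atlas A) A fst z (coord_vec (cot_atlas A) (cot_chart A c) z (u, \<eta>))
    = coord_vec A c (fst z) u"
proof -
  interpret cot: atlas "cot_atlas A" by (rule atlas_cot)
  let ?e = "cot_chart A c" and ?S = "(snd c ` fst c) \<times> (UNIV :: 'e set)"
  have e: "?e \<in> charts_at (cot_atlas A) z" by (rule cot_charts_atI[OF c z])
  have S: "open ?S" "snd ?e z \<in> ?S"
    using c by (auto intro: open_Times open_chart charts_atD simp: snd_cot_chart)
  have fst_inv: "fst (chart_inv ?e y) = chart_inv c (fst y)" if "y \<in> ?S" for y
    using that cot_chart_inv[OF charts_atD(1)[OF c], of "fst y" "snd y"] by auto
  have eq: "fst y = snd c (fst (chart_inv ?e y))" if "y \<in> ?S" for y
    unfolding fst_inv[OF that] using that by (auto simp: snd_chart_inv)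
  have d: "((\<lambda>y. snd c (fst (chart_inv ?e y))) has_derivative fst) (at (snd ?e z))"
    using has_derivative_fst[OF has_derivative_ident]
    by (rule has_derivative_transform_within_open[OF _ S eq])
  have "pushforward (cot_atlas A) A fst z (coord_vec (cot_atlas A) ?e z (u, \<eta>))
    = coord_vec A c (fst z) (FD (\<lambda>y. snd c (fst (chart_inv ?e y))) (snd ?e z)
        (coord_vec (cot_atlas A) ?e z (u, \<eta>) ?e))"
    using d by (intro cot.pushforward_chart[OF atlas_axioms e, where F = fst, OF c cot.coord_vec_in[OF e] _ S])
      (auto simp: differentiable_def fst_inv chart_inv_in)
  then show ?thesis by (simp add: FD_eq[OF d] cot.coord_vec_self[OF e])
qed

lemma one_form_smooth:
  assumes "s \<in> one_forms A" "c \<in> A"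
  shows "smooth_on (snd c ` fst c) (\<lambda>x. cov_comp c (chart_inv c x) (s (chart_inv c x)))"
  unfolding cov_comp_def using assms
  by (intro smooth_on_sum open_chart smooth_on_bounded_linear[OF _ bounded_linear_scaleR_left])
    (auto simp: one_forms_def)

lemma one_form_in: "s \<in> one_forms A \<Longrightarrow> s q \<in> cotangent_space A q"
  by (simp add: one_forms_def)

lemma pushforward_section:
  assumes c: "c \<in> charts_at A p" and s: "s \<in> one_forms A" and v: "v \<in> tangent_space A p"
  shows "pushforward A (cot_atlas A) (\<lambda>q. (q, s q)) p v = coord_vec (cot_atlas A) (cot_chart A c) (p, s p)
    (v c, FD (\<lambda>x. cov_comp c (chart_inv c x) (s (chart_inv c x))) (snd c p) (v c))"
proof -
  let ?sc = "\<lambda>x. cov_comp c (chart_inv c x) (s (chart_inv c x))"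
  have S: "open (snd c ` fst c)" "snd c p \<in> snd c ` fst c"
    using c by (auto intro: open_chart charts_atD coords_in)
  have e: "cot_chart A c \<in> charts_at (cot_atlas A) (p, s p)"
    using c by (intro cot_charts_atI) (simp_all add: one_form_in[OF s])
  have eq: "(x, ?sc x) = snd (cot_chart A c) (chart_inv c x, s (chart_inv c x))" if "x \<in> snd c ` fst c" for x
    using that by (simp add: snd_cot_chart snd_chart_inv)
  have "((\<lambda>x. (x, ?sc x)) has_derivative (\<lambda>u. (u, FD ?sc (snd c p) u))) (at (snd c p))"
    using smooth_on_differentiable[OF one_form_smooth[OF s charts_atD(1)[OF c]] S(2)]
    by (intro has_derivative_Pair has_derivative_ident FD_works)
  then have d: "((\<lambda>x. snd (cot_chart A c) (chart_inv c x, s (chart_inv c x))) has_derivative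
      (\<lambda>u. (u, FD ?sc (snd c p) u))) (at (snd c p))"
    by (rule has_derivative_transform_within_open[OF _ S eq])
  show ?thesis
    using d pushforward_chart[OF atlas_cot c, where F = "\<lambda>q. (q, s q)", OF e v _ S]
    by (simp add: FD_eq[OF d] differentiable_def fst_cot_chart chart_inv_in one_form_in[OF s]) blast
qed

end

section \<open>Horizontal lifts\<close>

text \<open>In a chart, the dual connection on 1-forms is \<open>D\<^sub>u s = ds (u) - hor G s u\<close> with \<open>G\<close> the Christoffel
  symbols.\<close>

definition hor :: "('e::euclidean_space \<Rightarrow> 'e \<Rightarrow> 'e) \<Rightarrow> 'e \<Rightarrow> 'e \<Rightarrow> 'e" where
  "hor G \<xi> u = (\<Sum>b\<in>Basis. (\<xi> \<bullet> G u b) *\<^sub>R b)"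

text \<open>\<open>hor G \<xi> u\<close> is the transpose of \<open>G u\<close> applied to
  \<xi>.\<close>

lemma hor_inner:
  assumes "linear (G u)"
  shows "hor G \<xi> u \<bullet> v = \<xi> \<bullet> G u v"
proof -
  interpret linear "G u" by fact
  have "G u v = G u (\<Sum>b\<in>Basis. (v \<bullet> b) *\<^sub>R b)" by (simp add: euclidean_representation)
  then show ?thesis by (simp add: sum scale hor_def inner_sum_left inner_sum_right inner_commute[of v] mult.commute)
qed

lemma linear_hor:
  assumes "\<And>v. linear (\<lambda>u. G u v)"
  shows "linear (hor G \<xi>)"
  by (rule linearI)
    (simp_all add: hor_def linear_add[OF assms] linear_cmul[OF assms] inner_add_right algebra_simps sum.distrib scaleR_sum_right)

context connected_manifold
begin

sublocale cot: atlas "cot_atlas A" by (rule atlas_cot)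

text \<open>\<open>G\<close> is the value of the Christoffel symbols at the single point
  \<open>p\<close>. Smoothness in the point is left out, because horizontal spaces, lifts and the
  almost complex structure over \<open>p\<close> depend on this value alone.\<close>

definition christoffel :: "('a, 'e) chart \<Rightarrow> 'a \<Rightarrow> ('e \<Rightarrow> 'e \<Rightarrow> 'e) \<Rightarrow> bool" where
  "christoffel c p G \<longleftrightarrow> (\<forall>u. linear (G u)) \<and> (\<forall>v. linear (\<lambda>u. G u v)) \<and>
    (\<forall>X\<in>vector_fields A. \<forall>Y\<in>vector_fields A.
      D X Y p c = FD (\<lambda>x. Y (chart_inv c x) c) (snd c p) (X p c) + G (X p c) (Y p c))"

lemma christoffelD:
  assumes "christoffel c p G"
  shows "linear (G u)" "linear (\<lambda>u. G u v)"
    "X \<in> vector_fields A \<Longrightarrow> Y \<in> vector_fields A \<Longrightarrow>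
      D X Y p c = FD (\<lambda>x. Y (chart_inv c x) c) (snd c p) (X p c) + G (X p c) (Y p c)"
  using assms by (auto simp: christoffel_def)

text \<open>The derivative of \<open>Y\<close> occurs both in the derivative of
  \<open>s q (Y q)\<close> and in \<open>s p (D X Y p)\<close> and cancels, so being parallel at
  \<open>p\<close> is a condition on the first derivative of the components of
  \<open>s\<close>.\<close>

lemma cov_deriv1_chart:
  assumes c: "c \<in> charts_at A p" and G: "christoffel c p G"
    and X: "X \<in> vector_fields A" and Y: "Y \<in> vector_fields A" and s: "s \<in> one_forms A"
  shows "cov_deriv1 A D X s Y p =
    (FD (\<lambda>x. cov_comp c (chart_inv c x) (s (chart_inv c x))) (snd c p) (X p c)
      - hor G (cov_comp c p (s p)) (X p c)) \<bullet> Y p c"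
proof -
  let ?sc = "\<lambda>x. cov_comp c (chart_inv c x) (s (chart_inv c x))" and ?Y = "\<lambda>x. Y (chart_inv c x) c"
  note cA = charts_atD[OF c]
  have S: "open (snd c ` fst c)" "snd c p \<in> snd c ` fst c"
    using c by (auto intro: open_chart charts_atD coords_in)
  have p: "chart_inv c (snd c p) = p" using cA by (simp add: chart_inv_snd)
  have eq: "?sc x \<bullet> ?Y x = s (chart_inv c x) (Y (chart_inv c x))" if "x \<in> snd c ` fst c" for x
    using cov_comp_apply[OF charts_at_chart_inv[OF cA(1) that] one_form_in[OF s] vector_fieldsD(1)[OF Y]]
    by simp
  have "((\<lambda>x. ?sc x \<bullet> ?Y x) has_derivative
      (\<lambda>h. ?sc (snd c p) \<bullet> FD ?Y (snd c p) h + FD ?sc (snd c p) h \<bullet> ?Y (snd c p))) (at (snd c p))"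
    using smooth_on_differentiable[OF one_form_smooth[OF s cA(1)] S(2)] vector_fieldsD(3)[OF Y c]
    by (intro has_derivative_inner FD_works)
  then have d: "((\<lambda>x. s (chart_inv c x) (Y (chart_inv c x))) has_derivative
      (\<lambda>h. ?sc (snd c p) \<bullet> FD ?Y (snd c p) h + FD ?sc (snd c p) h \<bullet> ?Y (snd c p))) (at (snd c p))"
    by (rule has_derivative_transform_within_open[OF _ S eq])
  have "lie_deriv A X (\<lambda>q. s q (Y q)) p =
      ?sc (snd c p) \<bullet> FD ?Y (snd c p) (X p c) + FD ?sc (snd c p) (X p c) \<bullet> ?Y (snd c p)"
    using lie_deriv_chart[OF c, where X = X, OF vector_fieldsD(1)[OF X], where f = "\<lambda>q. s q (Y q)"] d
    by (simp add: FD_eq[OF d] differentiable_def) blast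
  moreover have "s p (D X Y p) = ?sc (snd c p) \<bullet> D X Y p c"
    using cov_comp_apply[OF c one_form_in[OF s] vector_fieldsD(1)[OF conn_in[OF X Y]]] p by simp
  ultimately show ?thesis
    unfolding cov_deriv1_def christoffelD(3)[OF G X Y]
    by (simp add: p inner_diff_left inner_add_right hor_inner[of G, OF christoffelD(1)[OF G]])
qed

text \<open>Testing on fields \<open>Y\<close> with arbitrary value at the base point shows that a
  form parallel along \<open>X\<close> has components with derivative \<open>hor\<close> in that
  direction. Conversely, a one-form with affine components near the point realises every vector of
  the claimed range.\<close>

lemma horizontal_chart:
  assumes c: "c \<in> charts_at A (fst z)" and z: "snd z \<in> cotangent_space A (fst z)"
    and G: "christoffel c (fst z) G"
  shows "horizontal A D z =
    range (\<lambda>u. coord_vec (cot_atlas A) (cot_chart A c) z (u, hor G (cov_comp c (fst z) (snd z)) u))"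
    (is "_ = range ?h")
proof (intro equalityI subsetI)
  let ?p = "fst z"
  note cA = charts_atD[OF c]
  have p: "chart_inv c (snd c ?p) = ?p" using cA by (simp add: chart_inv_snd)
  {
    fix h assume "h \<in> horizontal A D z"
    then obtain X s where X: "X \<in> vector_fields A" and s: "s \<in> one_forms A" "s ?p = snd z"
      and par: "\<forall>Y\<in>vector_fields A. cov_deriv1 A D X s Y ?p = 0"
      and h: "h = pushforward A (cot_atlas A) (\<lambda>q. (q, s q)) ?p (X ?p)"
      unfolding horizontal_def by blast
    let ?sc = "\<lambda>x. cov_comp c (chart_inv c x) (s (chart_inv c x))"
    have "FD ?sc (snd c ?p) (X ?p c) = hor G (cov_comp c ?p (snd z)) (X ?p c)"
    proof (rule euclidean_eqI)
      fix b :: 'e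
      obtain Y where "Y \<in> vector_fields A" "Y ?p c = b"
        by (rule vector_field_through[OF c, of b])
      then show "FD ?sc (snd c ?p) (X ?p c) \<bullet> b = hor G (cov_comp c ?p (snd z)) (X ?p c) \<bullet> b"
        using par cov_deriv1_chart[OF c G X _ s(1), of Y] s(2) by (simp add: inner_diff_left)
    qed
    then show "h \<in> range ?h"
      using h pushforward_section[OF c s(1) vector_fieldsD(1)[OF X]] s(2) by simp
  }
  fix h assume "h \<in> range ?h"
  then obtain u where h: "h = ?h u" by blast
  obtain X where X: "X \<in> vector_fields A" "X ?p c = u"
    by (rule vector_field_through[OF c, of u])
  let ?\<xi> = "cov_comp c ?p (snd z)"
  \<comment> \<open>Affine components with value \<open>?\<xi>\<close> and derivative
    \<open>hor G ?\<xi>\<close> at the base point: the resulting form is parallel there in all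
    directions, whatever \<open>u\<close> is.\<close>
  define g where "g q = ?\<xi> + hor G ?\<xi> (snd c q - snd c ?p)" for q
  obtain \<rho> N where \<rho>: "bump c \<rho>" and N: "open N" "snd c ?p \<in> N" "N \<subseteq> snd c ` fst c"
    and \<rho>1: "\<forall>x\<in>N. \<rho> (chart_inv c x) = 1"
    by (rule bump_exists[OF c])
  define s where "s = (\<lambda>q v. if v \<in> tangent_space A q then \<rho> q * (g q \<bullet> v c) else 0)"
  have bl: "bounded_linear (hor G ?\<xi>)"
    using linear_hor[OF christoffelD(2)[OF G]] by (simp add: linear_conv_bounded_linear)
  have "smooth_on (snd c ` fst c) (\<lambda>x. ?\<xi> + hor G ?\<xi> (x - snd c ?p))"
    using open_chart[OF cA(1)]
    by (intro smooth_on_add smooth_on_bounded_linear[OF _ bl] smooth_on_diff smooth_on_const smooth_on_ident)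
  then have "smooth_on (snd c ` fst c) (\<lambda>x. g (chart_inv c x))"
    using smooth_on_cong[OF open_chart[OF cA(1)], of "\<lambda>x. ?\<xi> + hor G ?\<xi> (x - snd c ?p)" "\<lambda>x. g (chart_inv c x)"]
    by (simp add: g_def snd_chart_inv)
  then have s: "s \<in> one_forms A"
    unfolding s_def by (rule bump_one_form[OF cA(1) \<rho>])
  have s_of: "s (chart_inv c x) = cov_of c (chart_inv c x) (?\<xi> + hor G ?\<xi> (x - snd c ?p))" if "x \<in> N" for x
    using \<rho>1 that N(3) by (auto simp: s_def cov_of_def g_def snd_chart_inv subset_iff)
  have sp: "s ?p = snd z"
    using s_of[OF N(2)] bl by (simp add: p linear_0[OF bounded_linear.linear] cov_of_comp[OF c z])
  let ?sc = "\<lambda>x. cov_comp c (chart_inv c x) (s (chart_inv c x))"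
  have eq: "?\<xi> + hor G ?\<xi> (x - snd c ?p) = ?sc x" if "x \<in> N" for x
    using that N cA by (simp add: s_of cov_comp_of charts_at_chart_inv subset_iff)
  have "((\<lambda>x. ?\<xi> + hor G ?\<xi> (x - snd c ?p)) has_derivative (\<lambda>x. 0 + hor G ?\<xi> (x - 0))) (at (snd c ?p))"
    by (intro has_derivative_add has_derivative_const bounded_linear.has_derivative[OF bl] has_derivative_diff has_derivative_ident)
  then have "(?sc has_derivative (\<lambda>x. 0 + hor G ?\<xi> (x - 0))) (at (snd c ?p))"
    by (rule has_derivative_transform_within_open[OF _ N(1,2) eq])
  then have FD: "FD ?sc (snd c ?p) = hor G ?\<xi>" using FD_eq by fastforce
  have "\<forall>Y\<in>vector_fields A. cov_deriv1 A D X s Y ?p = 0"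
    using cov_deriv1_chart[OF c G X(1) _ s] by (simp add: FD sp)
  moreover have "h = pushforward A (cot_atlas A) (\<lambda>q. (q, s q)) ?p (X ?p)"
    using pushforward_section[OF c s vector_fieldsD(1)[OF X(1)]] by (simp add: h FD sp X(2))
  ultimately show "h \<in> horizontal A D z"
    unfolding horizontal_def using X(1) s sp by blast
qed

text \<open>The projection recovers the first component \<open>u\<close>, so a horizontal vector
  over \<open>v\<close> is unique and the definite description is justified.\<close>

lemma hlift_chart:
  assumes c: "c \<in> charts_at A (fst z)" and z: "snd z \<in> cotangent_space A (fst z)"
    and G: "christoffel c (fst z) G" and v: "v \<in> tangent_space A (fst z)"
  shows "hlift A D z v =
    coord_vec (cot_atlas A) (cot_chart A c) z (v c, hor G (cov_comp c (fst z) (snd z)) (v c))"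
  unfolding hlift_def horizontal_chart[OF c z G]
proof (rule the_equality)
  fix h
  assume "h \<in> range (\<lambda>u. coord_vec (cot_atlas A) (cot_chart A c) z (u, hor G (cov_comp c (fst z) (snd z)) u)) \<and>
    pushforward (cot_atlas A) A fst z h = v"
  then obtain u where u: "h = coord_vec (cot_atlas A) (cot_chart A c) z (u, hor G (cov_comp c (fst z) (snd z)) u)"
    "coord_vec A c (fst z) u = v"
    using pushforward_fst[OF c z] by force
  then have "u = v c" using coord_vec_self[OF c, of u] by simp
  with u show "h = coord_vec (cot_atlas A) (cot_chart A c) z (v c, hor G (cov_comp c (fst z) (snd z)) (v c))"
    by simp
qed (simp add: pushforward_fst[OF c z] coord_vec_eq[OF c v])

lemma splitting_chart:
  assumes c: "c \<in> charts_at A (fst z)" and z: "snd z \<in> cotangent_space A (fst z)"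
    and G: "christoffel c (fst z) G" and v: "v \<in> tangent_space A (fst z)" and \<beta>: "\<beta> \<in> cotangent_space A (fst z)"
  shows "splitting A D z (v, \<beta>) = coord_vec (cot_atlas A) (cot_chart A c) z
    (v c, hor G (cov_comp c (fst z) (snd z)) (v c) + cov_comp c (fst z) \<beta>)"
  using cot.coord_vec_add[OF cot_charts_atI[OF c z], of "(v c, hor G (cov_comp c (fst z) (snd z)) (v c))"
      "(0, cov_comp c (fst z) \<beta>)"]
  by (simp add: splitting_def hlift_chart[OF c z G v] vlift_chart[OF c z \<beta>])

text \<open>The base component is the tangent part; subtracting the fibre component of its
  horizontal lift leaves the vertical part.\<close>

lemma splitting_inv_chart:
  assumes c: "c \<in> charts_at A (fst z)" and z: "snd z \<in> cotangent_space A (fst z)"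
    and G: "christoffel c (fst z) G" and w: "w \<in> tangent_space (cot_atlas A) z"
  shows "the_inv_into (tangent_space A (fst z) \<times> cotangent_space A (fst z)) (splitting A D z) w =
    (coord_vec A c (fst z) (fst (w (cot_chart A c))), cov_of c (fst z)
      (snd (w (cot_chart A c)) - hor G (cov_comp c (fst z) (snd z)) (fst (w (cot_chart A c)))))"
proof (rule the_inv_into_f_eq)
  note e = cot_charts_atI[OF c z]
  show "inj_on (splitting A D z) (tangent_space A (fst z) \<times> cotangent_space A (fst z))"
  proof (rule inj_onI, clarify)
    fix v \<beta> v' \<beta>' assume v: "v \<in> tangent_space A (fst z)" "v' \<in> tangent_space A (fst z)"
      and \<beta>: "\<beta> \<in> cotangent_space A (fst z)" "\<beta>' \<in> cotangent_space A (fst z)"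
      and "splitting A D z (v, \<beta>) = splitting A D z (v', \<beta>')"
    then have "coord_vec (cot_atlas A) (cot_chart A c) z
        (v c, hor G (cov_comp c (fst z) (snd z)) (v c) + cov_comp c (fst z) \<beta>) (cot_chart A c)
      = coord_vec (cot_atlas A) (cot_chart A c) z
        (v' c, hor G (cov_comp c (fst z) (snd z)) (v' c) + cov_comp c (fst z) \<beta>') (cot_chart A c)"
      by (simp add: splitting_chart[OF c z G])
    then have "v c = v' c" "cov_comp c (fst z) \<beta> = cov_comp c (fst z) \<beta>'"
      by (auto simp: cot.coord_vec_self[OF e])
    then show "v = v' \<and> \<beta> = \<beta>'"
      using tangent_eqI[OF c v] cov_of_comp[OF c] \<beta> by metis
  qed
qed (simp_all add: splitting_chart[OF c z G] coord_vec_in[OF c] cov_of_in coord_vec_self[OF c]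
    cov_comp_of[OF c] cot.coord_vec_eq[OF cot_charts_atI[OF c z] w])

end

section \<open>The almost complex structure in charts\<close>

locale nondegenerate_form = connected_manifold T A D
  for T :: "'a topology" and A :: "('a, 'e::euclidean_space) chart set" and D :: "('a, 'e) conn" +
  fixes \<omega> :: "'a \<Rightarrow> ('a, 'e) tvec \<Rightarrow> ('a, 'e) tvec \<Rightarrow> real"
  assumes two_form: "\<omega> \<in> two_forms A" and nondegenerate: "nondegenerate A \<omega>"
begin

text \<open>The matrix of the map sending a vector to its contraction with \<omega>, once covectors
  are identified with vectors by the inner product.\<close>

definition form_comp :: "('a, 'e) chart \<Rightarrow> 'a \<Rightarrow> 'e \<Rightarrow> 'e" where
  "form_comp c p u = (\<Sum>b\<in>Basis. \<omega> p (coord_vec A c p u) (coord_vec A c p b) *\<^sub>R b)"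

lemma form_props:
  assumes "p \<in> points A" "v \<in> tangent_space A p" "w \<in> tangent_space A p"
  shows form_skew: "\<omega> p v w = - \<omega> p w v"
    and form_add: "u \<in> tangent_space A p \<Longrightarrow> \<omega> p (u +\<^sub>v v) w = \<omega> p u w + \<omega> p v w"
    and form_scale: "\<omega> p (a *\<^sub>v v) w = a * \<omega> p v w"
  using two_form assms unfolding two_forms_def by blast+

lemma form_in_cotangent:
  assumes "p \<in> points A" "v \<in> tangent_space A p"
  shows "flat_map A \<omega> p v \<in> cotangent_space A p"
  unfolding cotangent_space_def flat_map_def
proof (intro CollectI conjI ballI allI impI)
  fix w w' assume w: "w \<in> tangent_space A p" "w' \<in> tangent_space A p"
  have "\<omega> p v (w +\<^sub>v w') = \<omega> p v w + \<omega> p v w'"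
    using form_add[OF assms(1) w(2) assms(2) w(1)] form_skew[OF assms(1,2)] w by (simp add: vadd_in)
  then show "(if w +\<^sub>v w' \<in> tangent_space A p then \<omega> p v (w +\<^sub>v w') else 0) =
      (if w \<in> tangent_space A p then \<omega> p v w else 0) + (if w' \<in> tangent_space A p then \<omega> p v w' else 0)"
    using w by (simp add: vadd_in)
next
  fix a w assume w: "w \<in> tangent_space A p"
  have "\<omega> p v (a *\<^sub>v w) = a * \<omega> p v w"
    using form_scale[OF assms(1) w assms(2)] form_skew[OF assms(1,2)] w by (simp add: vscale_in)
  then show "(if a *\<^sub>v w \<in> tangent_space A p then \<omega> p v (a *\<^sub>v w) else 0) =
      a * (if w \<in> tangent_space A p then \<omega> p v w else 0)"
    using w by (simp add: vscale_in)
qed simp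

lemma flat_map_comp:
  assumes c: "c \<in> charts_at A p" and v: "v \<in> tangent_space A p"
  shows "cov_comp c p (flat_map A \<omega> p v) = form_comp c p (v c)"
  by (simp add: cov_comp_def flat_map_def coord_vec_in[OF c] form_comp_def coord_vec_eq[OF c v])

lemma form_comp_inner:
  assumes c: "c \<in> charts_at A p" and v: "v \<in> tangent_space A p" "w \<in> tangent_space A p"
  shows "\<omega> p v w = form_comp c p (v c) \<bullet> w c"
  using cov_comp_apply[OF c form_in_cotangent[OF points_charts[OF c] v(1)] v(2)] v
  unfolding flat_map_comp[OF c v(1)] by (simp add: flat_map_def)

lemma linear_form_comp:
  assumes c: "c \<in> charts_at A p"
  shows "linear (form_comp c p)"
  using form_add[OF points_charts[OF c]] form_scale[OF points_charts[OF c]]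
  by (intro linearI) (simp_all add: form_comp_def coord_vec_add[OF c] coord_vec_scale[OF c] coord_vec_in[OF c]
      algebra_simps sum.distrib scaleR_sum_right)

lemma inj_form_comp:
  assumes c: "c \<in> charts_at A p"
  shows "inj (form_comp c p)"
  unfolding linear_injective_0[OF linear_form_comp[OF c]]
proof (intro allI impI)
  fix u assume u: "form_comp c p u = 0"
  have "\<forall>w\<in>tangent_space A p. \<omega> p (coord_vec A c p u) w = 0"
    using form_comp_inner[OF c coord_vec_in[OF c]] u by (simp add: coord_vec_self[OF c])
  then have "coord_vec A c p u = 0\<^sub>v"
    using nondegenerate points_charts[OF c] coord_vec_in[OF c] unfolding nondegenerate_def by blast
  then show "u = 0" using coord_vec_self[OF c, of u] by (simp add: vzero_def)
qed

text \<open>An injective linear endomorphism of the finite-dimensional model space is onto.\<close>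

lemma form_comp_inv:
  assumes c: "c \<in> charts_at A p"
  shows "form_comp c p (inv (form_comp c p) \<eta>) = \<eta>"
  using linear_injective_imp_surjective[OF linear_form_comp[OF c] inj_form_comp[OF c]]
  by (simp add: surj_f_inv_f)

lemma flat_map_inv:
  assumes c: "c \<in> charts_at A p" and \<beta>: "\<beta> \<in> cotangent_space A p"
  shows "the_inv_into (tangent_space A p) (flat_map A \<omega> p) \<beta>
    = coord_vec A c p (inv (form_comp c p) (cov_comp c p \<beta>))"
proof (rule the_inv_into_f_eq)
  show "inj_on (flat_map A \<omega> p) (tangent_space A p)"
  proof (rule inj_onI)
    fix v w assume v: "v \<in> tangent_space A p" "w \<in> tangent_space A p" and "flat_map A \<omega> p v = flat_map A \<omega> p w"
    then have "form_comp c p (v c) = form_comp c p (w c)" using flat_map_comp[OF c] by metis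
    then show "v = w" using injD[OF inj_form_comp[OF c]] tangent_eqI[OF c v] by blast
  qed
  let ?v = "coord_vec A c p (inv (form_comp c p) (cov_comp c p \<beta>))"
  have "cov_comp c p (flat_map A \<omega> p ?v) = cov_comp c p \<beta>"
    by (simp add: flat_map_comp[OF c coord_vec_in[OF c]] coord_vec_self[OF c] form_comp_inv[OF c])
  then show "flat_map A \<omega> p ?v = \<beta>"
    using cov_of_comp[OF c \<beta>] cov_of_comp[OF c form_in_cotangent[OF points_charts[OF c] coord_vec_in[OF c]]]
    by metis
qed (rule coord_vec_in[OF c])

text \<open>\<open>snd w - hor G \<xi> (fst w)\<close> is the vertical part of \<open>w\<close> and
  \<open>a\<close> its image under the inverse of \<omega>. The result is the horizontal lift of
  \<open>a\<close> minus the vertical vector given by the contraction of \<open>fst w\<close> with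
  \<omega>.\<close>

definition J_comp :: "('a, 'e) chart \<Rightarrow> 'a \<Rightarrow> ('e \<Rightarrow> 'e \<Rightarrow> 'e) \<Rightarrow> 'e \<Rightarrow> 'e \<times> 'e \<Rightarrow> 'e \<times> 'e" where
  "J_comp c p G \<xi> w = (let a = inv (form_comp c p) (snd w - hor G \<xi> (fst w))
     in (a, hor G \<xi> a - form_comp c p (fst w)))"

lemma cot_structure_chart:
  assumes c: "c \<in> charts_at A (fst z)" and z: "snd z \<in> cotangent_space A (fst z)"
    and G: "christoffel c (fst z) G" and w: "w \<in> tangent_space (cot_atlas A) z"
  shows "cot_structure A D (J_form A \<omega>) z w = coord_vec (cot_atlas A) (cot_chart A c) z
    (J_comp c (fst z) G (cov_comp c (fst z) (snd z)) (w (cot_chart A c)))"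
  unfolding cot_structure_def splitting_inv_chart[OF c z G w] J_form_def prod.case
    flat_map_inv[OF c cov_of_in] cov_comp_of[OF c]
  using form_in_cotangent[OF points_charts[OF c] coord_vec_in[OF c]]
  by (subst splitting_chart[OF c z G coord_vec_in[OF c]])
    (simp_all add: cotangent_scale J_comp_def Let_def coord_vec_self[OF c] cov_comp_scale
      flat_map_comp[OF c coord_vec_in[OF c]])

end

section \<open>The Nijenhuis tensor in coordinates\<close>

text \<open>The data of a chart detached from the manifold: \<open>W\<close> stands for the matrix
  of \<omega> and \<open>G\<close> for the Christoffel symbols. The Nijenhuis tensor becomes a
  matter of calculus on the product of an open set with the fibre.\<close>

locale chart_data =
  fixes N :: "'e::euclidean_space set" and W :: "'e \<Rightarrow> 'e \<Rightarrow> 'e" and G :: "'e \<Rightarrow> 'e \<Rightarrow> 'e \<Rightarrow> 'e"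
  assumes open_N: "open N"
    and linear_W: "x \<in> N \<Longrightarrow> linear (W x)" and inj_W: "x \<in> N \<Longrightarrow> inj (W x)"
    and smooth_W: "smooth_on N (\<lambda>x. W x u)"
    and linear_G1: "linear (\<lambda>u. G x u v)" and linear_G2: "linear (G x u)"
    and smooth_G: "smooth_on N (\<lambda>x. G x u v)"
begin

abbreviation "NN \<equiv> N \<times> (UNIV :: 'e set)"

lemma open_NN: "open NN" using open_N by (simp add: open_Times)

lemma W_inv: "x \<in> N \<Longrightarrow> W x (inv (W x) \<eta>) = \<eta>"
  using linear_injective_imp_surjective[OF linear_W inj_W] by (simp add: surj_f_inv_f)

lemma inv_W: "x \<in> N \<Longrightarrow> inv (W x) (W x u) = u"
  by (simp add: inj_W)

lemma linear_inv_W: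
  assumes "x \<in> N"
  shows "linear (inv (W x))"
proof (rule linearI)
  show "inv (W x) (a + b) = inv (W x) a + inv (W x) b" for a b
    using inv_W[OF assms, of "inv (W x) a + inv (W x) b"] W_inv[OF assms]
    by (simp add: linear_add[OF linear_W[OF assms]])
  show "inv (W x) (r *\<^sub>R b) = r *\<^sub>R inv (W x) b" for r b
    using inv_W[OF assms, of "r *\<^sub>R inv (W x) b"] W_inv[OF assms]
    by (simp add: linear_cmul[OF linear_W[OF assms]])
qed

definition h :: "'e \<times> 'e \<Rightarrow> 'e \<Rightarrow> 'e" where "h y = hor (G (fst y)) (snd y)"

definition H :: "'e \<times> 'e \<Rightarrow> 'e \<Rightarrow> 'e \<times> 'e" where "H y u = (u, h y u)"

definition J :: "'e \<times> 'e \<Rightarrow> 'e \<times> 'e \<Rightarrow> 'e \<times> 'e" where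
  "J y w = (let a = inv (W (fst y)) (snd w - h y (fst w)) in (a, h y a - W (fst y) (fst w)))"

lemma linear_h: "linear (h y)"
  unfolding h_def by (rule linear_hor[OF linear_G1])

lemma h_inner: "h y u \<bullet> v = snd y \<bullet> G (fst y) u v"
  unfolding h_def by (rule hor_inner[OF linear_G2])

lemma J_vertical: "y \<in> NN \<Longrightarrow> J y (0, \<eta>) = H y (inv (W (fst y)) \<eta>)"
  by (auto simp: J_def H_def Let_def linear_0[OF linear_h] linear_0[OF linear_W])

lemma J_H: "y \<in> NN \<Longrightarrow> J y (H y u) = (0, - W (fst y) u)"
  by (auto simp: J_def H_def linear_0[OF linear_h] linear_0[OF linear_inv_W])

lemma J_J: "y \<in> NN \<Longrightarrow> J y (J y w) = - w"
  by (cases w)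
    (auto simp: J_def Let_def inv_W W_inv linear_neg[OF linear_inv_W] linear_neg[OF linear_h])

lemma linear_J: "y \<in> NN \<Longrightarrow> linear (J y)"
  by (rule linearI) (auto simp: J_def Let_def linear_add[OF linear_h] linear_add[OF linear_inv_W]
      linear_add[OF linear_W] linear_cmul[OF linear_h] linear_cmul[OF linear_inv_W] linear_diff[OF linear_inv_W]
      linear_diff[OF linear_h] linear_cmul[OF linear_W] algebra_simps)

text \<open>\<open>J y (H y v)\<close> is the vertical vector \<open>(0, - W (fst y) v)\<close>, so
  the vertical part of \<open>w\<close> is reached by inverting \<open>W\<close>, with a minus sign
  to compensate.\<close>

lemma decompose:
  assumes y: "y \<in> NN"
  shows "w = H y (fst w) + J y (H y (- inv (W (fst y)) (snd w - h y (fst w))))"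
proof -
  have x: "fst y \<in> N" using y by auto
  show ?thesis
    by (simp add: J_H[OF y] linear_neg[OF linear_W[OF x]] W_inv[OF x] H_def[of y "fst w"] prod_eq_iff)
qed

lemma smooth_fst_snd: "smooth_on NN fst" "smooth_on NN snd"
  using smooth_on_bounded_linear[OF open_NN bounded_linear_fst smooth_on_ident[OF open_NN]]
    smooth_on_bounded_linear[OF open_NN bounded_linear_snd smooth_on_ident[OF open_NN]] by simp_all

lemma smooth_fst_compose:
  fixes f :: "'e \<Rightarrow> 'w::real_normed_vector"
  shows "smooth_on N f \<Longrightarrow> smooth_on NN (\<lambda>y. f (fst y))"
  by (rule smooth_on_compose[OF open_NN smooth_fst_snd(1)]) auto

lemma FD_fst_compose:
  fixes f :: "'e \<Rightarrow> 'w::real_normed_vector"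
  assumes "smooth_on N f" "y \<in> NN"
  shows "FD (\<lambda>y. f (fst y)) y d = FD f (fst y) (fst d)"
proof -
  have "f differentiable at (fst y)" using assms by (auto intro: smooth_on_differentiable)
  from FD_eq[OF has_derivative_compose[OF bounded_linear_imp_has_derivative[OF bounded_linear_fst] FD_works[OF this]]]
  show ?thesis by simp
qed

lemma smooth_h: "smooth_on NN (\<lambda>y. h y u)"
  unfolding h_def hor_def
  by (intro smooth_on_sum open_NN smooth_on_bounded_linear[OF _ bounded_linear_scaleR_left]
      smooth_on_inner smooth_fst_snd smooth_fst_compose[where f = "\<lambda>x. G x u _"] smooth_G)

text \<open>The inverse function theorem, applied to the map \<open>?F\<close> of the total space
  that acts by \<open>W\<close> on each fibre, gives differentiability of the inverse matrices
  jointly in the base point and the argument, without determinants.\<close>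

lemma differentiable_inv_W:
  assumes y: "y \<in> NN" and g: "g differentiable at y"
  shows "(\<lambda>y. inv (W (fst y)) (g y)) differentiable at y"
proof -
  let ?F = "\<lambda>z. (fst z, W (fst z) (snd z))" and ?K = "\<lambda>z. (fst z, inv (W (fst z)) (snd z))"
  define x where "x = fst y"
  define a where "a = inv (W x) (g y)"
  have x: "x \<in> N" using y by (auto simp: x_def)
  have "smooth_on NN (\<lambda>z. W (fst z) (snd z))"
    using linear_W
    by (intro smooth_on_linear_field[OF open_NN _ smooth_fst_compose[OF smooth_W] smooth_fst_snd(2)]) auto
  then have cont: "continuous_on NN ?F"
    by (intro smooth_on_continuous smooth_on_Pair open_NN smooth_fst_snd)
  have "((\<lambda>z. W (fst z) (snd z)) has_derivative
     (\<lambda>d. FD (\<lambda>z. W (fst z) (snd (x, a))) (x, a) d + W (fst (x, a)) (FD snd (x, a) d))) (at (x, a))"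
    using x linear_W smooth_on_differentiable[OF smooth_fst_compose[OF smooth_W], of "(x, a)"]
      smooth_on_differentiable[OF smooth_fst_snd(2), of "(x, a)"]
    by (intro has_derivative_linear_field[OF open_NN, where g = snd]) auto
  moreover have "FD snd (x, a) = snd"
    by (rule FD_eq) (rule bounded_linear_imp_has_derivative[OF bounded_linear_snd])
  moreover have "FD (\<lambda>z. W (fst z) a) (x, a) d = FD (\<lambda>x. W x a) x (fst d)" for d
    using FD_fst_compose[OF smooth_W, of "(x, a)"] x by simp
  ultimately have "((\<lambda>z. W (fst z) (snd z)) has_derivative
      (\<lambda>d. FD (\<lambda>x. W x a) x (fst d) + W x (snd d))) (at (x, a))" by simp
  then have d: "(?F has_derivative (\<lambda>d. (fst d, FD (\<lambda>x. W x a) x (fst d) + W x (snd d)))) (at (x, a))"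
    by (intro has_derivative_Pair bounded_linear_imp_has_derivative[OF bounded_linear_fst])
  \<comment> \<open>The derivative of \<open>?F\<close> is block triangular with the identity and
    \<open>W x\<close> on the diagonal; this is its inverse.\<close>
  have "(?K has_derivative (\<lambda>d. (fst d, inv (W x) (snd d - FD (\<lambda>x. W x a) x (fst d))))) (at (?F (x, a)))"
    by (rule has_derivative_inverse_strong[OF open_NN _ cont _ d])
      (use x in \<open>auto simp: inv_W W_inv fun_eq_iff\<close>)
  then have "(?K has_derivative (\<lambda>d. (fst d, inv (W x) (snd d - FD (\<lambda>x. W x a) x (fst d))))) (at (x, g y))"
    by (simp add: a_def W_inv[OF x])
  then have K: "?K differentiable at (fst y, g y)" unfolding differentiable_def x_def by blast
  have "(\<lambda>y. (fst y, g y)) differentiable at y"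
    using has_derivative_Pair[OF bounded_linear_imp_has_derivative[OF bounded_linear_fst] FD_works[OF g]]
    unfolding differentiable_def by blast
  with K have "(\<lambda>y. ?K (fst y, g y)) differentiable at y"
    by (rule differentiable_compose)
  from differentiable_bounded_linear[OF bounded_linear_snd this] show ?thesis by simp
qed

section \<open>The derivative of \<open>J\<close> and the Nijenhuis tensor as an algebraic
  expression in it\<close>

lemma differentiable_J:
  assumes y: "y \<in> NN"
  shows "(\<lambda>y. J y w) differentiable at y"
proof -
  have h: "(\<lambda>y. h y u) differentiable at y" for u
    by (rule smooth_on_differentiable[OF smooth_h y])
  have a: "(\<lambda>y. inv (W (fst y)) (snd w - h y (fst w))) differentiable at y"
    by (intro differentiable_inv_W[OF y] differentiable_diff h) simp
  have "(\<lambda>y. h y (inv (W (fst y)) (snd w - h y (fst w)))) differentiable at y"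
    using has_derivative_linear_field[OF open_NN y linear_h h a] unfolding differentiable_def by blast
  moreover have "(\<lambda>y. W (fst y) (fst w)) differentiable at y"
    by (rule smooth_on_differentiable[OF smooth_fst_compose[OF smooth_W] y])
  ultimately have "(\<lambda>y. h y (inv (W (fst y)) (snd w - h y (fst w))) - W (fst y) (fst w)) differentiable at y"
    by (rule differentiable_diff)
  from has_derivative_Pair[OF FD_works[OF a] FD_works[OF this]] show ?thesis
    unfolding J_def Let_def differentiable_def by blast
qed

definition dJ :: "'e \<times> 'e \<Rightarrow> 'e \<times> 'e \<Rightarrow> 'e \<times> 'e \<Rightarrow> 'e \<times> 'e" where
  "dJ y d w = FD (\<lambda>y. J y w) y d"

lemma has_derivative_J:
  assumes y: "y \<in> NN" and X: "X differentiable at y"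
  shows "((\<lambda>y. J y (X y)) has_derivative (\<lambda>d. dJ y d (X y) + J y (FD X y d))) (at y)"
  unfolding dJ_def by (rule has_derivative_linear_field[OF open_NN y linear_J differentiable_J[OF y] X])

lemma linear_dJ1: "y \<in> NN \<Longrightarrow> linear (\<lambda>d. dJ y d w)"
  unfolding dJ_def by (rule bounded_linear.linear[OF FD_bounded_linear[OF differentiable_J]])

lemma linear_dJ2:
  assumes y: "y \<in> NN"
  shows "linear (dJ y d)"
proof (rule linearI)
  fix w w'
  have "FD (\<lambda>y. J y (w + w')) y d = FD (\<lambda>y. J y w + J y w') y d"
    by (rule fun_cong[OF FD_cong_open[OF open_NN y]]) (rule linear_add[OF linear_J])
  then show "dJ y d (w + w') = dJ y d w + dJ y d w'"
    by (simp add: dJ_def FD_add differentiable_J[OF y])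
next
  fix r w
  have "FD (\<lambda>y. J y (r *\<^sub>R w)) y d = FD (\<lambda>y. r *\<^sub>R J y w) y d"
    by (rule fun_cong[OF FD_cong_open[OF open_NN y]]) (rule linear_cmul[OF linear_J])
  then show "dJ y d (r *\<^sub>R w) = r *\<^sub>R dJ y d w"
    by (simp add: dJ_def FD_bounded_linear_compose[OF bounded_linear_scaleR_right] differentiable_J[OF y])
qed

text \<open>This is the identity \<open>J y (J y w) = - w\<close> differentiated in
  \<open>y\<close>.\<close>

lemma dJ_J:
  assumes y: "y \<in> NN"
  shows "dJ y d (J y w) = - J y (dJ y d w)"
proof -
  have "FD (\<lambda>y. J y (J y w)) y d = FD (\<lambda>y. - w) y d"
    by (rule fun_cong[OF FD_cong_open[OF open_NN y]]) (rule J_J)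
  then have "dJ y d (J y w) + J y (dJ y d w) = 0"
    using FD_eq[OF has_derivative_J[OF y differentiable_J[OF y, of w]]] by (simp add: dJ_def)
  then show ?thesis by (simp add: eq_neg_iff_add_eq_0)
qed

text \<open>What remains of the Nijenhuis tensor once its brackets are expanded: as \<open>J\<close>
  squares to minus the identity, the derivatives of the two fields cancel, and their values together
  with the derivative of \<open>J\<close> are left.\<close>

definition nij :: "'e \<times> 'e \<Rightarrow> 'e \<times> 'e \<Rightarrow> 'e \<times> 'e \<Rightarrow> 'e \<times> 'e" where
  "nij y X Y = dJ y (J y X) Y - dJ y (J y Y) X - J y (dJ y X Y) + J y (dJ y Y X)"

lemma nij_skew: "y \<in> NN \<Longrightarrow> nij y X Y = - nij y Y X"
  by (simp add: nij_def)

lemma nij_add: "y \<in> NN \<Longrightarrow> nij y (X + X') Y = nij y X Y + nij y X' Y"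
  by (simp add: nij_def linear_add[OF linear_J] linear_add[OF linear_dJ1] linear_add[OF linear_dJ2])

lemma nij_J: "y \<in> NN \<Longrightarrow> nij y (J y X) Y = - J y (nij y X Y)"
  by (simp add: nij_def J_J dJ_J linear_neg[OF linear_dJ1] linear_add[OF linear_J] linear_diff[OF linear_J]
      linear_neg[OF linear_J])

lemma nij_zeroI:
  assumes y: "y \<in> NN" and "\<And>u v. nij y (H y u) (H y v) = 0"
  shows "nij y X Y = 0"
proof -
  have 1: "nij y X (H y v) = 0" for X v
    by (subst decompose[OF y, of X])
      (simp add: nij_add[OF y] nij_J[OF y] assms(2) linear_0[OF linear_J[OF y]])
  have 2: "nij y (H y v) X = 0" for X v
    using 1[of X v] nij_skew[OF y, of "H y v" X] by simp
  show ?thesis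
    by (subst decompose[OF y, of X])
      (simp add: nij_add[OF y] nij_J[OF y] 2 linear_0[OF linear_J[OF y]])
qed

section \<open>First derivatives of the coordinate data and the tensor on horizontal vectors\<close>

definition dW :: "'e \<Rightarrow> 'e \<Rightarrow> 'e \<Rightarrow> 'e" where "dW x d u = FD (\<lambda>x. W x u) x d"
definition dG :: "'e \<Rightarrow> 'e \<Rightarrow> 'e \<Rightarrow> 'e \<Rightarrow> 'e" where "dG x d u v = FD (\<lambda>x. G x u v) x d"
definition dh :: "'e \<times> 'e \<Rightarrow> 'e \<times> 'e \<Rightarrow> 'e \<Rightarrow> 'e" where "dh y d u = FD (\<lambda>y. h y u) y d"

text \<open>\<open>h\<close> is linear in the fibre variable: the fibre increment enters through
  \<open>G\<close> itself, the base increment through its derivative.\<close>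

lemma dh_inner:
  assumes y: "y \<in> NN"
  shows "dh y d u \<bullet> v = snd d \<bullet> G (fst y) u v + snd y \<bullet> dG (fst y) (fst d) u v"
proof -
  have "dh y d u \<bullet> v = FD (\<lambda>y. h y u \<bullet> v) y d"
    unfolding dh_def
    by (rule FD_bounded_linear_compose[OF bounded_linear_inner_left smooth_on_differentiable[OF smooth_h y], symmetric])
  also have "\<dots> = FD (\<lambda>y. snd y \<bullet> G (fst y) u v) y d" by (simp add: h_inner)
  also have "\<dots> = snd y \<bullet> FD (\<lambda>y. G (fst y) u v) y d + FD snd y d \<bullet> G (fst y) u v"
    by (rule FD_bilinear[OF bounded_bilinear_inner smooth_on_differentiable[OF smooth_fst_snd(2) y]
          smooth_on_differentiable[OF smooth_fst_compose[OF smooth_G] y]])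
  also have "FD snd y = snd"
    by (rule FD_eq[OF bounded_linear_imp_has_derivative[OF bounded_linear_snd]])
  finally show ?thesis
    by (simp add: FD_fst_compose[OF smooth_G y] dG_def)
qed

text \<open>Differentiating the identity \<open>J (H u) = (0, - W u)\<close> avoids the derivative of the inverse of \<open>W\<close>.\<close>

lemma dJ_H:
  assumes y: "y \<in> NN"
  shows "dJ y d (H y u) = (0, - dW (fst y) (fst d) u) - J y (0, dh y d u)"
proof -
  have dH: "((\<lambda>y. H y u) has_derivative (\<lambda>d. (0, dh y d u))) (at y)"
    unfolding H_def dh_def
    by (intro has_derivative_Pair has_derivative_const FD_works smooth_on_differentiable[OF smooth_h y])
  have "FD (\<lambda>y. J y (H y u)) y d = dJ y d (H y u) + J y (0, dh y d u)"
    using FD_eq[OF has_derivative_J[OF y differentiableI[OF dH]]] by (simp add: FD_eq[OF dH])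
  moreover have "FD (\<lambda>y. J y (H y u)) y d = FD (\<lambda>y. (0::'e, - W (fst y) u)) y d"
    by (rule fun_cong[OF FD_cong_open[OF open_NN y]]) (rule J_H)
  moreover have "((\<lambda>y. (0::'e, - W (fst y) u)) has_derivative
      (\<lambda>d. (0, - FD (\<lambda>y. W (fst y) u) y d))) (at y)"
    by (intro has_derivative_Pair has_derivative_const has_derivative_minus FD_works
        smooth_on_differentiable[OF smooth_fst_compose[OF smooth_W] y])
  ultimately show ?thesis
    by (simp add: FD_eq FD_fst_compose[OF smooth_W y] dW_def)
qed

text \<open>The curvature on constant coordinate fields, whose bracket vanishes.\<close>

definition curv :: "'e \<Rightarrow> 'e \<Rightarrow> 'e \<Rightarrow> 'e \<Rightarrow> 'e" where
  "curv x u v w = dG x u v w - dG x v u w + G x u (G x v w) - G x v (G x u w)"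

text \<open>For constant coordinate fields, the covariant derivative along \<open>u\<close> of the
  contraction of \<open>v\<close> with \<omega>, minus the same with \<open>u\<close> and
  \<open>v\<close> exchanged, evaluated on \<open>w\<close>. In \<open>dW x u v\<close> the
  direction of differentiation is \<open>u\<close>.\<close>

definition defect :: "'e \<Rightarrow> 'e \<Rightarrow> 'e \<Rightarrow> 'e \<Rightarrow> real" where
  "defect x u v w = (dW x u v - dW x v u) \<bullet> w + W x u \<bullet> G x v w - W x v \<bullet> G x u w"

text \<open>As \<open>J y (H y u)\<close> is vertical, \<open>dJ\<close> along it sees only how
  \<open>h\<close> depends on the fibre variable and contributes the \<open>hor\<close> terms. Along
  \<open>H y u\<close> it contributes the derivative of \<open>W\<close> and a term
  \<open>J y (0, dh y d v)\<close> with \<open>d = H y u\<close>, on which the outer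
  \<open>J\<close> acts as a second application and leaves a vertical vector.\<close>

lemma nij_H:
  assumes y: "y \<in> NN"
  shows "nij y (H y u) (H y v) =
    J y (0, hor (G (fst y)) (W (fst y) u) v - hor (G (fst y)) (W (fst y) v) u + dW (fst y) u v - dW (fst y) v u)
    - (0, dh y (H y u) v - dh y (H y v) u)"
proof -
  let ?x = "fst y"
  have dW0: "dW ?x 0 v = 0" for v
    using y unfolding dW_def
    by (auto intro!: linear_0[OF bounded_linear.linear[OF FD_bounded_linear[OF smooth_on_differentiable[OF smooth_W]]]])
  have dG0: "dG ?x 0 v w = 0" for v w
    using y unfolding dG_def
    by (auto intro!: linear_0[OF bounded_linear.linear[OF FD_bounded_linear[OF smooth_on_differentiable[OF smooth_G]]]])
  \<comment> \<open>Along a vertical direction the base point is fixed, so the derivative of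
    \<open>G\<close> contributes nothing.\<close>
  have "dh y (0, - W ?x u) v = - hor (G ?x) (W ?x u) v" for u v
    by (rule euclidean_eqI) (simp add: dh_inner[OF y] dG0 hor_inner[of "G ?x", OF linear_G2])
  then have 1: "dJ y (J y (H y u)) (H y v) = J y (0, hor (G ?x) (W ?x u) v)" for u v
    using linear_neg[OF linear_J[OF y], of "(0, hor (G ?x) (W ?x u) v)"]
    by (simp add: dJ_H[OF y] J_H[OF y] dW0 zero_prod_def[symmetric])
  have 2: "J y (dJ y (H y u) (H y v)) = - J y (0, dW ?x u v) + (0, dh y (H y u) v)" for u v
    using linear_neg[OF linear_J[OF y], of "(0, dW ?x u v)"]
    by (simp add: dJ_H[OF y] linear_diff[OF linear_J[OF y]] J_J[OF y]) (simp add: H_def)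
  have 3: "J y (0, a - b + c - d) = J y (0, a) - J y (0, b) + J y (0, c) - J y (0, d)" for a b c d :: 'e
    by (simp add: linear_add[OF linear_J[OF y], symmetric] linear_diff[OF linear_J[OF y], symmetric])
  show ?thesis unfolding nij_def 1 2 3 by (simp add: algebra_simps)
qed

text \<open>\<open>J y (0, a)\<close> is horizontal and \<open>(0, b)\<close> vertical, so they
  vanish separately. The curvature arises in \<open>b\<close> because differentiating
  \<open>h\<close> along \<open>H y u\<close> combines the base derivative of \<open>G\<close> with
  a product of two Christoffel terms, the fibre component of \<open>H y u\<close> being
  \<open>h y u\<close>.\<close>

lemma nij_H_zero_iff:
  assumes y: "y \<in> NN"
  shows "nij y (H y u) (H y v) = 0 \<longleftrightarrow>
    (\<forall>w. defect (fst y) u v w = 0) \<and> (\<forall>w. snd y \<bullet> curv (fst y) u v w = 0)"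
proof -
  let ?x = "fst y"
  define a where "a = hor (G ?x) (W ?x u) v - hor (G ?x) (W ?x v) u + dW ?x u v - dW ?x v u"
  define b where "b = dh y (H y u) v - dh y (H y v) u"
  have x: "?x \<in> N" using y by auto
  have a: "a \<bullet> w = defect ?x u v w" for w
    by (simp add: a_def defect_def inner_diff_left inner_add_left hor_inner[of "G ?x", OF linear_G2])
  have b: "b \<bullet> w = snd y \<bullet> curv ?x u v w" for w
    by (simp add: b_def curv_def inner_diff_left inner_add_right inner_diff_right dh_inner[OF y] H_def h_inner)
  have "nij y (H y u) (H y v) = J y (0, a) - (0, b)" by (simp add: nij_H[OF y] a_def b_def)
  also have "\<dots> = 0 \<longleftrightarrow> a = 0 \<and> b = 0"
  proof
    assume 0: "J y (0, a) - (0, b) = 0"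
    then have "inv (W ?x) a = 0" by (simp add: J_vertical[OF y] H_def zero_prod_def)
    then have "a = 0" using W_inv[OF x, of a] linear_0[OF linear_W[OF x]] by simp
    with 0 show "a = 0 \<and> b = 0"
      using linear_0[OF linear_J[OF y]] by (simp add: zero_prod_def)
  next
    assume "a = 0 \<and> b = 0"
    then show "J y (0, a) - (0, b) = 0"
      using linear_0[OF linear_J[OF y]] by (simp add: zero_prod_def)
  qed
  also have "\<dots> \<longleftrightarrow> (\<forall>w. a \<bullet> w = 0) \<and> (\<forall>w. b \<bullet> w = 0)"
    by (metis inner_eq_zero_iff inner_zero_left)
  finally show ?thesis by (simp add: a b)
qed

section \<open>Product rules for the coordinate data along vector fields\<close>

lemma has_derivative_W_field:
  assumes x: "x \<in> N" and Y: "Y differentiable at x" and Z: "Z differentiable at x"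
  shows "((\<lambda>x. W x (Y x) \<bullet> Z x) has_derivative
    (\<lambda>d. (dW x d (Y x) + W x (FD Y x d)) \<bullet> Z x + W x (Y x) \<bullet> FD Z x d)) (at x)"
proof -
  have "((\<lambda>x. W x (Y x)) has_derivative (\<lambda>d. dW x d (Y x) + W x (FD Y x d))) (at x)"
    unfolding dW_def
    by (rule has_derivative_linear_field[OF open_N x linear_W smooth_on_differentiable[OF smooth_W x] Y])
  from has_derivative_inner[OF this FD_works[OF Z]] show ?thesis by (simp add: add.commute)
qed

text \<open>The last argument is absorbed first: for fixed \<open>v\<close> the map
  \<open>G x v (Z x)\<close> is differentiable, and as a matrix field in \<open>v\<close> it is then
  applied to \<open>Y x\<close>.\<close>

lemma has_derivative_G_field:
  assumes x: "x \<in> N" and Y: "Y differentiable at x" and Z: "Z differentiable at x"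
  shows "((\<lambda>x. G x (Y x) (Z x)) has_derivative
    (\<lambda>d. dG x d (Y x) (Z x) + G x (Y x) (FD Z x d) + G x (FD Y x d) (Z x))) (at x)"
proof -
  have 1: "((\<lambda>x. G x v (Z x)) has_derivative (\<lambda>d. dG x d v (Z x) + G x v (FD Z x d))) (at x)" for v
    unfolding dG_def
    by (rule has_derivative_linear_field[OF open_N x linear_G2 smooth_on_differentiable[OF smooth_G x] Z])
  have "((\<lambda>x. G x (Y x) (Z x)) has_derivative
      (\<lambda>d. FD (\<lambda>z. G z (Y x) (Z z)) x d + G x (FD Y x d) (Z x))) (at x)"
    using 1 by (intro has_derivative_linear_field[where L = "\<lambda>x v. G x v (Z x)", OF open_N x linear_G1 _ Y])
      (auto simp: differentiable_def)
  then show ?thesis by (simp add: FD_eq[OF 1])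
qed

end

section \<open>Passage from coordinates to the cotangent bundle\<close>

context nondegenerate_form
begin

abbreviation cot_J :: "('a, 'e) ctpoint \<Rightarrow> (('a, 'e) ctpoint, 'e \<times> 'e) tvec \<Rightarrow> (('a, 'e) ctpoint, 'e \<times> 'e) tvec"
  where "cot_J \<equiv> cot_structure A D (J_form A \<omega>)"

lemma christoffel_near:
  assumes c: "c \<in> charts_at A p"
  obtains \<Gamma> N where "open N" "snd c p \<in> N" "N \<subseteq> snd c ` fst c"
    "\<forall>x\<in>N. christoffel c (chart_inv c x) (\<Gamma> x)" "\<forall>u v. smooth_on N (\<lambda>x. \<Gamma> x u v)"
    "\<forall>x u. linear (\<Gamma> x u)" "\<forall>x v. linear (\<lambda>u. \<Gamma> x u v)"
proof (rule christoffel_exists[OF c])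
  fix \<Gamma> N
  assume N: "open N" "snd c p \<in> N" "N \<subseteq> snd c ` fst c"
    and \<Gamma>: "\<And>x v. linear (\<lambda>u. \<Gamma> x u v)" "\<And>x u. linear (\<Gamma> x u)" "\<And>u v. smooth_on N (\<lambda>x. \<Gamma> x u v)"
    "\<And>X Y x. X \<in> vector_fields A \<Longrightarrow> Y \<in> vector_fields A \<Longrightarrow> x \<in> N \<Longrightarrow>
      D X Y (chart_inv c x) c = FD (\<lambda>x. Y (chart_inv c x) c) x (X (chart_inv c x) c)
        + \<Gamma> x (X (chart_inv c x) c) (Y (chart_inv c x) c)"
  have "christoffel c (chart_inv c x) (\<Gamma> x)" if x: "x \<in> N" for x
  proof -
    have "snd c (chart_inv c x) = x" using x N(3) by (intro snd_chart_inv) auto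
    then show ?thesis unfolding christoffel_def using \<Gamma>(1,2) \<Gamma>(4)[OF _ _ x] by simp
  qed
  then show thesis using that[OF N] \<Gamma>(1-3) by blast
qed

lemma cot_pointsE:
  assumes "z \<in> points (cot_atlas A)"
  obtains c where "c \<in> charts_at A (fst z)" "snd z \<in> cotangent_space A (fst z)"
proof -
  obtain d where "d \<in> charts_at (cot_atlas A) z" using assms unfolding cot.points_iff by blast
  then show thesis by (rule cot_charts_atE) (rule that)
qed

lemma cot_J_in:
  assumes z: "z \<in> points (cot_atlas A)" and w: "w \<in> tangent_space (cot_atlas A) z"
  shows "cot_J z w \<in> tangent_space (cot_atlas A) z"
proof -
  obtain c where c: "c \<in> charts_at A (fst z)" "snd z \<in> cotangent_space A (fst z)"
    using z by (rule cot_pointsE)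
  obtain \<Gamma> :: "'e \<Rightarrow> 'e \<Rightarrow> 'e \<Rightarrow> 'e" and N where "snd c (fst z) \<in> N" "\<forall>x\<in>N. christoffel c (chart_inv c x) (\<Gamma> x)"
    by (rule christoffel_near[OF c(1)])
  then have "christoffel c (fst z) (\<Gamma> (snd c (fst z)))"
    using chart_inv_snd charts_atD[OF c(1)] by metis
  from cot_structure_chart[OF c this w] show ?thesis
    using cot.coord_vec_in[OF cot_charts_atI[OF c]] by simp
qed

lemma smooth_form_comp:
  assumes "c \<in> A"
  shows "smooth_on (snd c ` fst c) (\<lambda>x. form_comp c (chart_inv c x) u)"
  unfolding form_comp_def
proof (intro smooth_on_sum open_chart[OF assms] smooth_on_bounded_linear[OF _ bounded_linear_scaleR_left])
  have "\<forall>c\<in>A. \<forall>u u'. smooth_on (snd c ` fst c)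
      (\<lambda>x. \<omega> (chart_inv c x) (coord_vec A c (chart_inv c x) u) (coord_vec A c (chart_inv c x) u'))"
    using two_form unfolding two_forms_def by blast
  then show "smooth_on (snd c ` fst c)
      (\<lambda>x. \<omega> (chart_inv c x) (coord_vec A c (chart_inv c x) u) (coord_vec A c (chart_inv c x) b))" for b
    using assms by blast
qed

definition compat :: "('a, 'e) vfield \<Rightarrow> ('a, 'e) vfield \<Rightarrow> ('a, 'e) vfield \<Rightarrow> 'a \<Rightarrow> real" where
  "compat X Y Z p = ext_deriv2 A \<omega> X Y Z p - cov_deriv2 A D \<omega> Z X Y p
       - \<omega> p (torsion A D Z X p) (Y p) - \<omega> p (X p) (torsion A D Z Y p)"

end

text \<open>The Christoffel symbols come from a cut-off frame, so they are available on a
  neighbourhood \<open>N\<close> that may be smaller than the image of the chart. On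
  \<open>N\<close> the chart satisfies the assumptions of \<open>chart_data\<close>.\<close>

locale adapted_chart = nondegenerate_form T A D \<omega>
  for T :: "'a topology" and A :: "('a, 'e::euclidean_space) chart set" and D :: "('a, 'e) conn"
    and \<omega> :: "'a \<Rightarrow> ('a, 'e) tvec \<Rightarrow> ('a, 'e) tvec \<Rightarrow> real" +
  fixes c :: "('a, 'e) chart" and N :: "'e set" and \<Gamma> :: "'e \<Rightarrow> 'e \<Rightarrow> 'e \<Rightarrow> 'e"
  assumes c: "c \<in> A" and open_nbhd: "open N" and N: "N \<subseteq> snd c ` fst c"
    and \<Gamma>: "x \<in> N \<Longrightarrow> christoffel c (chart_inv c x) (\<Gamma> x)" "smooth_on N (\<lambda>x. \<Gamma> x u v)"
      "linear (\<Gamma> x u)" "linear (\<lambda>u. \<Gamma> x u v)"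
begin

lemma N_chart: "x \<in> N \<Longrightarrow> c \<in> charts_at A (chart_inv c x)" "x \<in> N \<Longrightarrow> snd c (chart_inv c x) = x"
  using N c by (auto intro: charts_at_chart_inv snd_chart_inv)

sublocale chart_data N "\<lambda>x. form_comp c (chart_inv c x)" \<Gamma>
proof (rule chart_data.intro)
  show "open N" by (rule open_nbhd)
  show "linear (form_comp c (chart_inv c x))" "inj (form_comp c (chart_inv c x))" if "x \<in> N" for x
    by (rule linear_form_comp[OF N_chart(1)[OF that]] inj_form_comp[OF N_chart(1)[OF that]])+
  show "smooth_on N (\<lambda>x. form_comp c (chart_inv c x) u)" for u
    by (rule smooth_on_subset[OF smooth_form_comp[OF c] N])
qed (rule \<Gamma>)+

abbreviation "e \<equiv> cot_chart A c"

lemma chart_inv_e: "y \<in> NN \<Longrightarrow> e \<in> charts_at (cot_atlas A) (chart_inv e y)"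
  "y \<in> NN \<Longrightarrow> snd e (chart_inv e y) = y" "y \<in> NN \<Longrightarrow> fst (chart_inv e y) = chart_inv c (fst y)"
proof -
  assume y: "y \<in> NN"
  then have x: "fst y \<in> N" "fst y \<in> snd c ` fst c" using N by auto
  have inv: "chart_inv e y = (chart_inv c (fst y), cov_of c (chart_inv c (fst y)) (snd y))"
    using cot_chart_inv[OF c x(2), of "snd y"] by simp
  show "e \<in> charts_at (cot_atlas A) (chart_inv e y)"
    unfolding inv by (rule cot_charts_atI) (simp_all add: N_chart x cov_of_in)
  show "snd e (chart_inv e y) = y"
    unfolding inv by (simp add: snd_cot_chart N_chart x cov_comp_of)
  show "fst (chart_inv e y) = chart_inv c (fst y)" unfolding inv by simp
qed

lemma e_charts_atD:
  assumes "e \<in> charts_at (cot_atlas A) z" "snd e z \<in> NN"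
  shows "c \<in> charts_at A (fst z)" "snd z \<in> cotangent_space A (fst z)"
    "christoffel c (fst z) (\<Gamma> (snd c (fst z)))"
proof -
  have z: "fst z \<in> fst c" "snd z \<in> cotangent_space A (fst z)"
    using assms(1) by (simp_all add: charts_at_def fst_cot_chart)
  show "c \<in> charts_at A (fst z)" "snd z \<in> cotangent_space A (fst z)" using z c by (simp_all add: charts_atI)
  show "christoffel c (fst z) (\<Gamma> (snd c (fst z)))"
    using \<Gamma>(1)[of "snd c (fst z)"] assms(2) z c by (simp add: snd_cot_chart chart_inv_snd)
qed

lemma cot_J_comp:
  assumes z: "e \<in> charts_at (cot_atlas A) z" "snd e z \<in> NN" and w: "w \<in> tangent_space (cot_atlas A) z"
  shows "cot_J z w e = J (snd e z) (w e)"
proof -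
  have "chart_inv c (snd c (fst z)) = fst z"
    using charts_atD[OF e_charts_atD(1)[OF z]] by (simp add: chart_inv_snd)
  then show ?thesis
    unfolding cot_structure_chart[OF e_charts_atD[OF z] w] cot.coord_vec_self[OF z(1)]
    by (simp add: J_comp_def J_def h_def snd_cot_chart)
qed

lemma has_derivative_cot_J:
  assumes z: "e \<in> charts_at (cot_atlas A) z" "snd e z \<in> NN" and X: "X \<in> vector_fields (cot_atlas A)"
  shows "((\<lambda>y. cot_J (chart_inv e y) (X (chart_inv e y)) e) has_derivative
    (\<lambda>d. dJ (snd e z) d (X z e) + J (snd e z) (FD (\<lambda>y. X (chart_inv e y) e) (snd e z) d))) (at (snd e z))"
proof -
  have z0: "chart_inv e (snd e z) = z" using cot.charts_atD[OF z(1)] by (rule cot.chart_inv_snd)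
  have eq: "J y (X (chart_inv e y) e) = cot_J (chart_inv e y) (X (chart_inv e y)) e" if y: "y \<in> NN" for y
    using cot_J_comp[OF chart_inv_e(1)[OF y] _ cot.vector_fieldsD(1)[OF X]] y by (simp add: chart_inv_e)
  have "((\<lambda>y. J y (X (chart_inv e y) e)) has_derivative
    (\<lambda>d. dJ (snd e z) d (X (chart_inv e (snd e z)) e)
      + J (snd e z) (FD (\<lambda>y. X (chart_inv e y) e) (snd e z) d))) (at (snd e z))"
    by (rule has_derivative_J[OF z(2) cot.vector_fieldsD(3)[OF X z(1)]])
  then show ?thesis
    unfolding z0 by (rule has_derivative_transform_within_open[OF _ open_NN z(2) eq])
qed

text \<open>Expanding the four brackets makes the derivatives of \<open>X\<close> and
  \<open>Y\<close> cancel. Tangency is recorded as well, because it allows vanishing of the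
  component in the single chart \<open>e\<close> to give vanishing of the vector.\<close>

lemma nijenhuis_chart:
  assumes z: "e \<in> charts_at (cot_atlas A) z" "snd e z \<in> NN"
    and X: "X \<in> vector_fields (cot_atlas A)" and Y: "Y \<in> vector_fields (cot_atlas A)"
  shows "nijenhuis (cot_atlas A) cot_J X Y z \<in> tangent_space (cot_atlas A) z"
    and "nijenhuis (cot_atlas A) cot_J X Y z e = nij (snd e z) (X z e) (Y z e)"
proof -
  let ?A = "cot_atlas A" and ?y = "snd e z"
  let ?JX = "\<lambda>q. cot_J q (X q)" and ?JY = "\<lambda>q. cot_J q (Y q)"
  have zp: "z \<in> points ?A" by (rule cot.points_charts[OF z(1)])
  have t: "q \<in> points ?A \<Longrightarrow> X q \<in> tangent_space ?A q" "q \<in> points ?A \<Longrightarrow> Y q \<in> tangent_space ?A q"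
    "q \<in> points ?A \<Longrightarrow> ?JX q \<in> tangent_space ?A q" "q \<in> points ?A \<Longrightarrow> ?JY q \<in> tangent_space ?A q" for q
    using cot.vector_fieldsD(1)[OF X] cot.vector_fieldsD(1)[OF Y] cot_J_in by auto
  note dJX = has_derivative_cot_J[OF z X] and dJY = has_derivative_cot_J[OF z Y]
  note d = cot.vector_fieldsD(3)[OF X z(1)] cot.vector_fieldsD(3)[OF Y z(1)]
    differentiableI[OF dJX] differentiableI[OF dJY]
  have b: "bracket ?A ?JX ?JY z \<in> tangent_space ?A z" "bracket ?A ?JX Y z \<in> tangent_space ?A z"
    "bracket ?A X ?JY z \<in> tangent_space ?A z" "bracket ?A X Y z \<in> tangent_space ?A z"
    by (rule cot.bracket_in_tangent[OF z(1) t(3) d(3) t(4) d(4)] cot.bracket_in_tangent[OF z(1) t(3) d(3) t(2) d(2)]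
      cot.bracket_in_tangent[OF z(1) t(1) d(1) t(4) d(4)] cot.bracket_in_tangent[OF z(1) t(1) d(1) t(2) d(2)]; assumption)+
  show "nijenhuis ?A cot_J X Y z \<in> tangent_space ?A z"
    unfolding nijenhuis_def by (intro cot.vdiff_in cot_J_in zp b)
  show "nijenhuis ?A cot_J X Y z e = nij ?y (X z e) (Y z e)"
    unfolding nijenhuis_def vdiff_def cot_J_comp[OF z b(2)] cot_J_comp[OF z b(3)]
      cot.bracket_apply[OF z(1)] FD_eq[OF dJX] FD_eq[OF dJY] cot_J_comp[OF z t(1)[OF zp]]
      cot_J_comp[OF z t(2)[OF zp]]
    by (simp add: nij_def linear_add[OF linear_J[OF z(2)]] linear_diff[OF linear_J[OF z(2)]] J_J[OF z(2)])
qed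

section \<open>Curvature and compatibility in coordinates\<close>

lemma D_comp:
  assumes "X \<in> vector_fields A" "Y \<in> vector_fields A" "x \<in> N"
  shows "D X Y (chart_inv c x) c = FD (\<lambda>x. Y (chart_inv c x) c) x (X (chart_inv c x) c)
    + \<Gamma> x (X (chart_inv c x) c) (Y (chart_inv c x) c)"
  using christoffelD(3)[OF \<Gamma>(1) assms(1,2)] assms(3) by (simp add: N_chart)

lemma field_differentiable: "X \<in> vector_fields A \<Longrightarrow> x \<in> N \<Longrightarrow> (\<lambda>x. X (chart_inv c x) c) differentiable at x"
  using vector_fieldsD(3)[of X c "chart_inv c x"] N_chart by auto

lemma D_D_comp:
  assumes X: "X \<in> vector_fields A" and Y: "Y \<in> vector_fields A" and Z: "Z \<in> vector_fields A"
    and x: "x \<in> N"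
  defines "X0 \<equiv> X (chart_inv c x) c" and "Y0 \<equiv> Y (chart_inv c x) c" and "Z0 \<equiv> Z (chart_inv c x) c"
    and "dY \<equiv> FD (\<lambda>x. Y (chart_inv c x) c) x" and "dZ \<equiv> FD (\<lambda>x. Z (chart_inv c x) c) x"
  shows "D X (D Y Z) (chart_inv c x) c =
    FD (\<lambda>x'. FD (\<lambda>x. Z (chart_inv c x) c) x' Y0) x X0 + dZ (dY X0)
    + dG x X0 Y0 Z0 + \<Gamma> x Y0 (dZ X0) + \<Gamma> x (dY X0) Z0 + \<Gamma> x X0 (dZ Y0) + \<Gamma> x X0 (\<Gamma> x Y0 Z0)"
proof -
  let ?Y = "\<lambda>x. Y (chart_inv c x) c" and ?Z = "\<lambda>x. Z (chart_inv c x) c"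
  have Z': "smooth_on N ?Z" by (rule smooth_on_subset[OF vector_fieldsD(2)[OF Z c] N])
  have lin: "linear (FD ?Z x')" if "x' \<in> N" for x'
    by (rule bounded_linear.linear[OF FD_bounded_linear[OF field_differentiable[OF Z that]]])
  have 1: "((\<lambda>x. FD ?Z x (?Y x)) has_derivative (\<lambda>d. FD (\<lambda>x'. FD ?Z x' Y0) x d + dZ (dY d))) (at x)"
    unfolding Y0_def dY_def dZ_def
    by (rule has_derivative_linear_field[OF open_nbhd x lin smooth_on_differentiable[OF smooth_on_FD[OF Z'] x]
        field_differentiable[OF Y x]])
  have 2: "((\<lambda>x. \<Gamma> x (?Y x) (?Z x)) has_derivative (\<lambda>d. dG x d Y0 Z0 + \<Gamma> x Y0 (dZ d) + \<Gamma> x (dY d) Z0)) (at x)"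
    unfolding Y0_def dY_def dZ_def Z0_def
    by (rule has_derivative_G_field[OF x field_differentiable[OF Y x] field_differentiable[OF Z x]])
  have eq: "FD ?Z x (?Y x) + \<Gamma> x (?Y x) (?Z x) = D Y Z (chart_inv c x) c" if "x \<in> N" for x
    using D_comp[OF Y Z that] by simp
  have "((\<lambda>x. D Y Z (chart_inv c x) c) has_derivative (\<lambda>d. FD (\<lambda>x'. FD ?Z x' Y0) x d + dZ (dY d)
      + (dG x d Y0 Z0 + \<Gamma> x Y0 (dZ d) + \<Gamma> x (dY d) Z0))) (at x)"
    using has_derivative_add[OF 1 2] by (rule has_derivative_transform_within_open[OF _ open_nbhd x eq])
  from FD_eq[OF this] show ?thesis
    using D_comp[OF X conn_in[OF Y Z] x] D_comp[OF Y Z x]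
    by (simp add: X0_def[symmetric] Y0_def[symmetric] Z0_def[symmetric] dZ_def[symmetric] linear_add[OF \<Gamma>(3)])
qed

text \<open>Upon exchanging \<open>X\<close> and \<open>Y\<close> and subtracting, the second
  derivatives of \<open>Z\<close> cancel by symmetry, and so do the terms with a Christoffel symbol
  applied to a derivative of \<open>Z\<close>. The terms with derivatives of \<open>X\<close> and
  \<open>Y\<close> form the bracket and cancel against \<open>D (bracket A X Y) Z\<close>.\<close>

lemma curvature_comp:
  assumes X: "X \<in> vector_fields A" and Y: "Y \<in> vector_fields A" and Z: "Z \<in> vector_fields A"
    and x: "x \<in> N"
  shows "curvature A D X Y Z (chart_inv c x) c =
    curv x (X (chart_inv c x) c) (Y (chart_inv c x) c) (Z (chart_inv c x) c)"
proof -
  let ?q = "chart_inv c x"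
  have Z': "smooth_on N (\<lambda>x. Z (chart_inv c x) c)" by (rule smooth_on_subset[OF vector_fieldsD(2)[OF Z c] N])
  have lin: "linear (FD (\<lambda>x. Z (chart_inv c x) c) x)"
    by (rule bounded_linear.linear[OF FD_bounded_linear[OF field_differentiable[OF Z x]]])
  have sym: "FD (\<lambda>x'. FD (\<lambda>x. Z (chart_inv c x) c) x' (Y ?q c)) x (X ?q c)
      = FD (\<lambda>x'. FD (\<lambda>x. Z (chart_inv c x) c) x' (X ?q c)) x (Y ?q c)"
    by (rule FD_commute[OF open_nbhd x Z'])
  show ?thesis
    unfolding curvature_def vdiff_def D_D_comp[OF X Y Z x] D_D_comp[OF Y X Z x]
      D_comp[OF bracket_vector_field[OF X Y] Z x] bracket_apply[OF N_chart(1)[OF x]] N_chart(2)[OF x]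
    by (simp add: sym curv_def linear_diff[OF lin] linear_diff[OF \<Gamma>(4)])
qed

lemma form_comp_at: "x \<in> N \<Longrightarrow> v \<in> tangent_space A (chart_inv c x) \<Longrightarrow> w \<in> tangent_space A (chart_inv c x) \<Longrightarrow>
    \<omega> (chart_inv c x) v w = form_comp c (chart_inv c x) (v c) \<bullet> w c"
  by (rule form_comp_inner[OF N_chart(1)])

lemma lie_form_comp:
  assumes X: "X \<in> vector_fields A" and Y: "Y \<in> vector_fields A" and Z: "Z \<in> vector_fields A"
    and x: "x \<in> N"
  shows "lie_deriv A X (\<lambda>q. \<omega> q (Y q) (Z q)) (chart_inv c x) =
    (dW x (X (chart_inv c x) c) (Y (chart_inv c x) c)
      + form_comp c (chart_inv c x) (FD (\<lambda>x. Y (chart_inv c x) c) x (X (chart_inv c x) c))) \<bullet> Z (chart_inv c x) c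
    + form_comp c (chart_inv c x) (Y (chart_inv c x) c) \<bullet> FD (\<lambda>x. Z (chart_inv c x) c) x (X (chart_inv c x) c)"
proof -
  have eq: "form_comp c (chart_inv c x) (Y (chart_inv c x) c) \<bullet> Z (chart_inv c x) c
      = \<omega> (chart_inv c x) (Y (chart_inv c x)) (Z (chart_inv c x))" if "x \<in> N" for x
    using form_comp_at[OF that vector_fieldsD(1)[OF Y] vector_fieldsD(1)[OF Z]] by simp
  have d: "((\<lambda>x. \<omega> (chart_inv c x) (Y (chart_inv c x)) (Z (chart_inv c x))) has_derivative
      (\<lambda>d. (dW x d (Y (chart_inv c x) c) + form_comp c (chart_inv c x) (FD (\<lambda>x. Y (chart_inv c x) c) x d))
          \<bullet> Z (chart_inv c x) c
        + form_comp c (chart_inv c x) (Y (chart_inv c x) c) \<bullet> FD (\<lambda>x. Z (chart_inv c x) c) x d)) (at x)"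
    using has_derivative_W_field[OF x field_differentiable[OF Y x] field_differentiable[OF Z x]]
    by (rule has_derivative_transform_within_open[OF _ open_nbhd x eq])
  have "lie_deriv A X (\<lambda>q. \<omega> q (Y q) (Z q)) (chart_inv c x) =
      FD (\<lambda>x. \<omega> (chart_inv c x) (Y (chart_inv c x)) (Z (chart_inv c x))) (snd c (chart_inv c x))
        (X (chart_inv c x) c)"
    using differentiableI[OF d]
    by (intro lie_deriv_chart N_chart(1)[OF x] vector_fieldsD(1)[OF X]) (simp add: N_chart(2)[OF x])
  then show ?thesis unfolding N_chart(2)[OF x] FD_eq[OF d] .
qed

text \<open>The derivative of \<open>W\<close> along \<open>Z\<close> occurs in the exterior and in
  the covariant derivative and cancels. The Christoffel terms of the covariant derivative, in which
  \<open>Z\<close> is the direction, cancel against the same terms of the torsion; those of the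
  torsion with \<open>Z\<close> differentiated along \<open>X\<close> and \<open>Y\<close> survive.
  Derivatives of the fields cancel with the brackets.\<close>

lemma compat_comp:
  assumes X: "X \<in> vector_fields A" and Y: "Y \<in> vector_fields A" and Z: "Z \<in> vector_fields A"
    and x: "x \<in> N"
  shows "compat X Y Z (chart_inv c x) =
    defect x (X (chart_inv c x) c) (Y (chart_inv c x) c) (Z (chart_inv c x) c)"
proof -
  let ?q = "chart_inv c x" and ?W = "form_comp c (chart_inv c x)"
  note b = vector_fieldsD(1)[OF bracket_vector_field]
  note t = vector_fieldsD(1)[OF X, of ?q] vector_fieldsD(1)[OF Y, of ?q] vector_fieldsD(1)[OF Z, of ?q]
    b[OF X Y, of ?q] b[OF X Z, of ?q] b[OF Y Z, of ?q] b[OF Z X, of ?q] b[OF Z Y, of ?q]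
    vector_fieldsD(1)[OF conn_in[OF Z X], of ?q] vector_fieldsD(1)[OF conn_in[OF Z Y], of ?q]
    vector_fieldsD(1)[OF conn_in[OF X Z], of ?q] vector_fieldsD(1)[OF conn_in[OF Y Z], of ?q]
  have skew: "?W u \<bullet> v = - (?W v \<bullet> u)" for u v
    using form_skew[OF points_charts[OF N_chart(1)[OF x]] coord_vec_in[OF N_chart(1)[OF x]]
        coord_vec_in[OF N_chart(1)[OF x]], of u v]
    by (simp add: form_comp_at[OF x coord_vec_in[OF N_chart(1)[OF x]] coord_vec_in[OF N_chart(1)[OF x]]]
        coord_vec_self[OF N_chart(1)[OF x]])
  note lin = linear_add[OF linear_form_comp[OF N_chart(1)[OF x]]] linear_diff[OF linear_form_comp[OF N_chart(1)[OF x]]]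
  \<comment> \<open>Oriented instances of \<open>skew\<close>, which as a rewrite rule would undo
    itself: \<open>Z\<close> goes to the second slot, and \<open>X\<close> or \<open>Y\<close> to
    the first when paired with a derivative or a Christoffel term.\<close>
  have s: "?W (Z ?q c) \<bullet> u = - (?W u \<bullet> Z ?q c)" "?W (FD f x u) \<bullet> X ?q c = - (?W (X ?q c) \<bullet> FD f x u)"
    "?W (FD f x u) \<bullet> Y ?q c = - (?W (Y ?q c) \<bullet> FD f x u)"
    "?W (\<Gamma> x u v) \<bullet> X ?q c = - (?W (X ?q c) \<bullet> \<Gamma> x u v)"
    "?W (\<Gamma> x u v) \<bullet> Y ?q c = - (?W (Y ?q c) \<bullet> \<Gamma> x u v)" for u v f
    by (rule skew)+
  show ?thesis
    unfolding compat_def ext_deriv2_def cov_deriv2_def torsion_def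
      lie_form_comp[OF X Y Z x] lie_form_comp[OF Y X Z x] lie_form_comp[OF Z X Y x]
    by (simp add: form_comp_at[OF x] t vdiff_in)
      (simp add: vdiff_def D_comp[OF Z X x] D_comp[OF Z Y x] D_comp[OF X Z x] D_comp[OF Y Z x]
       bracket_apply[OF N_chart(1)[OF x]] N_chart(2)[OF x] lin inner_add_left inner_diff_left
       inner_add_right inner_diff_right s defect_def)
qed

end

section \<open>Horizontal lifts of vector fields and the equivalence\<close>

context nondegenerate_form
begin

lemma adapted_chart_exists:
  assumes "c \<in> charts_at A p"
  obtains N \<Gamma> where "adapted_chart T A D \<omega> c N \<Gamma>" "snd c p \<in> N"
proof -
  obtain \<Gamma> :: "'e \<Rightarrow> 'e \<Rightarrow> 'e \<Rightarrow> 'e" and N where N: "open N" "snd c p \<in> N" "N \<subseteq> snd c ` fst c"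
    "\<forall>x\<in>N. christoffel c (chart_inv c x) (\<Gamma> x)" "\<forall>u v. smooth_on N (\<lambda>x. \<Gamma> x u v)"
    "\<forall>x u. linear (\<Gamma> x u)" "\<forall>x v. linear (\<lambda>u. \<Gamma> x u v)"
    by (rule christoffel_near[OF assms])
  have "adapted_chart T A D \<omega> c N \<Gamma>"
  proof (intro adapted_chart.intro adapted_chart_axioms.intro nondegenerate_form_axioms)
    show "c \<in> A" "open N" "N \<subseteq> snd c ` fst c" by (fact charts_atD(1)[OF assms] N)+
    show "christoffel c (chart_inv c x) (\<Gamma> x)" if "x \<in> N" for x using N(4) that by (rule bspec)
  qed (use N(5-7) in blast)+
  from that[OF this N(2)] show thesis .
qed

text \<open>\<open>vector_fields\<close> constrains every \<open>z\<close>, and outside the bundle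
  the tangent space is \<open>{0}\<close>, whereas \<open>hlift\<close> has no known value there;
  hence the default \<open>0\<^sub>v\<close>.\<close>

definition hlift_field :: "('a, 'e) vfield \<Rightarrow> (('a, 'e) ctpoint, 'e \<times> 'e) vfield" where
  "hlift_field X z = (if z \<in> points (cot_atlas A) then hlift A D z (X (fst z)) else 0\<^sub>v)"

lemma hlift_field_comp:
  assumes ac: "adapted_chart T A D \<omega> c N \<Gamma>"
    and z: "cot_chart A c \<in> charts_at (cot_atlas A) z" "snd c (fst z) \<in> N" and X: "X \<in> vector_fields A"
  shows "hlift_field X z \<in> tangent_space (cot_atlas A) z"
    and "hlift_field X z (cot_chart A c) = chart_data.H \<Gamma> (snd (cot_chart A c) z) (X (fst z) c)"
proof -
  interpret adapted_chart T A D \<omega> c N \<Gamma> by fact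
  have z2: "snd e z \<in> NN" using z by (simp add: snd_cot_chart)
  have "hlift_field X z = coord_vec (cot_atlas A) e z
      (X (fst z) c, hor (\<Gamma> (snd c (fst z))) (cov_comp c (fst z) (snd z)) (X (fst z) c))"
    using cot.points_charts[OF z(1)] hlift_chart[OF e_charts_atD[OF z(1) z2] vector_fieldsD(1)[OF X]]
    by (simp add: hlift_field_def)
  then show "hlift_field X z \<in> tangent_space (cot_atlas A) z"
    and "hlift_field X z (cot_chart A c) = H (snd (cot_chart A c) z) (X (fst z) c)"
    using z(1) by (simp_all add: cot.coord_vec_in cot.coord_vec_self H_def h_def snd_cot_chart)
qed

text \<open>In an induced chart the components are those of \<open>X\<close> and their image under
  the smooth matrix field \<open>h\<close>. As smoothness is local, neighbourhoods from adapted
  charts are enough.\<close>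

lemma hlift_field_in:
  assumes X: "X \<in> vector_fields A"
  shows "hlift_field X \<in> vector_fields (cot_atlas A)"
  unfolding vector_fields_def
proof (intro CollectI conjI allI ballI)
  fix z
  show "hlift_field X z \<in> tangent_space (cot_atlas A) z"
  proof (cases "z \<in> points (cot_atlas A)")
    case True
    then obtain c where c: "c \<in> charts_at A (fst z)" "snd z \<in> cotangent_space A (fst z)"
      by (rule cot_pointsE)
    obtain N \<Gamma> where "adapted_chart T A D \<omega> c N \<Gamma>" "snd c (fst z) \<in> N"
      by (rule adapted_chart_exists[OF c(1)])
    then show ?thesis using hlift_field_comp(1)[OF _ cot_charts_atI[OF c] _ X] by blast
  next
    case False
    then show ?thesis by (simp add: hlift_field_def cot.vzero_in)
  qed
next
  fix e assume "e \<in> cot_atlas A"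
  then obtain c where c: "c \<in> A" "e = cot_chart A c" by (auto simp: cot_atlas_def)
  show "smooth_on (snd e ` fst e) (\<lambda>y. hlift_field X (chart_inv e y) e)"
  proof (rule smooth_on_local)
    fix y assume "y \<in> snd e ` fst e"
    then have x: "fst y \<in> snd c ` fst c" by (auto simp: c snd_cot_chart fst_cot_chart)
    obtain N \<Gamma> where ac: "adapted_chart T A D \<omega> c N \<Gamma>" and "snd c (chart_inv c (fst y)) \<in> N"
      by (rule adapted_chart_exists[OF charts_at_chart_inv[OF c(1) x]])
    then have y: "y \<in> N \<times> UNIV" using x by (simp add: snd_chart_inv mem_Times_iff)
    interpret ac: adapted_chart T A D \<omega> c N \<Gamma> by fact
    have eq: "hlift_field X (chart_inv e y) e = (X (chart_inv c (fst y)) c, ac.h y (X (chart_inv c (fst y)) c))"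
      if y: "y \<in> N \<times> UNIV" for y
      using hlift_field_comp(2)[OF ac ac.chart_inv_e(1)[OF y] _ X] y
      by (simp add: c(2) ac.chart_inv_e ac.N_chart ac.H_def mem_Times_iff)
    have X': "smooth_on (N \<times> (UNIV :: 'e set)) (\<lambda>y. X (chart_inv c (fst y)) c)"
      by (rule ac.smooth_fst_compose[OF smooth_on_subset[OF vector_fieldsD(2)[OF X c(1)] ac.N]])
    have "smooth_on (N \<times> UNIV) (\<lambda>y. (X (chart_inv c (fst y)) c, ac.h y (X (chart_inv c (fst y)) c)))"
      by (intro smooth_on_Pair ac.open_NN X' smooth_on_linear_field[OF ac.open_NN ac.linear_h ac.smooth_h X'])
    moreover have "smooth_on (N \<times> UNIV) (\<lambda>y. hlift_field X (chart_inv e y) e) \<longleftrightarrow>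
        smooth_on (N \<times> UNIV) (\<lambda>y. (X (chart_inv c (fst y)) c, ac.h y (X (chart_inv c (fst y)) c)))"
      by (rule smooth_on_cong[OF ac.open_NN eq])
    ultimately show "\<exists>N. open N \<and> y \<in> N \<and> smooth_on N (\<lambda>y. hlift_field X (chart_inv e y) e)"
      using y ac.open_NN by blast
  qed
qed

text \<open>From left to right, horizontal lifts of fields of the base are tested at all covectors
  over a point. From right to left no lifts occur: \<open>nij\<close> depends on the values of the
  fields only, and vectors \<open>u\<close>, \<open>v\<close>, \<open>w\<close> of the model space
  are values of global fields of the base, on which both conditions are available.\<close>

lemma integrable_iff:
  "integrable_structure (cot_atlas A) cot_J \<longleftrightarrow> flat A D \<and>
    (\<forall>X\<in>vector_fields A. \<forall>Y\<in>vector_fields A. \<forall>Z\<in>vector_fields A. \<forall>p\<in>points A. compat X Y Z p = 0)"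
proof (intro iffI conjI)
  assume int: "integrable_structure (cot_atlas A) cot_J"
  have main: "curvature A D X Y Z p = 0\<^sub>v \<and> compat X Y Z p = 0"
    if X: "X \<in> vector_fields A" and Y: "Y \<in> vector_fields A" and Z: "Z \<in> vector_fields A"
      and p: "p \<in> points A" for X Y Z p
  proof -
    obtain c where c: "c \<in> charts_at A p" using p points_iff by blast
    obtain N \<Gamma> where ac: "adapted_chart T A D \<omega> c N \<Gamma>" and N: "snd c p \<in> N"
      by (rule adapted_chart_exists[OF c])
    interpret ac: adapted_chart T A D \<omega> c N \<Gamma> by fact
    have cp: "chart_inv c (snd c p) = p" using charts_atD[OF c] by (rule chart_inv_snd)
    have *: "(\<forall>w. ac.defect (snd c p) (X p c) (Y p c) w = 0) \<and>
        (\<forall>w. \<xi> \<bullet> ac.curv (snd c p) (X p c) (Y p c) w = 0)" for \<xi>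
    proof -
      let ?z = "(p, cov_of c p \<xi>)"
      have z: "cot_chart A c \<in> charts_at (cot_atlas A) ?z"
        using c by (intro cot_charts_atI) (simp_all add: cov_of_in)
      have sz: "snd (cot_chart A c) ?z = (snd c p, \<xi>)" by (simp add: snd_cot_chart cov_comp_of[OF c])
      then have zN: "snd (cot_chart A c) ?z \<in> N \<times> UNIV" using N by simp
      have "nijenhuis (cot_atlas A) cot_J (hlift_field X) (hlift_field Y) ?z = 0\<^sub>v"
        using int hlift_field_in[OF X] hlift_field_in[OF Y] cot.points_charts[OF z]
        unfolding integrable_structure_def by blast
      then have "ac.nij (snd (cot_chart A c) ?z) (hlift_field X ?z (cot_chart A c)) (hlift_field Y ?z (cot_chart A c)) = 0"
        using ac.nijenhuis_chart(2)[OF z zN hlift_field_in[OF X] hlift_field_in[OF Y]] by (simp add: vzero_def)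
      then have "ac.nij (snd c p, \<xi>) (ac.H (snd c p, \<xi>) (X p c)) (ac.H (snd c p, \<xi>) (Y p c)) = 0"
        using hlift_field_comp(2)[OF ac z _ X] hlift_field_comp(2)[OF ac z _ Y] N by (simp add: sz)
      then show ?thesis using ac.nij_H_zero_iff[of "(snd c p, \<xi>)"] N by simp
    qed
    \<comment> \<open>The curvature vector itself is chosen as the point of the fibre, so that its
      squared norm vanishes.\<close>
    have "ac.curv (snd c p) (X p c) (Y p c) (Z p c) = 0"
      using *[of "ac.curv (snd c p) (X p c) (Y p c) (Z p c)"] by (metis inner_eq_zero_iff)
    then have "curvature A D X Y Z p c = 0\<^sub>v c"
      using ac.curvature_comp[OF X Y Z N] by (simp add: cp vzero_def)
    moreover have "curvature A D X Y Z p \<in> tangent_space A p"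
      unfolding curvature_def
      by (intro vdiff_in vector_fieldsD(1)[OF conn_in] conn_in bracket_vector_field X Y Z)
    ultimately have "curvature A D X Y Z p = 0\<^sub>v" using tangent_eqI[OF c _ vzero_in] by blast
    moreover have "compat X Y Z p = 0"
      using ac.compat_comp[OF X Y Z N] * by (simp add: cp)
    ultimately show ?thesis by blast
  qed
  show "flat A D" unfolding flat_def using main by blast
  show "\<forall>X\<in>vector_fields A. \<forall>Y\<in>vector_fields A. \<forall>Z\<in>vector_fields A. \<forall>p\<in>points A. compat X Y Z p = 0"
    using main by blast
next
  assume R: "flat A D \<and>
    (\<forall>X\<in>vector_fields A. \<forall>Y\<in>vector_fields A. \<forall>Z\<in>vector_fields A. \<forall>p\<in>points A. compat X Y Z p = 0)"
  show "integrable_structure (cot_atlas A) cot_J"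
    unfolding integrable_structure_def
  proof (intro ballI)
    fix P Q z assume P: "P \<in> vector_fields (cot_atlas A)" and Q: "Q \<in> vector_fields (cot_atlas A)"
      and z: "z \<in> points (cot_atlas A)"
    obtain c where c: "c \<in> charts_at A (fst z)" "snd z \<in> cotangent_space A (fst z)"
      using z by (rule cot_pointsE)
    note e = cot_charts_atI[OF c]
    obtain N \<Gamma> where ac: "adapted_chart T A D \<omega> c N \<Gamma>" and N: "snd c (fst z) \<in> N"
      by (rule adapted_chart_exists[OF c(1)])
    interpret ac: adapted_chart T A D \<omega> c N \<Gamma> by fact
    let ?x = "snd c (fst z)" and ?y = "snd (cot_chart A c) z"
    have cp: "chart_inv c ?x = fst z" using charts_atD[OF c(1)] by (rule chart_inv_snd)
    have y: "?y \<in> N \<times> UNIV" "fst ?y = ?x" using N by (simp_all add: snd_cot_chart)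
    have "ac.defect ?x u v w = 0 \<and> ac.curv ?x u v w = 0" for u v w
    proof -
      obtain X where X: "X \<in> vector_fields A" "X (fst z) c = u" by (rule vector_field_through[OF c(1)])
      obtain Y where Y: "Y \<in> vector_fields A" "Y (fst z) c = v" by (rule vector_field_through[OF c(1)])
      obtain Z where Z: "Z \<in> vector_fields A" "Z (fst z) c = w" by (rule vector_field_through[OF c(1)])
      have "compat X Y Z (fst z) = 0" "curvature A D X Y Z (fst z) = 0\<^sub>v"
        using R X(1) Y(1) Z(1) points_charts[OF c(1)] unfolding flat_def by blast+
      then show ?thesis
        using ac.compat_comp[OF X(1) Y(1) Z(1) N] ac.curvature_comp[OF X(1) Y(1) Z(1) N]
        by (simp add: cp X(2) Y(2) Z(2) vzero_def)
    qed
    then have "ac.nij ?y (ac.H ?y u) (ac.H ?y v) = 0" for u v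
      using ac.nij_H_zero_iff[OF y(1)] by (simp add: y(2))
    then have "ac.nij ?y (P z (cot_chart A c)) (Q z (cot_chart A c)) = 0"
      by (rule ac.nij_zeroI[OF y(1)])
    then have "nijenhuis (cot_atlas A) cot_J P Q z (cot_chart A c) = 0\<^sub>v (cot_chart A c)"
      using ac.nijenhuis_chart(2)[OF e y(1) P Q] by (simp add: vzero_def)
    then show "nijenhuis (cot_atlas A) cot_J P Q z = 0\<^sub>v"
      using cot.tangent_eqI[OF e ac.nijenhuis_chart(1)[OF e y(1) P Q] cot.vzero_in] by blast
  qed
qed

end

theorem lemma35:
  fixes T :: "'a topology"
    and A :: "('a, 'e::euclidean_space) chart set"
    and \<omega> :: "'a \<Rightarrow> ('a, 'e) tvec \<Rightarrow> ('a, 'e) tvec \<Rightarrow> real"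
    and D :: "('a, 'e) conn"
  assumes "smooth_manifold T A"
    and "\<omega> \<in> two_forms A"
    and "nondegenerate A \<omega>"
    and "linear_connection A D"
  shows "integrable_structure (cot_atlas A) (cot_structure A D (J_form A \<omega>)) \<longleftrightarrow>
    flat A D \<and>
    (\<forall>X\<in>vector_fields A. \<forall>Y\<in>vector_fields A. \<forall>Z\<in>vector_fields A. \<forall>p\<in>points A.
       ext_deriv2 A \<omega> X Y Z p - cov_deriv2 A D \<omega> Z X Y p
       - \<omega> p (torsion A D Z X p) (Y p) - \<omega> p (X p) (torsion A D Z Y p) = 0)"
proof -
  interpret nondegenerate_form T A D \<omega> by unfold_locales fact+
  show ?thesis using integrable_iff unfolding compat_def .
qed

end
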